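(* Let $\beta\geq -1$ be real and let $X_0,X_1,X_2,X_3,X_4$ be independent identically distributed random points in the four-dimensional unit ball $\mathbb{B}^4$ sampled from the beta distribution $f_{4,\beta}$ (for $\beta=-1$: the uniform distribution on the unit sphere $\mathbb{S}^3$). Let $T_\beta:=[X_0,\ldots,X_4]$ be their convex hull. Then the expected sum of the solid angles of the $4$-dimensional simplex $T_\beta$ at its vertices is $$ \mathbb{E}\, s_0(T_\beta) = \frac 32 - \frac{5\, \Gamma^2(\beta+3)\,\Gamma(3\beta+7)}{\pi^{3/2}\, \Gamma^2(\beta + \frac 5 2)\,\Gamma(3\beta + \frac {13}2)} \int_{-\pi/2}^{+\pi/2} (\cos\varphi)^{6\beta+12} \left(\int_{-\pi/2}^\varphi (\cos \theta)^{2\beta+4}\,\mathrm{d}\theta\right)^2 \mathrm{d} \varphi. $$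
   Context: For $d\in\mathbb{N}$ and $\beta>-1$, the $d$-dimensional beta distribution with parameter $\beta$ is the probability distribution on $\mathbb{R}^d$ with Lebesgue density $$f_{d,\beta}(x)=c_{d,\beta}\,(1-\|x\|^2)^\beta\,\mathbf{1}_{\{\|x\|<1\}},\qquad c_{d,\beta}=\frac{\Gamma(\frac d2+\beta+1)}{\pi^{d/2}\,\Gamma(\beta+1)},$$ where $\|\cdot\|$ is the Euclidean norm. For $\beta=-1$, by convention, the distribution $f_{d,-1}$ is the uniform distribution on the unit sphere $\mathbb{S}^{d-1}=\{x\in\mathbb{R}^d\colon\|x\|=1\}$ (the weak limit as $\beta\downarrow-1$). $\mathbb{B}^d=\{x\in\mathbb{R}^d\colon\|x\|\le 1\}$. For a $d$-dimensional convex polytope $P\subset\mathbb{R}^d$ with vertex set $\mathcal{F}_0(P)$, the internal (solid) angle of $P$ at a vertex $x_0$, normalized so that the full solid angle equals $1$, is $$\beta(x_0,P):=\mathbb{P}[\exists\, \varepsilon>0 \text{ such that } x_0+\varepsilon U\in P],$$ where $U$ is a random vector uniformly distributed on $\mathbb{S}^{d-1}$ (this function $\beta(\cdot,\cdot)$ is unrelated to the real parameter $\beta$). The angle sum at vertices is $s_0(P)=\sum_{x_0\in\mathcal{F}_0(P)}\beta(x_0,P)$. With probability $1$, the random convex hull $T_\beta$ is a $4$-dimensional simplex with vertices $X_0,\ldots,X_4$, so $s_0(T_\beta)$ is almost surely defined. $\Gamma$ is the Gamma function and $\Gamma^2(x)=(\Gamma(x))^2$. *)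

theory Defs
  imports "HOL-Probability.Probability"
begin

text \<open>
  The normalised surface measure on the unit sphere, obtained as the cone measure: the law of
  \<open>Y / norm Y\<close> for \<open>Y\<close> uniform on the unit ball. (The event \<open>Y = 0\<close>, where
  \<open>sgn Y = 0\<close>, has probability zero.)
\<close>

definition sphere_uniform :: "'a::euclidean_space measure" where
  "sphere_uniform = distr (uniform_measure lborel (ball 0 1)) borel sgn"

definition beta_density :: "real \<Rightarrow> 'a::euclidean_space \<Rightarrow> real" where
  "beta_density \<beta> x =
     Gamma (real DIM('a) / 2 + \<beta> + 1) / (pi powr (real DIM('a) / 2) * Gamma (\<beta> + 1))
     * (1 - (norm x)\<^sup>2) powr \<beta> * indicator {y. norm y < 1} x"

text \<open>Only meaningful for \<open>\<beta> \<ge> -1\<close>.\<close>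

definition beta_distribution :: "real \<Rightarrow> 'a::euclidean_space measure" where
  "beta_distribution \<beta> =
     (if \<beta> = -1 then sphere_uniform else density lborel (\<lambda>x. ennreal (beta_density \<beta> x)))"

definition solid_angle :: "'a::euclidean_space \<Rightarrow> 'a set \<Rightarrow> real" where
  "solid_angle x P = measure sphere_uniform {u. \<exists>\<epsilon>>0. x + \<epsilon> *\<^sub>R u \<in> P}"

definition vertex_angle_sum :: "'a::euclidean_space set \<Rightarrow> real" where
  "vertex_angle_sum P = (\<Sum>x | x extreme_point_of P. solid_angle x P)"

end

theory Submission
  imports Defs
begin

text \<open>
  Let \<open>\<mu>\<close> be the law of the points. By rotation invariance of \<open>\<mu>\<close> the uniform direction in the
  definition of the solid angle may be replaced by the fixed direction \<open>e\<^sub>4\<close>, so that twice the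
  expected angle sum is the probability that, after projection along \<open>e\<^sub>4\<close> to \<open>\<real>\<^sup>3\<close>, one of the five
  points lies in the convex hull of the others. Generically the projected points have a unique affine
  dependence, with sign pattern \<open>1 | 4\<close> (exactly that event) or \<open>2 | 3\<close>. The plane through three of
  them separates the other two iff the latter have coefficients of the same sign, which happens for
  six of the ten triples in the first case and for four in the second. Hence the expected angle sum
  is \<open>5/2 * P - 1\<close>, where \<open>P\<close> is the probability that the plane through three points separates the
  other two.

  The projected points have the density \<open>const * (1 - |x|\<^sup>2) powr (\<beta> + 1/2)\<close>. Writing three of them
  as points of the graph of \<open>a x + b y + c\<close> and substituting \<open>(a, b, c)\<close> for the three heights shows
  that the signed distance \<open>t\<close> of their plane from the origin has density
  \<open>const * (1 - t\<^sup>2) powr (3 \<beta> + 11/2)\<close>. A half space at signed distance \<open>t\<close> has mass \<open>F t\<close>, where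
  \<open>F\<close> has density \<open>const * (1 - t\<^sup>2) powr (\<beta> + 3/2)\<close>, so \<open>P = 1 - 2 E (F t)\<^sup>2\<close>. All normalising
  constants follow from total mass one.
\<close>


section \<open>Substitutions in the plane and in space\<close>

text \<open>That a point lies in the hull of four others involves all five points at once.
  Separation by a plane does not: once three points are fixed, the other two are independent and
  each enters only through its signed distance along the normal of the plane, so everything reduces
  to one-dimensional laws. The numbers \<open>5/2\<close> and \<open>-1\<close> come from taking
  means in the count: if \<open>k\<close> is the mean solid angle at one vertex, the ten triples and
  the ten pairs of a vertex and a direction \<open>e4\<close> or \<open>-e4\<close> give
  \<open>10 P = 4 + 20 k\<close>, and the expected sum is \<open>5 k\<close>.

  Integrals stay in \<open>ennreal\<close> and unnormalised until the last stage: Fubini then asks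
  for no integrability, and an unknown constant may be infinite until a total mass of one pins it.
  The case \<beta> = -1, without a density in R^4, joins the others after the projection, which
  always has one. Degenerate samples do harm nowhere: they are null for the count, and for the angle
  sum the formula in terms of cones reads \<open>0 = 0\<close>, so that the angle sum is a
  measurable function of the points everywhere.\<close>

text \<open>The power and the indicator of the open ball in one factor; the cut-off also hides the
  values of \<open>powr\<close> at negative arguments. Positive scalings pull out of it as
  constants, whatever the sign of the rest.\<close>

definition pospow :: "real \<Rightarrow> real \<Rightarrow> ennreal" where
  "pospow \<kappa> s = (if s > 0 then ennreal (s powr \<kappa>) else 0)"

lemma pospow_measurable [measurable]: "pospow \<kappa> \<in> borel_measurable borel"
  unfolding pospow_def [abs_def] by measurable

lemma pospow_mult: "m > 0 \<Longrightarrow> pospow \<kappa> (m * s) = pospow \<kappa> m * pospow \<kappa> s"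
  by (auto simp: pospow_def powr_mult zero_less_mult_iff simp flip: ennreal_mult)

lemma pospow_add: "pospow \<kappa> m * pospow \<kappa>' m = pospow (\<kappa> + \<kappa>') m"
  by (auto simp: pospow_def powr_add simp flip: ennreal_mult)

lemma measurable_curry3:
  assumes "(\<lambda>(x, y, z). f x y z) \<in> measurable (A \<Otimes>\<^sub>M B \<Otimes>\<^sub>M C) D"
    and "g \<in> measurable N A" "h \<in> measurable N B" "k \<in> measurable N C"
  shows "(\<lambda>x. f (g x) (h x) (k x)) \<in> measurable N D"
proof -
  have "(\<lambda>x. (g x, h x, k x)) \<in> measurable N (A \<Otimes>\<^sub>M B \<Otimes>\<^sub>M C)"
    using assms(2-) by simp
  from measurable_compose[OF this assms(1)] show ?thesis by simp
qed

text \<open>Two affine substitutions in one variable with Fubini between them: \<open>y\<close> for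
  fixed \<open>x\<close> with slope \<open>\<delta> / \<xi>1\<close>, then \<open>x\<close> for
  fixed \<open>b\<close> with slope \<open>\<xi>1\<close>. Their Jacobians multiply to the
  determinant; \<open>\<xi>1\<close> is the pivot of this elimination.\<close>

lemma nn_integral_shear:
  fixes f :: "real \<Rightarrow> real \<Rightarrow> ennreal"
  assumes f [measurable]: "(\<lambda>(x, y). f x y) \<in> borel_measurable (borel \<Otimes>\<^sub>M borel)"
    and "\<xi>1 \<noteq> 0" "\<xi>1 * \<eta>2 - \<xi>2 * \<eta>1 \<noteq> 0"
  shows "(\<integral>\<^sup>+x. \<integral>\<^sup>+y. f x y \<partial>lborel \<partial>lborel) = ennreal \<bar>\<xi>1 * \<eta>2 - \<xi>2 * \<eta>1\<bar> *
     (\<integral>\<^sup>+a. \<integral>\<^sup>+b. f (a * \<xi>1 + b * \<eta>1) (a * \<xi>2 + b * \<eta>2) \<partial>lborel \<partial>lborel)"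
proof -
  define \<delta> where "\<delta> = \<xi>1 * \<eta>2 - \<xi>2 * \<eta>1"
  have \<delta>: "\<delta> \<noteq> 0" using assms by (simp add: \<delta>_def)
  have "(\<integral>\<^sup>+x. \<integral>\<^sup>+y. f x y \<partial>lborel \<partial>lborel)
      = (\<integral>\<^sup>+x. ennreal \<bar>\<delta> / \<xi>1\<bar> * (\<integral>\<^sup>+b. f x (x * \<xi>2 / \<xi>1 + \<delta> / \<xi>1 * b) \<partial>lborel) \<partial>lborel)"
    using \<delta> assms by (intro nn_integral_cong nn_integral_real_affine) auto
  also have "\<dots> = ennreal \<bar>\<delta> / \<xi>1\<bar> * (\<integral>\<^sup>+x. \<integral>\<^sup>+b. f x (x * \<xi>2 / \<xi>1 + \<delta> / \<xi>1 * b) \<partial>lborel \<partial>lborel)"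
    by (rule nn_integral_cmult) measurable
  also have "(\<integral>\<^sup>+x. \<integral>\<^sup>+b. f x (x * \<xi>2 / \<xi>1 + \<delta> / \<xi>1 * b) \<partial>lborel \<partial>lborel)
     = (\<integral>\<^sup>+b. \<integral>\<^sup>+x. f x (x * \<xi>2 / \<xi>1 + \<delta> / \<xi>1 * b) \<partial>lborel \<partial>lborel)"
    by (rule lborel_pair.Fubini') measurable
  also have "\<dots> = (\<integral>\<^sup>+b. ennreal \<bar>\<xi>1\<bar> * (\<integral>\<^sup>+a. f (b * \<eta>1 + \<xi>1 * a) ((b * \<eta>1 + \<xi>1 * a) * \<xi>2 / \<xi>1 + \<delta> / \<xi>1 * b) \<partial>lborel) \<partial>lborel)"
    using assms by (intro nn_integral_cong nn_integral_real_affine) auto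
  also have "\<dots> = ennreal \<bar>\<xi>1\<bar> * (\<integral>\<^sup>+b. \<integral>\<^sup>+a. f (b * \<eta>1 + \<xi>1 * a) ((b * \<eta>1 + \<xi>1 * a) * \<xi>2 / \<xi>1 + \<delta> / \<xi>1 * b) \<partial>lborel \<partial>lborel)"
    by (rule nn_integral_cmult) measurable
  also have "(\<integral>\<^sup>+b. \<integral>\<^sup>+a. f (b * \<eta>1 + \<xi>1 * a) ((b * \<eta>1 + \<xi>1 * a) * \<xi>2 / \<xi>1 + \<delta> / \<xi>1 * b) \<partial>lborel \<partial>lborel)
     = (\<integral>\<^sup>+a. \<integral>\<^sup>+b. f (b * \<eta>1 + \<xi>1 * a) ((b * \<eta>1 + \<xi>1 * a) * \<xi>2 / \<xi>1 + \<delta> / \<xi>1 * b) \<partial>lborel \<partial>lborel)"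
    by (rule lborel_pair.Fubini') measurable
  also have "\<dots> = (\<integral>\<^sup>+a. \<integral>\<^sup>+b. f (a * \<xi>1 + b * \<eta>1) (a * \<xi>2 + b * \<eta>2) \<partial>lborel \<partial>lborel)"
    using \<open>\<xi>1 \<noteq> 0\<close> by (intro nn_integral_cong arg_cong2[where f = f]) (simp_all add: \<delta>_def field_simps)
  finally show ?thesis
    using \<open>\<xi>1 \<noteq> 0\<close> unfolding \<delta>_def[symmetric]
    by (simp add: mult.assoc[symmetric] ennreal_mult[symmetric] add.commute mult.commute abs_mult)
qed

lemma nn_integral_shift:
  fixes f :: "real \<Rightarrow> ennreal"
  assumes "f \<in> borel_measurable borel"
  shows "(\<integral>\<^sup>+x. f x \<partial>lborel) = (\<integral>\<^sup>+x. f (x + t) \<partial>lborel)"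
  using nn_integral_real_affine[OF assms, of 1 t] by (simp add: add.commute)

text \<open>Measured from the first height, the other two are linear in the slopes
  \<open>(a, b)\<close> alone, with the edge vectors of the base triangle as rows. Translating
  \<open>z0\<close> by \<open>a * x0 + b * y0\<close> then produces the intercept \<open>c\<close>
  with Jacobian one.\<close>

lemma nn_integral_heights_to_plane:
  fixes f :: "real \<Rightarrow> real \<Rightarrow> real \<Rightarrow> ennreal"
  assumes f [measurable]: "(\<lambda>(x, y, z). f x y z) \<in> borel_measurable (borel \<Otimes>\<^sub>M borel \<Otimes>\<^sub>M borel)"
    and "x1 - x0 \<noteq> 0" "(x1 - x0) * (y2 - y0) - (x2 - x0) * (y1 - y0) \<noteq> 0"
  shows "(\<integral>\<^sup>+z0. \<integral>\<^sup>+z1. \<integral>\<^sup>+z2. f z0 z1 z2 \<partial>lborel \<partial>lborel \<partial>lborel)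
     = ennreal \<bar>(x1 - x0) * (y2 - y0) - (x2 - x0) * (y1 - y0)\<bar> *
       (\<integral>\<^sup>+a. \<integral>\<^sup>+b. \<integral>\<^sup>+c. f (a * x0 + b * y0 + c) (a * x1 + b * y1 + c) (a * x2 + b * y2 + c) \<partial>lborel \<partial>lborel \<partial>lborel)"
proof -
  note [measurable] = measurable_curry3[OF f]
  define \<delta> where "\<delta> = (x1 - x0) * (y2 - y0) - (x2 - x0) * (y1 - y0)"
  have "(\<integral>\<^sup>+z0. \<integral>\<^sup>+z1. \<integral>\<^sup>+z2. f z0 z1 z2 \<partial>lborel \<partial>lborel \<partial>lborel)
      = (\<integral>\<^sup>+z0. \<integral>\<^sup>+z1. \<integral>\<^sup>+z2. f z0 (z1 + z0) (z2 + z0) \<partial>lborel \<partial>lborel \<partial>lborel)" (is "_ = (\<integral>\<^sup>+z0. ?r z0 \<partial>_)")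
  proof (rule nn_integral_cong)
    fix z0 :: real
    have "(\<integral>\<^sup>+z1. \<integral>\<^sup>+z2. f z0 z1 z2 \<partial>lborel \<partial>lborel) = (\<integral>\<^sup>+z1. \<integral>\<^sup>+z2. f z0 (z1 + z0) z2 \<partial>lborel \<partial>lborel)"
      by (rule nn_integral_shift) measurable
    also have "\<dots> = ?r z0"
      by (intro nn_integral_cong nn_integral_shift) measurable
    finally show "(\<integral>\<^sup>+z1. \<integral>\<^sup>+z2. f z0 z1 z2 \<partial>lborel \<partial>lborel) = ?r z0" .
  qed
  also have "\<dots> = (\<integral>\<^sup>+z0. ennreal \<bar>\<delta>\<bar> * (\<integral>\<^sup>+a. \<integral>\<^sup>+b. f z0 (a * (x1 - x0) + b * (y1 - y0) + z0)
       (a * (x2 - x0) + b * (y2 - y0) + z0) \<partial>lborel \<partial>lborel) \<partial>lborel)"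
    unfolding \<delta>_def
    by (intro nn_integral_cong, rule nn_integral_shear) (use assms(2,3) in \<open>simp_all\<close>)
  also have "\<dots> = ennreal \<bar>\<delta>\<bar> * (\<integral>\<^sup>+z0. \<integral>\<^sup>+a. \<integral>\<^sup>+b. f z0 (a * (x1 - x0) + b * (y1 - y0) + z0)
       (a * (x2 - x0) + b * (y2 - y0) + z0) \<partial>lborel \<partial>lborel \<partial>lborel)"
    by (rule nn_integral_cmult) measurable
  also have "(\<integral>\<^sup>+z0. \<integral>\<^sup>+a. \<integral>\<^sup>+b. f z0 (a * (x1 - x0) + b * (y1 - y0) + z0)
       (a * (x2 - x0) + b * (y2 - y0) + z0) \<partial>lborel \<partial>lborel \<partial>lborel) =
     (\<integral>\<^sup>+a. \<integral>\<^sup>+z0. \<integral>\<^sup>+b. f z0 (a * (x1 - x0) + b * (y1 - y0) + z0)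
       (a * (x2 - x0) + b * (y2 - y0) + z0) \<partial>lborel \<partial>lborel \<partial>lborel)"
    by (rule lborel_pair.Fubini') measurable
  also have "\<dots> = (\<integral>\<^sup>+a. \<integral>\<^sup>+b. \<integral>\<^sup>+z0. f z0 (a * (x1 - x0) + b * (y1 - y0) + z0)
       (a * (x2 - x0) + b * (y2 - y0) + z0) \<partial>lborel \<partial>lborel \<partial>lborel)"
    by (rule nn_integral_cong, rule lborel_pair.Fubini') measurable
  also have "\<dots> = (\<integral>\<^sup>+a. \<integral>\<^sup>+b. \<integral>\<^sup>+c. f (a * x0 + b * y0 + c) (a * x1 + b * y1 + c) (a * x2 + b * y2 + c) \<partial>lborel \<partial>lborel \<partial>lborel)"
  proof (rule nn_integral_cong, rule nn_integral_cong)
    fix a b :: real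
    show "(\<integral>\<^sup>+z0. f z0 (a * (x1 - x0) + b * (y1 - y0) + z0) (a * (x2 - x0) + b * (y2 - y0) + z0) \<partial>lborel)
       = (\<integral>\<^sup>+c. f (a * x0 + b * y0 + c) (a * x1 + b * y1 + c) (a * x2 + b * y2 + c) \<partial>lborel)"
      by (subst nn_integral_shift[where t = "a * x0 + b * y0"])
         (measurable, simp add: algebra_simps)
  qed
  finally show ?thesis unfolding \<delta>_def .
qed

lemma nn_integral_lborel_pair:
  assumes "f \<in> borel_measurable borel"
  shows "(\<integral>\<^sup>+q. f q \<partial>(lborel :: ('a::euclidean_space \<times> 'b::euclidean_space) measure))
    = (\<integral>\<^sup>+x. \<integral>\<^sup>+y. f (x, y) \<partial>lborel \<partial>lborel)"
  using lborel.nn_integral_fst[of f "lborel :: 'a measure"] assms by (simp add: lborel_prod)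

section \<open>Plane sections of the ball and their elliptical shadows\<close>

text \<open>The plane \<open>z = a x + b y + c\<close> cuts the unit ball in a disc of radius
  \<open>s\<close>, at signed distance \<open>c / R\<close> from the origin. The shadow of that disc
  in the horizontal plane is an ellipse with centre \<open>-(c / R^2) (a, b)\<close>, and this is an
  affine map of the unit disc onto it. Its linear part is triangular since it comes from completing
  squares in \<open>X^2 + Y^2 + (a X + b Y)^2\<close>, first in \<open>X\<close>, with leading
  coefficient \<open>r^2\<close>, then in \<open>Y\<close>.\<close>

definition ellipse_map :: "real \<Rightarrow> real \<Rightarrow> real \<Rightarrow> real \<times> real \<Rightarrow> real \<times> real" where
  "ellipse_map a b c q =
    (let r = sqrt (1 + a\<^sup>2); R = sqrt (1 + a\<^sup>2 + b\<^sup>2); s = sqrt (1 - c\<^sup>2 / R\<^sup>2) in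
      (s / r * fst q - s * a * b / (r * R) * snd q - c * a / R\<^sup>2, s * r / R * snd q - c * b / R\<^sup>2))"

lemma ellipse_map_measurable [measurable]:
  "ellipse_map a b c \<in> borel_measurable borel"
proof -
  have "ellipse_map a b c \<in> borel_measurable (borel \<Otimes>\<^sub>M borel)"
    unfolding ellipse_map_def [abs_def] Let_def by measurable
  then show ?thesis by (simp add: borel_prod)
qed

text \<open>This pulls the weight on a plane section back to a multiple of the weight on the unit
  disc, the multiple depending on the distance of the plane alone.\<close>

lemma ellipse_map_quadratic:
  assumes m: "1 - c\<^sup>2 / (1 + a\<^sup>2 + b\<^sup>2) > 0"
    and q: "(x, y) = ellipse_map a b c q"
  shows "1 - x\<^sup>2 - y\<^sup>2 - (a * x + b * y + c)\<^sup>2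
    = (1 - c\<^sup>2 / (1 + a\<^sup>2 + b\<^sup>2)) * (1 - (fst q)\<^sup>2 - (snd q)\<^sup>2)"
proof -
  define r R s where "r = sqrt (1 + a\<^sup>2)" and "R = sqrt (1 + a\<^sup>2 + b\<^sup>2)" and "s = sqrt (1 - c\<^sup>2 / R\<^sup>2)"
  have r2: "r\<^sup>2 = 1 + a\<^sup>2" and R2: "R\<^sup>2 = 1 + a\<^sup>2 + b\<^sup>2"
    unfolding r_def R_def by (simp_all add: add_nonneg_nonneg)
  have r: "r > 0" and R: "R > 0"
    unfolding r_def R_def by (simp_all add: add_pos_nonneg)
  have s2: "s\<^sup>2 = 1 - c\<^sup>2 / R\<^sup>2" using m R2 by (simp add: s_def)
  define X Y where "X = s / r * fst q - s * a * b / (r * R) * snd q" and "Y = s * r / R * snd q"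
  have xy: "x = X - c * a / R\<^sup>2" "y = Y - c * b / R\<^sup>2"
    using q by (simp_all add: ellipse_map_def Let_def X_def Y_def r_def R_def s_def)
  have "(s * fst q)\<^sup>2 = r\<^sup>2 * X\<^sup>2 + 2 * a * b * X * Y + (a * b)\<^sup>2 * Y\<^sup>2 / r\<^sup>2"
  proof -
    have "r * X + a * b * Y / r = s * fst q"
      using r R by (simp add: X_def Y_def field_simps)
    then show ?thesis
      using r by (simp add: power2_eq_square field_simps flip: \<open>r * X + a * b * Y / r = s * fst q\<close>)
  qed
  moreover have "(s * snd q)\<^sup>2 = R\<^sup>2 * Y\<^sup>2 / r\<^sup>2"
    using r R by (simp add: Y_def power2_eq_square field_simps)
  ultimately have "s\<^sup>2 * ((fst q)\<^sup>2 + (snd q)\<^sup>2) = r\<^sup>2 * X\<^sup>2 + 2 * a * b * X * Y + ((a * b)\<^sup>2 + R\<^sup>2) * Y\<^sup>2 / r\<^sup>2"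
    by (simp add: power_mult_distrib algebra_simps add_divide_distrib)
  also have "\<dots> = r\<^sup>2 * X\<^sup>2 + 2 * a * b * X * Y + (1 + b\<^sup>2) * Y\<^sup>2"
  proof -
    have "(a * b)\<^sup>2 + R\<^sup>2 = r\<^sup>2 * (1 + b\<^sup>2)"
      unfolding r2 R2 by algebra
    then show ?thesis using r by simp
  qed
  also have "\<dots> = X\<^sup>2 + Y\<^sup>2 + (a * X + b * Y)\<^sup>2"
    unfolding r2 by algebra
  finally have XY: "X\<^sup>2 + Y\<^sup>2 + (a * X + b * Y)\<^sup>2 = s\<^sup>2 * ((fst q)\<^sup>2 + (snd q)\<^sup>2)" ..
  define d where "d = c / R\<^sup>2"
  have c: "c = d * (1 + a\<^sup>2 + b\<^sup>2)" using R by (simp add: d_def flip: R2)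
  have xy': "x = X - d * a" "y = Y - d * b" using xy by (simp_all add: d_def)
  \<comment> \<open>Pythagoras: recentring at the foot of the perpendicular from the origin cancels
    the mixed terms, and \<open>c * d\<close> is the squared distance of the plane.\<close>
  have "x\<^sup>2 + y\<^sup>2 + (a * x + b * y + c)\<^sup>2 = X\<^sup>2 + Y\<^sup>2 + (a * X + b * Y)\<^sup>2 + c * d"
    unfolding xy' c by algebra
  moreover have "c * d = c\<^sup>2 / R\<^sup>2" by (simp add: d_def power2_eq_square)
  ultimately have "1 - x\<^sup>2 - y\<^sup>2 - (a * x + b * y + c)\<^sup>2 = 1 - s\<^sup>2 * ((fst q)\<^sup>2 + (snd q)\<^sup>2) - c\<^sup>2 / R\<^sup>2"
    using XY by linarith
  also have "\<dots> = s\<^sup>2 * (1 - (fst q)\<^sup>2 - (snd q)\<^sup>2)"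
    unfolding s2 by algebra
  finally show ?thesis unfolding s2 R2 .
qed

text \<open>Signed areas scale by the determinant of the linear part, which is the product
  \<open>(s / r) (s r / R) = s^2 / R\<close> of its diagonal entries.\<close>

lemma ellipse_map_det:
  assumes m: "1 - c\<^sup>2 / (1 + a\<^sup>2 + b\<^sup>2) > 0"
  shows "(fst (ellipse_map a b c q1) - fst (ellipse_map a b c q0)) * (snd (ellipse_map a b c q2) - snd (ellipse_map a b c q0))
    - (fst (ellipse_map a b c q2) - fst (ellipse_map a b c q0)) * (snd (ellipse_map a b c q1) - snd (ellipse_map a b c q0))
    = (1 - c\<^sup>2 / (1 + a\<^sup>2 + b\<^sup>2)) / sqrt (1 + a\<^sup>2 + b\<^sup>2) *
      ((fst q1 - fst q0) * (snd q2 - snd q0) - (fst q2 - fst q0) * (snd q1 - snd q0))"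
proof -
  define r R s where "r = sqrt (1 + a\<^sup>2)" and "R = sqrt (1 + a\<^sup>2 + b\<^sup>2)" and "s = sqrt (1 - c\<^sup>2 / R\<^sup>2)"
  have R2: "R\<^sup>2 = 1 + a\<^sup>2 + b\<^sup>2" unfolding R_def by (simp add: add_nonneg_nonneg)
  have r: "r > 0" unfolding r_def by (simp add: add_pos_nonneg)
  have s2: "s\<^sup>2 = 1 - c\<^sup>2 / R\<^sup>2" using m R2 by (simp add: s_def)
  define \<xi> \<eta> \<zeta> where "\<xi> = s / r" and "\<eta> = s * a * b / (r * R)" and "\<zeta> = s * r / R"
  have d: "s\<^sup>2 / R = \<xi> * \<zeta>" using r by (simp add: \<xi>_def \<zeta>_def power2_eq_square)
  have e: "ellipse_map a b c q = (\<xi> * fst q - \<eta> * snd q - c * a / R\<^sup>2, \<zeta> * snd q - c * b / R\<^sup>2)" for q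
    by (simp add: ellipse_map_def Let_def \<xi>_def \<eta>_def \<zeta>_def r_def R_def s_def)
  have "(1 - c\<^sup>2 / (1 + a\<^sup>2 + b\<^sup>2)) / sqrt (1 + a\<^sup>2 + b\<^sup>2) = \<xi> * \<zeta>"
    using d s2 R2 by (simp add: R_def)
  then show ?thesis
    unfolding e fst_conv snd_conv by algebra
qed

lemma nn_integral_ellipse_map:
  fixes f :: "real \<times> real \<Rightarrow> ennreal"
  assumes [measurable]: "f \<in> borel_measurable borel"
    and m: "1 - c\<^sup>2 / (1 + a\<^sup>2 + b\<^sup>2) > 0"
  shows "(\<integral>\<^sup>+q. f q \<partial>lborel) = ennreal ((1 - c\<^sup>2 / (1 + a\<^sup>2 + b\<^sup>2)) / sqrt (1 + a\<^sup>2 + b\<^sup>2)) *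
    (\<integral>\<^sup>+q. f (ellipse_map a b c q) \<partial>lborel)"
proof -
  define r R s where "r = sqrt (1 + a\<^sup>2)" and "R = sqrt (1 + a\<^sup>2 + b\<^sup>2)" and "s = sqrt (1 - c\<^sup>2 / R\<^sup>2)"
  have R2: "R\<^sup>2 = 1 + a\<^sup>2 + b\<^sup>2" unfolding R_def by (simp add: add_nonneg_nonneg)
  have r: "r > 0" and R: "R > 0"
    unfolding r_def R_def by (simp_all add: add_pos_nonneg)
  have s2: "s\<^sup>2 = 1 - c\<^sup>2 / R\<^sup>2" and s: "s > 0" using m R2 by (simp_all add: s_def)
  define \<xi> \<eta> \<zeta> where "\<xi> = s / r" and "\<eta> = - (s * a * b / (r * R))" and "\<zeta> = s * r / R"
  have d: "\<xi> * \<zeta> - 0 * \<eta> = (1 - c\<^sup>2 / (1 + a\<^sup>2 + b\<^sup>2)) / sqrt (1 + a\<^sup>2 + b\<^sup>2)"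
    using r s2 R2 by (simp add: \<xi>_def \<zeta>_def power2_eq_square R_def)
  have "\<xi> \<noteq> 0" "\<xi> * \<zeta> - 0 * \<eta> \<noteq> 0" "\<xi> * \<zeta> - 0 * \<eta> > 0"
    using r R s by (simp_all add: \<xi>_def \<zeta>_def)
  define tx ty where "tx = - (c * a / R\<^sup>2)" and "ty = - (c * b / R\<^sup>2)"
  have e: "ellipse_map a b c (x, y) = (x * \<xi> + y * \<eta> + tx, x * 0 + y * \<zeta> + ty)" for x y
    by (simp add: ellipse_map_def Let_def \<xi>_def \<eta>_def \<zeta>_def r_def R_def s_def tx_def ty_def, simp only: mult_ac)
  have [measurable]: "f \<in> borel_measurable (borel \<Otimes>\<^sub>M borel)" using assms(1) by (simp add: borel_prod)
  have "(\<integral>\<^sup>+q. f q \<partial>lborel) = (\<integral>\<^sup>+x. \<integral>\<^sup>+y. f (x, y) \<partial>lborel \<partial>lborel)"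
    by (rule nn_integral_lborel_pair) fact
  also have "\<dots> = (\<integral>\<^sup>+x. \<integral>\<^sup>+y. f (x + tx, y) \<partial>lborel \<partial>lborel)"
    by (rule nn_integral_shift) measurable
  also have "\<dots> = (\<integral>\<^sup>+x. \<integral>\<^sup>+y. f (x + tx, y + ty) \<partial>lborel \<partial>lborel)"
    by (rule nn_integral_cong, rule nn_integral_shift) measurable
  also have "\<dots> = ennreal \<bar>\<xi> * \<zeta> - 0 * \<eta>\<bar> *
     (\<integral>\<^sup>+x. \<integral>\<^sup>+y. f (x * \<xi> + y * \<eta> + tx, x * 0 + y * \<zeta> + ty) \<partial>lborel \<partial>lborel)"
    using \<open>\<xi> \<noteq> 0\<close> \<open>\<xi> * \<zeta> - 0 * \<eta> \<noteq> 0\<close>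
    by (intro nn_integral_shear[where f = "\<lambda>x y. f (x + tx, y + ty)"]) simp_all
  also have "\<dots> = ennreal (\<xi> * \<zeta> - 0 * \<eta>) * (\<integral>\<^sup>+x. \<integral>\<^sup>+y. f (ellipse_map a b c (x, y)) \<partial>lborel \<partial>lborel)"
    using \<open>\<xi> * \<zeta> - 0 * \<eta> > 0\<close> unfolding e by (simp add: abs_of_pos)
  also have "(\<integral>\<^sup>+x. \<integral>\<^sup>+y. f (ellipse_map a b c (x, y)) \<partial>lborel \<partial>lborel) = (\<integral>\<^sup>+q. f (ellipse_map a b c q) \<partial>lborel)"
    by (rule nn_integral_lborel_pair[symmetric]) measurable
  finally show ?thesis unfolding d .
qed

section \<open>Integrals of powers over plane sections\<close>

lemma measurable_fst_borel [measurable (raw)]: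
  fixes f :: "'x \<Rightarrow> 'a::second_countable_topology \<times> 'b::second_countable_topology"
  shows "f \<in> borel_measurable M \<Longrightarrow> (\<lambda>x. fst (f x)) \<in> borel_measurable M"
  using measurable_compose[of f M borel fst borel] by (simp flip: borel_prod)

lemma measurable_snd_borel [measurable (raw)]:
  fixes f :: "'x \<Rightarrow> 'a::second_countable_topology \<times> 'b::second_countable_topology"
  shows "f \<in> borel_measurable M \<Longrightarrow> (\<lambda>x. snd (f x)) \<in> borel_measurable M"
  using measurable_compose[of f M borel snd borel] by (simp flip: borel_prod)

text \<open>Twice the signed area of the triangle \<open>q0 q1 q2\<close>.\<close>

definition qdet :: "real \<times> real \<Rightarrow> real \<times> real \<Rightarrow> real \<times> real \<Rightarrow> real" where
  "qdet q0 q1 q2 = (fst q1 - fst q0) * (snd q2 - snd q0) - (fst q2 - fst q0) * (snd q1 - snd q0)"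

lemma qdet_measurable [measurable (raw)]:
  assumes [measurable]: "f \<in> borel_measurable M" "g \<in> borel_measurable M" "h \<in> borel_measurable M"
  shows "(\<lambda>x. qdet (f x) (g x) (h x)) \<in> borel_measurable M"
  unfolding qdet_def by measurable

text \<open>The weight of the ball at the point of the graph above \<open>q\<close>. Slopes and
  intercept \<open>0\<close> give the weight of the unit disc, to which all other planes are
  reduced.\<close>

definition plane_weight :: "real \<Rightarrow> real \<Rightarrow> real \<Rightarrow> real \<Rightarrow> real \<times> real \<Rightarrow> ennreal" where
  "plane_weight \<kappa> a b c q = pospow \<kappa> (1 - (fst q)\<^sup>2 - (snd q)\<^sup>2 - (a * fst q + b * snd q + c)\<^sup>2)"

lemma plane_weight_measurable [measurable (raw)]:
  assumes [measurable]: "f \<in> borel_measurable M" "g \<in> borel_measurable M" "h \<in> borel_measurable M"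
    "k \<in> borel_measurable M"
  shows "(\<lambda>x. plane_weight \<kappa> (f x) (g x) (h x) (k x)) \<in> borel_measurable M"
  unfolding plane_weight_def by measurable

lemma plane_weight_ellipse_map:
  assumes "1 - c\<^sup>2 / (1 + a\<^sup>2 + b\<^sup>2) > 0"
  shows "plane_weight \<kappa> a b c (ellipse_map a b c q)
    = pospow \<kappa> (1 - c\<^sup>2 / (1 + a\<^sup>2 + b\<^sup>2)) * plane_weight \<kappa> 0 0 0 q"
  using ellipse_map_quadratic[OF assms, of _ _ q, OF prod.collapse] assms
  by (simp add: plane_weight_def pospow_mult)

text \<open>The hypothesis puts the plane at distance at least one from the origin, so it misses the
  open ball.\<close>

lemma plane_weight_eq_0:
  assumes "1 - c\<^sup>2 / (1 + a\<^sup>2 + b\<^sup>2) \<le> 0"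
  shows "plane_weight \<kappa> a b c q = 0"
proof -
  obtain x y where q: "q = (x, y)" by (cases q)
  define z where "z = a * x + b * y + c"
  define A where "A = 1 + a\<^sup>2 + b\<^sup>2"
  have A: "A > 0" by (simp add: A_def add_pos_nonneg)
  \<comment> \<open>Lagrange's identity \<open>|n|^2 |p|^2 - (n . p)^2 = |n x p|^2\<close> for the
    normal \<open>n = (-a, -b, 1)\<close> and \<open>p = (x, y, z)\<close>, where
    \<open>n . p = c\<close>.\<close>
  have "A * (x\<^sup>2 + y\<^sup>2 + z\<^sup>2) - c\<^sup>2 = (b * x - a * y)\<^sup>2 + (x + a * z)\<^sup>2 + (y + b * z)\<^sup>2"
    unfolding z_def A_def by algebra
  then have "A * (x\<^sup>2 + y\<^sup>2 + z\<^sup>2) \<ge> c\<^sup>2"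
    by (smt (verit) zero_le_power2)
  moreover have "1 \<le> c\<^sup>2 / A" using assms by (simp add: A_def)
  then have "A \<le> c\<^sup>2" using A by (simp add: le_divide_eq)
  ultimately have "A * 1 \<le> A * (x\<^sup>2 + y\<^sup>2 + z\<^sup>2)" by simp
  then have "1 \<le> x\<^sup>2 + y\<^sup>2 + z\<^sup>2" using A by (metis mult_le_cancel_left_pos)
  then show ?thesis by (simp add: plane_weight_def q pospow_def z_def)
qed

text \<open>Pulling back to the unit disc gives the power \<open>\<kappa>\<close> of
  \<open>m = 1 - c^2 / R^2\<close> from the weight and one more from the Jacobian
  \<open>m / R\<close>.\<close>

lemma nn_integral_plane_weight:
  "(\<integral>\<^sup>+q. plane_weight \<kappa> a b c q \<partial>lborel) = pospow (\<kappa> + 1) (1 - c\<^sup>2 / (1 + a\<^sup>2 + b\<^sup>2)) *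
    ennreal (1 / sqrt (1 + a\<^sup>2 + b\<^sup>2)) * (\<integral>\<^sup>+q. plane_weight \<kappa> 0 0 0 q \<partial>lborel)"
proof -
  define m R where "m = 1 - c\<^sup>2 / (1 + a\<^sup>2 + b\<^sup>2)" and "R = sqrt (1 + a\<^sup>2 + b\<^sup>2)"
  have R: "R > 0" unfolding R_def by (simp add: add_pos_nonneg)
  show ?thesis
  proof (cases "m > 0")
    case True
    have "(\<integral>\<^sup>+q. plane_weight \<kappa> a b c q \<partial>lborel)
      = ennreal (m / R) * (\<integral>\<^sup>+q. plane_weight \<kappa> a b c (ellipse_map a b c q) \<partial>lborel)"
      unfolding m_def R_def by (rule nn_integral_ellipse_map) (use True in \<open>simp_all add: m_def\<close>)
    also have "\<dots> = ennreal (m / R) * (pospow \<kappa> m * (\<integral>\<^sup>+q. plane_weight \<kappa> 0 0 0 q \<partial>lborel))"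
      using True by (simp add: plane_weight_ellipse_map m_def nn_integral_cmult)
    also have "ennreal (m / R) = pospow 1 m * ennreal (1 / R)"
      using True R by (simp add: pospow_def flip: ennreal_mult)
    also have "pospow 1 m * ennreal (1 / R) * (pospow \<kappa> m * (\<integral>\<^sup>+q. plane_weight \<kappa> 0 0 0 q \<partial>lborel))
      = (pospow \<kappa> m * pospow 1 m) * ennreal (1 / R) * (\<integral>\<^sup>+q. plane_weight \<kappa> 0 0 0 q \<partial>lborel)"
      by (simp add: mult_ac)
    finally show ?thesis unfolding pospow_add m_def R_def .
  next
    case False
    then show ?thesis by (simp add: m_def plane_weight_eq_0 pospow_def)
  qed
qed

text \<open>A count of powers: three weights give \<open>3 * \<kappa>\<close>; the three Jacobians
  \<open>m / R\<close>, and \<open>qdet\<close>, which scales by \<open>m / R\<close> too, give four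
  more powers of \<open>m\<close> and the fourth power of \<open>1 / R\<close>. With \<kappa> =
  \<beta> + 1/2 the exponent is the \<open>3 * \<beta> + 11 / 2\<close> of the law of the
  distance.\<close>

lemma nn_integral_plane_weight_qdet:
  "(\<integral>\<^sup>+q0. \<integral>\<^sup>+q1. \<integral>\<^sup>+q2. ennreal \<bar>qdet q0 q1 q2\<bar> *
      (plane_weight \<kappa> a b c q0 * plane_weight \<kappa> a b c q1 * plane_weight \<kappa> a b c q2) \<partial>lborel \<partial>lborel \<partial>lborel)
    = pospow (3 * \<kappa> + 4) (1 - c\<^sup>2 / (1 + a\<^sup>2 + b\<^sup>2)) * ennreal (1 / (1 + a\<^sup>2 + b\<^sup>2)\<^sup>2) *
     (\<integral>\<^sup>+q0. \<integral>\<^sup>+q1. \<integral>\<^sup>+q2. ennreal \<bar>qdet q0 q1 q2\<bar> *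
      (plane_weight \<kappa> 0 0 0 q0 * plane_weight \<kappa> 0 0 0 q1 * plane_weight \<kappa> 0 0 0 q2) \<partial>lborel \<partial>lborel \<partial>lborel)"
    (is "?L = _ * _ * ?K")
proof -
  define m R where "m = 1 - c\<^sup>2 / (1 + a\<^sup>2 + b\<^sup>2)" and "R = sqrt (1 + a\<^sup>2 + b\<^sup>2)"
  have R: "R > 0" unfolding R_def by (simp add: add_pos_nonneg)
  show ?thesis
  proof (cases "m > 0")
    case True
    define e where "e = ellipse_map a b c"
    have [measurable]: "e \<in> borel_measurable borel" unfolding e_def by measurable
    define w where "w = plane_weight \<kappa> a b c"
    have [measurable]: "w \<in> borel_measurable borel" unfolding w_def by measurable
    define v where "v = plane_weight \<kappa> 0 0 0"
    have [measurable]: "v \<in> borel_measurable borel" unfolding v_def by measurable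
    define j where "j = ennreal (m / R)"
    have sub: "(\<integral>\<^sup>+q. f q \<partial>lborel) = j * (\<integral>\<^sup>+q. f (e q) \<partial>lborel)"
      if "f \<in> borel_measurable borel" for f
      unfolding m_def R_def e_def j_def by (rule nn_integral_ellipse_map) (use True that in \<open>simp_all add: m_def\<close>)
    have we: "w (e q) = pospow \<kappa> m * v q" for q
      using True by (simp add: w_def e_def v_def plane_weight_ellipse_map m_def)
    have qe: "ennreal \<bar>qdet (e q0) (e q1) (e q2)\<bar> = j * ennreal \<bar>qdet q0 q1 q2\<bar>" for q0 q1 q2
      using True ellipse_map_det[of c a b q1 q0 q2] R
      by (simp add: j_def e_def qdet_def m_def R_def abs_mult flip: ennreal_mult)
    have "?L = j * (\<integral>\<^sup>+q0. \<integral>\<^sup>+q1. \<integral>\<^sup>+q2. ennreal \<bar>qdet (e q0) q1 q2\<bar> *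
      (w (e q0) * w q1 * w q2) \<partial>lborel \<partial>lborel \<partial>lborel)"
      unfolding w_def[symmetric] by (rule sub) measurable
    also have "(\<integral>\<^sup>+q0. \<integral>\<^sup>+q1. \<integral>\<^sup>+q2. ennreal \<bar>qdet (e q0) q1 q2\<bar> * (w (e q0) * w q1 * w q2) \<partial>lborel \<partial>lborel \<partial>lborel)
      = (\<integral>\<^sup>+q0. j * (\<integral>\<^sup>+q1. \<integral>\<^sup>+q2. ennreal \<bar>qdet (e q0) (e q1) q2\<bar> * (w (e q0) * w (e q1) * w q2) \<partial>lborel \<partial>lborel) \<partial>lborel)"
      by (rule nn_integral_cong, rule sub) measurable
    also have "\<dots> = (\<integral>\<^sup>+q0. j * (\<integral>\<^sup>+q1. j * (\<integral>\<^sup>+q2. ennreal \<bar>qdet (e q0) (e q1) (e q2)\<bar> *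
        (w (e q0) * w (e q1) * w (e q2)) \<partial>lborel) \<partial>lborel) \<partial>lborel)"
      by (rule nn_integral_cong, rule arg_cong2[where f = "(*)", OF refl], rule nn_integral_cong, rule sub) measurable
    also have "\<dots> = (\<integral>\<^sup>+q0. j * (\<integral>\<^sup>+q1. j * (\<integral>\<^sup>+q2. (j * (pospow \<kappa> m * pospow \<kappa> m * pospow \<kappa> m)) * (ennreal \<bar>qdet q0 q1 q2\<bar> *
        (v q0 * v q1 * v q2)) \<partial>lborel) \<partial>lborel) \<partial>lborel)"
      unfolding we qe by (simp only: mult_ac)
    also have "\<dots> = j * (j * ((j * (pospow \<kappa> m * pospow \<kappa> m * pospow \<kappa> m)) * (\<integral>\<^sup>+q0. \<integral>\<^sup>+q1. \<integral>\<^sup>+q2. ennreal \<bar>qdet q0 q1 q2\<bar> *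
        (v q0 * v q1 * v q2) \<partial>lborel \<partial>lborel \<partial>lborel)))"
      by (simp add: nn_integral_cmult)
    also have "j = pospow 1 m * ennreal (1 / R)"
      using True R by (simp add: pospow_def j_def flip: ennreal_mult)
    finally have "?L = (pospow \<kappa> m * pospow \<kappa> m * pospow \<kappa> m * pospow 1 m * pospow 1 m * pospow 1 m * pospow 1 m)
      * (ennreal (1 / R) * ennreal (1 / R) * ennreal (1 / R) * ennreal (1 / R)) * ?K"
      unfolding v_def by (simp only: mult_ac)
    also have "ennreal (1 / R) * ennreal (1 / R) * ennreal (1 / R) * ennreal (1 / R) = ennreal (1 / (R\<^sup>2)\<^sup>2)"
      using R by (simp add: power2_eq_square flip: ennreal_mult)
    also have "R\<^sup>2 = 1 + a\<^sup>2 + b\<^sup>2" by (simp add: R_def add_nonneg_nonneg)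
    finally show ?thesis unfolding pospow_add m_def[symmetric] by (simp add: algebra_simps)
  next
    case False
    then show ?thesis by (simp add: m_def plane_weight_eq_0 pospow_def)
  qed
qed

section \<open>Planes through three random points\<close>

definition ball_weight :: "real \<Rightarrow> (real \<times> real) \<times> real \<Rightarrow> ennreal" where
  "ball_weight \<kappa> p = pospow \<kappa> (1 - (fst (fst p))\<^sup>2 - (snd (fst p))\<^sup>2 - (snd p)\<^sup>2)"

lemma ball_weight_measurable [measurable (raw)]:
  assumes [measurable]: "f \<in> borel_measurable M"
  shows "(\<lambda>x. ball_weight \<kappa> (f x)) \<in> borel_measurable M"
  unfolding ball_weight_def by measurable

lemma ball_weight_plane: "ball_weight \<kappa> (q, a * fst q + b * snd q + c) = plane_weight \<kappa> a b c q"
  by (simp add: ball_weight_def plane_weight_def)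

lemma nn_integral_ball_weight:
  assumes [measurable]: "g \<in> borel_measurable borel"
  shows "(\<integral>\<^sup>+p. g p \<partial>density lborel (\<lambda>p. k * ball_weight \<kappa> p))
    = (\<integral>\<^sup>+q. \<integral>\<^sup>+z. k * ball_weight \<kappa> (q, z) * g (q, z) \<partial>lborel \<partial>lborel)"
  by (subst nn_integral_density) (simp_all add: nn_integral_lborel_pair)

lemma measurable_curry4:
  assumes "(\<lambda>(x, y, z, w). f x y z w) \<in> measurable (A \<Otimes>\<^sub>M B \<Otimes>\<^sub>M C \<Otimes>\<^sub>M D) E"
    and "g \<in> measurable N A" "h \<in> measurable N B" "k \<in> measurable N C" "l \<in> measurable N D"
  shows "(\<lambda>x. f (g x) (h x) (k x) (l x)) \<in> measurable N E"
proof -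
  have "(\<lambda>x. (g x, h x, k x, l x)) \<in> measurable N (A \<Otimes>\<^sub>M B \<Otimes>\<^sub>M C \<Otimes>\<^sub>M D)"
    using assms(2-) by simp
  from measurable_compose[OF this assms(1)] show ?thesis by simp
qed

text \<open>Meant for \<open>w\<close> one of the slopes \<open>a\<close>, \<open>b\<close> or the
  intercept \<open>c\<close>, which have to be carried in front of the three base points.\<close>

lemma nn_integral_rotate4:
  fixes f :: "'a::euclidean_space \<Rightarrow> 'b::euclidean_space \<Rightarrow> 'c::euclidean_space \<Rightarrow> 'd::euclidean_space \<Rightarrow> ennreal"
  assumes f: "(\<lambda>(x, y, z, w). f x y z w) \<in> borel_measurable (borel \<Otimes>\<^sub>M borel \<Otimes>\<^sub>M borel \<Otimes>\<^sub>M borel)"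
  shows "(\<integral>\<^sup>+x. \<integral>\<^sup>+y. \<integral>\<^sup>+z. \<integral>\<^sup>+w. f x y z w \<partial>lborel \<partial>lborel \<partial>lborel \<partial>lborel)
    = (\<integral>\<^sup>+w. \<integral>\<^sup>+x. \<integral>\<^sup>+y. \<integral>\<^sup>+z. f x y z w \<partial>lborel \<partial>lborel \<partial>lborel \<partial>lborel)"
proof -
  note [measurable] = measurable_curry4[OF f]
  have "(\<integral>\<^sup>+x. \<integral>\<^sup>+y. \<integral>\<^sup>+z. \<integral>\<^sup>+w. f x y z w \<partial>lborel \<partial>lborel \<partial>lborel \<partial>lborel)
    = (\<integral>\<^sup>+x. \<integral>\<^sup>+y. \<integral>\<^sup>+w. \<integral>\<^sup>+z. f x y z w \<partial>lborel \<partial>lborel \<partial>lborel \<partial>lborel)"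
    by (rule nn_integral_cong, rule nn_integral_cong, rule lborel_pair.Fubini') measurable
  also have "\<dots> = (\<integral>\<^sup>+x. \<integral>\<^sup>+w. \<integral>\<^sup>+y. \<integral>\<^sup>+z. f x y z w \<partial>lborel \<partial>lborel \<partial>lborel \<partial>lborel)"
    by (rule nn_integral_cong, rule lborel_pair.Fubini') measurable
  also have "\<dots> = (\<integral>\<^sup>+w. \<integral>\<^sup>+x. \<integral>\<^sup>+y. \<integral>\<^sup>+z. f x y z w \<partial>lborel \<partial>lborel \<partial>lborel \<partial>lborel)"
    by (rule lborel_pair.Fubini') measurable
  finally show ?thesis .
qed

lemma AE_lborel_hyperplane:
  fixes a :: "'a::euclidean_space"
  assumes "a \<noteq> 0"
  shows "AE x in lborel. a \<bullet> x \<noteq> b"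
proof -
  have "{x. a \<bullet> x = b} \<in> null_sets lebesgue"
    using negligible_hyperplane[of a b] assms by (simp add: negligible_iff_null_sets)
  then have "AE x in lebesgue. a \<bullet> x \<noteq> b"
    by (auto simp: eventually_ae_filter intro!: bexI[of _ "{x. a \<bullet> x = b}"])
  then show ?thesis by (simp add: AE_completion_iff)
qed

text \<open>With \<open>q0\<close> and \<open>q1\<close> fixed, collinearity confines
  \<open>q2\<close> to a line. The condition on first coordinates makes the normal of this line
  nonzero, and is also the pivot condition of the elimination.\<close>

lemma AE_qdet: 
  assumes "fst q1 \<noteq> fst q0"
  shows "AE q2 in lborel. qdet q0 q1 q2 \<noteq> 0"
proof -
  define a where "a = (- (snd q1 - snd q0), fst q1 - fst q0)"
  have "AE q2 in lborel. a \<bullet> q2 \<noteq> a \<bullet> q0"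
    by (rule AE_lborel_hyperplane) (use assms in \<open>auto simp: a_def zero_prod_def\<close>)
  then show ?thesis
    by eventually_elim (auto simp: a_def qdet_def inner_prod_def algebra_simps)
qed

lemma AE_fst_neq: "AE q in lborel. fst (q :: real \<times> real) \<noteq> x"
  using AE_lborel_hyperplane[of "(1, 0) :: real \<times> real" x] by (simp add: inner_prod_def zero_prod_def)

text \<open>An affine Blaschke-Petkantschin formula in coordinates: three points with given horizontal
  components span the graph of \<open>a x + b y + c\<close>; the Jacobian of heights with respect to \<open>(a, b, c)\<close> is
  \<open>qdet\<close>.\<close>

lemma nn_integral_ball_weight_plane:
  fixes H :: "(real \<times> real) \<times> real \<Rightarrow> (real \<times> real) \<times> real \<Rightarrow> (real \<times> real) \<times> real \<Rightarrow> ennreal"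
    and \<Psi> :: "real \<Rightarrow> ennreal" and \<kappa> :: real and k :: ennreal
  assumes H: "(\<lambda>(p0, p1, p2). H p0 p1 p2) \<in> borel_measurable (borel \<Otimes>\<^sub>M borel \<Otimes>\<^sub>M borel)"
    and \<Psi> [measurable]: "\<Psi> \<in> borel_measurable borel"
    and H\<Psi>: "\<And>a b c q0 q1 q2. qdet q0 q1 q2 \<noteq> 0 \<Longrightarrow>
      H (q0, a * fst q0 + b * snd q0 + c) (q1, a * fst q1 + b * snd q1 + c) (q2, a * fst q2 + b * snd q2 + c)
        = \<Psi> (c / sqrt (1 + a\<^sup>2 + b\<^sup>2))"
  defines "\<nu> \<equiv> density lborel (\<lambda>p. k * ball_weight \<kappa> p)"
  shows "(\<integral>\<^sup>+p0. \<integral>\<^sup>+p1. \<integral>\<^sup>+p2. H p0 p1 p2 \<partial>\<nu> \<partial>\<nu> \<partial>\<nu>)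
    = (k * k * k * (\<integral>\<^sup>+q0. \<integral>\<^sup>+q1. \<integral>\<^sup>+q2. ennreal \<bar>qdet q0 q1 q2\<bar> *
        (plane_weight \<kappa> 0 0 0 q0 * plane_weight \<kappa> 0 0 0 q1 * plane_weight \<kappa> 0 0 0 q2) \<partial>lborel \<partial>lborel \<partial>lborel) *
       (\<integral>\<^sup>+a. \<integral>\<^sup>+b. ennreal (1 / (1 + a\<^sup>2 + b\<^sup>2)\<^sup>2) * ennreal (sqrt (1 + a\<^sup>2 + b\<^sup>2)) \<partial>lborel \<partial>lborel)) *
      (\<integral>\<^sup>+t. \<Psi> t * pospow (3 * \<kappa> + 4) (1 - t\<^sup>2) \<partial>lborel)"
    (is "_ = (k * k * k * ?K * ?A) * ?T")
proof -
  note [measurable (raw)] = measurable_curry3[OF H]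
  define w where "w p = k * ball_weight \<kappa> p" for p
  have [measurable]: "w \<in> borel_measurable borel" unfolding w_def by measurable
  define V where "V q0 z0 q1 z1 q2 z2 = w (q0, z0) * (w (q1, z1) * (w (q2, z2) * H (q0, z0) (q1, z1) (q2, z2)))"
    for q0 z0 q1 z1 q2 z2
  have [measurable (raw)]: "(\<lambda>x. V (f0 x) (g0 x) (f1 x) (g1 x) (f2 x) (g2 x)) \<in> borel_measurable M"
    if [measurable]: "f0 \<in> borel_measurable M" "f1 \<in> borel_measurable M" "f2 \<in> borel_measurable M"
      "g0 \<in> borel_measurable M" "g1 \<in> borel_measurable M" "g2 \<in> borel_measurable M"
    for f0 f1 f2 g0 g1 g2 and M :: "'x measure"
    unfolding V_def by measurable
  have "(\<integral>\<^sup>+p0. \<integral>\<^sup>+p1. \<integral>\<^sup>+p2. H p0 p1 p2 \<partial>\<nu> \<partial>\<nu> \<partial>\<nu>)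
    = (\<integral>\<^sup>+q0. \<integral>\<^sup>+z0. w (q0, z0) * (\<integral>\<^sup>+q1. \<integral>\<^sup>+z1. w (q1, z1) * (\<integral>\<^sup>+q2. \<integral>\<^sup>+z2. w (q2, z2) *
      H (q0, z0) (q1, z1) (q2, z2) \<partial>lborel \<partial>lborel) \<partial>lborel \<partial>lborel) \<partial>lborel \<partial>lborel)"
    unfolding \<nu>_def w_def by (subst nn_integral_ball_weight, measurable)+ 
  also have "\<dots> = (\<integral>\<^sup>+q0. \<integral>\<^sup>+z0. \<integral>\<^sup>+q1. \<integral>\<^sup>+z1. \<integral>\<^sup>+q2. \<integral>\<^sup>+z2. V q0 z0 q1 z1 q2 z2
      \<partial>lborel \<partial>lborel \<partial>lborel \<partial>lborel \<partial>lborel \<partial>lborel)"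
    unfolding V_def by (simp add: nn_integral_cmult[symmetric])
  also have "\<dots> = (\<integral>\<^sup>+q0. \<integral>\<^sup>+z0. \<integral>\<^sup>+q1. \<integral>\<^sup>+q2. \<integral>\<^sup>+z1. \<integral>\<^sup>+z2. V q0 z0 q1 z1 q2 z2
      \<partial>lborel \<partial>lborel \<partial>lborel \<partial>lborel \<partial>lborel \<partial>lborel)"
    by (rule nn_integral_cong, rule nn_integral_cong, rule nn_integral_cong, rule lborel_pair.Fubini') measurable
  also have "\<dots> = (\<integral>\<^sup>+q0. \<integral>\<^sup>+q1. \<integral>\<^sup>+z0. \<integral>\<^sup>+q2. \<integral>\<^sup>+z1. \<integral>\<^sup>+z2. V q0 z0 q1 z1 q2 z2
      \<partial>lborel \<partial>lborel \<partial>lborel \<partial>lborel \<partial>lborel \<partial>lborel)"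
    by (rule nn_integral_cong, rule lborel_pair.Fubini') measurable
  also have "\<dots> = (\<integral>\<^sup>+q0. \<integral>\<^sup>+q1. \<integral>\<^sup>+q2. \<integral>\<^sup>+z0. \<integral>\<^sup>+z1. \<integral>\<^sup>+z2. V q0 z0 q1 z1 q2 z2
      \<partial>lborel \<partial>lborel \<partial>lborel \<partial>lborel \<partial>lborel \<partial>lborel)"
    by (rule nn_integral_cong, rule nn_integral_cong, rule lborel_pair.Fubini') measurable
  also have "\<dots> = (\<integral>\<^sup>+q0. \<integral>\<^sup>+q1. \<integral>\<^sup>+q2. ennreal \<bar>qdet q0 q1 q2\<bar> * (\<integral>\<^sup>+a. \<integral>\<^sup>+b. \<integral>\<^sup>+c.
      V q0 (a * fst q0 + b * snd q0 + c) q1 (a * fst q1 + b * snd q1 + c) q2 (a * fst q2 + b * snd q2 + c)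
      \<partial>lborel \<partial>lborel \<partial>lborel) \<partial>lborel \<partial>lborel \<partial>lborel)"
  proof (rule nn_integral_cong, rule nn_integral_cong_AE)
    fix q0 :: "real \<times> real"
    \<comment> \<open>The substitution needs a nonzero pivot and a nondegenerate base triangle;
      these fail only on null sets of \<open>q1\<close> and of \<open>q2\<close>.\<close>
    show "AE q1 in lborel. (\<integral>\<^sup>+q2. \<integral>\<^sup>+z0. \<integral>\<^sup>+z1. \<integral>\<^sup>+z2. V q0 z0 q1 z1 q2 z2 \<partial>lborel \<partial>lborel \<partial>lborel \<partial>lborel)
      = (\<integral>\<^sup>+q2. ennreal \<bar>qdet q0 q1 q2\<bar> * (\<integral>\<^sup>+a. \<integral>\<^sup>+b. \<integral>\<^sup>+c.
      V q0 (a * fst q0 + b * snd q0 + c) q1 (a * fst q1 + b * snd q1 + c) q2 (a * fst q2 + b * snd q2 + c)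
      \<partial>lborel \<partial>lborel \<partial>lborel) \<partial>lborel)"
      using AE_fst_neq[of "fst q0"]
    proof eventually_elim
      case (elim q1)
      show ?case
      proof (rule nn_integral_cong_AE, use AE_qdet[OF elim] in eventually_elim)
        case (elim q2)
        then show ?case using \<open>fst q1 \<noteq> fst q0\<close> unfolding qdet_def
          by (intro nn_integral_heights_to_plane) simp_all
      qed
    qed
  qed
  also have "\<dots> = (\<integral>\<^sup>+q0. \<integral>\<^sup>+q1. \<integral>\<^sup>+q2. \<integral>\<^sup>+a. \<integral>\<^sup>+b. \<integral>\<^sup>+c. ennreal \<bar>qdet q0 q1 q2\<bar> *
      V q0 (a * fst q0 + b * snd q0 + c) q1 (a * fst q1 + b * snd q1 + c) q2 (a * fst q2 + b * snd q2 + c)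
      \<partial>lborel \<partial>lborel \<partial>lborel \<partial>lborel \<partial>lborel \<partial>lborel)"
    by (simp add: nn_integral_cmult[symmetric])
  also have "\<dots> = (\<integral>\<^sup>+q0. \<integral>\<^sup>+q1. \<integral>\<^sup>+q2. \<integral>\<^sup>+a. \<integral>\<^sup>+b. \<integral>\<^sup>+c. (k * k * k * \<Psi> (c / sqrt (1 + a\<^sup>2 + b\<^sup>2))) *
      (ennreal \<bar>qdet q0 q1 q2\<bar> * (plane_weight \<kappa> a b c q0 * plane_weight \<kappa> a b c q1 * plane_weight \<kappa> a b c q2))
      \<partial>lborel \<partial>lborel \<partial>lborel \<partial>lborel \<partial>lborel \<partial>lborel)"
  proof (intro nn_integral_cong)
    fix q0 q1 q2 a b c
    \<comment> \<open>The identity between \<open>H\<close> and \<open>\<Psi>\<close> is available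
      off the collinear triples only; on these the factor \<open>qdet\<close> makes both sides
      vanish.\<close>
    show "ennreal \<bar>qdet q0 q1 q2\<bar> *
      V q0 (a * fst q0 + b * snd q0 + c) q1 (a * fst q1 + b * snd q1 + c) q2 (a * fst q2 + b * snd q2 + c)
      = (k * k * k * \<Psi> (c / sqrt (1 + a\<^sup>2 + b\<^sup>2))) *
      (ennreal \<bar>qdet q0 q1 q2\<bar> * (plane_weight \<kappa> a b c q0 * plane_weight \<kappa> a b c q1 * plane_weight \<kappa> a b c q2))"
    proof (cases "qdet q0 q1 q2 = 0")
      case False
      then show ?thesis
        unfolding V_def w_def ball_weight_plane H\<Psi>[OF False] by (simp only: mult_ac)
    qed simp
  qed
  also have "\<dots> = (\<integral>\<^sup>+a. \<integral>\<^sup>+q0. \<integral>\<^sup>+q1. \<integral>\<^sup>+q2. \<integral>\<^sup>+b. \<integral>\<^sup>+c. (k * k * k * \<Psi> (c / sqrt (1 + a\<^sup>2 + b\<^sup>2))) *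
      (ennreal \<bar>qdet q0 q1 q2\<bar> * (plane_weight \<kappa> a b c q0 * plane_weight \<kappa> a b c q1 * plane_weight \<kappa> a b c q2))
      \<partial>lborel \<partial>lborel \<partial>lborel \<partial>lborel \<partial>lborel \<partial>lborel)"
    by (rule nn_integral_rotate4) measurable
  also have "\<dots> = (\<integral>\<^sup>+a. \<integral>\<^sup>+b. \<integral>\<^sup>+q0. \<integral>\<^sup>+q1. \<integral>\<^sup>+q2. \<integral>\<^sup>+c. (k * k * k * \<Psi> (c / sqrt (1 + a\<^sup>2 + b\<^sup>2))) *
      (ennreal \<bar>qdet q0 q1 q2\<bar> * (plane_weight \<kappa> a b c q0 * plane_weight \<kappa> a b c q1 * plane_weight \<kappa> a b c q2))
      \<partial>lborel \<partial>lborel \<partial>lborel \<partial>lborel \<partial>lborel \<partial>lborel)"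
    by (rule nn_integral_cong, rule nn_integral_rotate4) measurable
  also have "\<dots> = (\<integral>\<^sup>+a. \<integral>\<^sup>+b. \<integral>\<^sup>+c. \<integral>\<^sup>+q0. \<integral>\<^sup>+q1. \<integral>\<^sup>+q2. (k * k * k * \<Psi> (c / sqrt (1 + a\<^sup>2 + b\<^sup>2))) *
      (ennreal \<bar>qdet q0 q1 q2\<bar> * (plane_weight \<kappa> a b c q0 * plane_weight \<kappa> a b c q1 * plane_weight \<kappa> a b c q2))
      \<partial>lborel \<partial>lborel \<partial>lborel \<partial>lborel \<partial>lborel \<partial>lborel)"
    by (rule nn_integral_cong, rule nn_integral_cong, rule nn_integral_rotate4) measurable
  also have "\<dots> = (\<integral>\<^sup>+a. \<integral>\<^sup>+b. \<integral>\<^sup>+c. (k * k * k * \<Psi> (c / sqrt (1 + a\<^sup>2 + b\<^sup>2))) *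
      (pospow (3 * \<kappa> + 4) (1 - c\<^sup>2 / (1 + a\<^sup>2 + b\<^sup>2)) * ennreal (1 / (1 + a\<^sup>2 + b\<^sup>2)\<^sup>2) * ?K)
      \<partial>lborel \<partial>lborel \<partial>lborel)"
    by (intro nn_integral_cong, subst nn_integral_plane_weight_qdet[symmetric]) (simp add: nn_integral_cmult)
  \<comment> \<open>The substitution \<open>c = R * t\<close> replaces the intercept by the signed
    distance. The weight then depends on \<open>t\<close> alone, so slopes and distance separate;
    its Jacobian \<open>R\<close> is collected with the powers of \<open>R\<close> from the
    sections.\<close>
  also have "\<dots> = (\<integral>\<^sup>+a. \<integral>\<^sup>+b. (k * k * k * ?K) * (ennreal (1 / (1 + a\<^sup>2 + b\<^sup>2)\<^sup>2) * ennreal (sqrt (1 + a\<^sup>2 + b\<^sup>2))) * ?T \<partial>lborel \<partial>lborel)"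
  proof (rule nn_integral_cong, rule nn_integral_cong)
    fix a b :: real
    define R where "R = sqrt (1 + a\<^sup>2 + b\<^sup>2)"
    have R: "R > 0" unfolding R_def by (simp add: add_pos_nonneg)
    have R2: "1 + a\<^sup>2 + b\<^sup>2 = R\<^sup>2" by (simp add: R_def add_nonneg_nonneg)
    have sqrt_R2: "sqrt (R\<^sup>2) = R" using R by simp
    have "(\<integral>\<^sup>+c. (k * k * k * \<Psi> (c / R)) * (pospow (3 * \<kappa> + 4) (1 - c\<^sup>2 / R\<^sup>2) * ennreal (1 / (R\<^sup>2)\<^sup>2) * ?K) \<partial>lborel)
      = ennreal \<bar>R\<bar> * (\<integral>\<^sup>+t. (k * k * k * \<Psi> ((0 + R * t) / R)) * (pospow (3 * \<kappa> + 4) (1 - (0 + R * t)\<^sup>2 / R\<^sup>2) * ennreal (1 / (R\<^sup>2)\<^sup>2) * ?K) \<partial>lborel)"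
      by (rule nn_integral_real_affine) (use R in simp_all)
    also have "\<dots> = ennreal R * (\<integral>\<^sup>+t. (k * k * k * ?K * ennreal (1 / (R\<^sup>2)\<^sup>2)) * (\<Psi> t * pospow (3 * \<kappa> + 4) (1 - t\<^sup>2)) \<partial>lborel)"
      using R by (simp add: power_mult_distrib mult_ac)
    also have "\<dots> = (k * k * k * ?K) * (ennreal (1 / (R\<^sup>2)\<^sup>2) * ennreal R) * ?T"
      by (subst nn_integral_cmult) (simp_all add: mult_ac)
    finally show "(\<integral>\<^sup>+c. (k * k * k * \<Psi> (c / sqrt (1 + a\<^sup>2 + b\<^sup>2))) *
      (pospow (3 * \<kappa> + 4) (1 - c\<^sup>2 / (1 + a\<^sup>2 + b\<^sup>2)) * ennreal (1 / (1 + a\<^sup>2 + b\<^sup>2)\<^sup>2) * ?K) \<partial>lborel)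
      = (k * k * k * ?K) * (ennreal (1 / (1 + a\<^sup>2 + b\<^sup>2)\<^sup>2) * ennreal (sqrt (1 + a\<^sup>2 + b\<^sup>2))) * ?T"
      unfolding R_def[symmetric] unfolding R2 sqrt_R2 .
  qed
  also have "\<dots> = k * k * k * ?K * ?A * ?T"
    by (simp add: nn_integral_cmult nn_integral_multc)
  finally show ?thesis .
qed

text \<open>Slicing by the parallel planes of slopes \<open>a\<close> and \<open>b\<close>, on which
  the argument of \<open>G\<close> is the intercept \<open>c\<close>. The Jacobian \<open>R\<close>
  of \<open>c = R * t\<close> cancels the \<open>1 / R\<close> of the section formula, so the law of
  the signed distance is the same for all directions.\<close>

lemma nn_integral_ball_weight_halfspace:
  fixes G :: "real \<Rightarrow> ennreal"
  assumes [measurable]: "G \<in> borel_measurable borel"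
  shows "(\<integral>\<^sup>+p. G (snd p - a * fst (fst p) - b * snd (fst p)) \<partial>density lborel (\<lambda>p. k * ball_weight \<kappa> p))
    = (k * (\<integral>\<^sup>+q. plane_weight \<kappa> 0 0 0 q \<partial>lborel)) *
      (\<integral>\<^sup>+t. G (sqrt (1 + a\<^sup>2 + b\<^sup>2) * t) * pospow (\<kappa> + 1) (1 - t\<^sup>2) \<partial>lborel)"
    (is "_ = (k * ?K) * ?T")
proof -
  define R where "R = sqrt (1 + a\<^sup>2 + b\<^sup>2)"
  have R: "R > 0" unfolding R_def by (simp add: add_pos_nonneg)
  have R2: "1 + a\<^sup>2 + b\<^sup>2 = R\<^sup>2" by (simp add: R_def add_nonneg_nonneg)
  have sqrt_R2: "sqrt (R\<^sup>2) = R" using R by simp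
  have "(\<integral>\<^sup>+p. G (snd p - a * fst (fst p) - b * snd (fst p)) \<partial>density lborel (\<lambda>p. k * ball_weight \<kappa> p))
    = (\<integral>\<^sup>+q. \<integral>\<^sup>+z. k * ball_weight \<kappa> (q, z) * G (z - a * fst q - b * snd q) \<partial>lborel \<partial>lborel)"
    by (subst nn_integral_ball_weight) simp_all
  also have "\<dots> = (\<integral>\<^sup>+q. \<integral>\<^sup>+c. (k * G c) * plane_weight \<kappa> a b c q \<partial>lborel \<partial>lborel)"
  proof (rule nn_integral_cong)
    fix q :: "real \<times> real"
    show "(\<integral>\<^sup>+z. k * ball_weight \<kappa> (q, z) * G (z - a * fst q - b * snd q) \<partial>lborel)
      = (\<integral>\<^sup>+c. (k * G c) * plane_weight \<kappa> a b c q \<partial>lborel)"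
      by (subst nn_integral_shift[where t = "a * fst q + b * snd q"])
        (simp_all add: ball_weight_plane[symmetric] algebra_simps)
  qed
  also have "\<dots> = (\<integral>\<^sup>+c. \<integral>\<^sup>+q. (k * G c) * plane_weight \<kappa> a b c q \<partial>lborel \<partial>lborel)"
    by (rule lborel_pair.Fubini') measurable
  also have "\<dots> = (\<integral>\<^sup>+c. (k * G c) * (pospow (\<kappa> + 1) (1 - c\<^sup>2 / R\<^sup>2) * ennreal (1 / R) * ?K) \<partial>lborel)"
    by (intro nn_integral_cong, subst nn_integral_cmult)
      (simp_all add: nn_integral_plane_weight[of \<kappa> a b] R2 sqrt_R2 abs_of_pos[OF R])
  also have "\<dots> = ennreal \<bar>R\<bar> * (\<integral>\<^sup>+t. (k * G (0 + R * t)) *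
      (pospow (\<kappa> + 1) (1 - (0 + R * t)\<^sup>2 / R\<^sup>2) * ennreal (1 / R) * ?K) \<partial>lborel)"
    by (rule nn_integral_real_affine) (use R in simp_all)
  also have "\<dots> = ennreal R * (\<integral>\<^sup>+t. (k * ennreal (1 / R) * ?K) * (G (R * t) * pospow (\<kappa> + 1) (1 - t\<^sup>2)) \<partial>lborel)"
    using R by (simp add: power_mult_distrib mult_ac)
  also have "\<dots> = (ennreal R * ennreal (1 / R)) * (k * ?K) * (\<integral>\<^sup>+t. G (R * t) * pospow (\<kappa> + 1) (1 - t\<^sup>2) \<partial>lborel)"
    by (subst nn_integral_cmult) (simp_all add: mult_ac)
  also have "ennreal R * ennreal (1 / R) = 1"
    using R by (simp flip: ennreal_mult)
  finally show ?thesis by (simp add: R_def)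
qed

section \<open>Separation of two points by the plane through three others\<close>

text \<open>Six times the signed volume of the tetrahedron \<open>a b c d\<close>; its sign tells on
  which side of the plane through \<open>a\<close>, \<open>b\<close>, \<open>c\<close> the point
  \<open>d\<close> lies.\<close>

definition triple_det :: "(real \<times> real) \<times> real \<Rightarrow> (real \<times> real) \<times> real \<Rightarrow> (real \<times> real) \<times> real \<Rightarrow> (real \<times> real) \<times> real \<Rightarrow> real" where
  "triple_det a b c d =
    (fst (fst b) - fst (fst a)) * ((snd (fst c) - snd (fst a)) * (snd d - snd a) - (snd (fst d) - snd (fst a)) * (snd c - snd a))
  - (fst (fst c) - fst (fst a)) * ((snd (fst b) - snd (fst a)) * (snd d - snd a) - (snd (fst d) - snd (fst a)) * (snd b - snd a))
  + (fst (fst d) - fst (fst a)) * ((snd (fst b) - snd (fst a)) * (snd c - snd a) - (snd (fst c) - snd (fst a)) * (snd b - snd a))"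

lemma triple_det_measurable [measurable (raw)]:
  assumes [measurable]: "f \<in> borel_measurable M" "g \<in> borel_measurable M" "h \<in> borel_measurable M" "k \<in> borel_measurable M"
  shows "(\<lambda>x. triple_det (f x) (g x) (h x) (k x)) \<in> borel_measurable M"
  unfolding triple_det_def by measurable

lemma triple_det_plane:
  "triple_det (q0, a * fst q0 + b * snd q0 + c) (q1, a * fst q1 + b * snd q1 + c) (q2, a * fst q2 + b * snd q2 + c) p
    = qdet q0 q1 q2 * (snd p - a * fst (fst p) - b * snd (fst p) - c)"
  unfolding triple_det_def qdet_def fst_conv snd_conv by algebra

text \<open>Given a plane at signed distance \<open>t\<close>, the last two points are independent
  and may lie on its two sides in two orders, hence the factor \<open>2\<close>. The integrals
  hidden in \<open>C\<close> and \<open>r\<close> are never evaluated: the constant test function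
  \<open>1\<close> identifies both constants through the total mass.\<close>

lemma prob_plane_separates:
  fixes \<kappa> :: real and k :: ennreal
  defines "\<nu> \<equiv> density lborel (\<lambda>p. k * ball_weight \<kappa> p)"
  assumes "prob_space \<nu>"
  obtains C r :: ennreal where
    "C * (\<integral>\<^sup>+t. pospow (3 * \<kappa> + 4) (1 - t\<^sup>2) \<partial>lborel) = 1"
    "r * (\<integral>\<^sup>+t. pospow (\<kappa> + 1) (1 - t\<^sup>2) \<partial>lborel) = 1"
    "(\<integral>\<^sup>+p0. \<integral>\<^sup>+p1. \<integral>\<^sup>+p2. \<integral>\<^sup>+p3. \<integral>\<^sup>+p4.
        indicator {d. d < 0} (triple_det p0 p1 p2 p3 * triple_det p0 p1 p2 p4) \<partial>\<nu> \<partial>\<nu> \<partial>\<nu> \<partial>\<nu> \<partial>\<nu>)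
      = C * (\<integral>\<^sup>+t. 2 * (r * (\<integral>\<^sup>+s. indicator {..<t} s * pospow (\<kappa> + 1) (1 - s\<^sup>2) \<partial>lborel)) *
            (r * (\<integral>\<^sup>+s. indicator {t<..} s * pospow (\<kappa> + 1) (1 - s\<^sup>2) \<partial>lborel)) *
            pospow (3 * \<kappa> + 4) (1 - t\<^sup>2) \<partial>lborel)"
proof -
  interpret \<nu>: prob_space \<nu> by fact
  have sets_\<nu> [measurable_cong, simp]: "sets \<nu> = sets borel" by (simp add: \<nu>_def)
  define C where "C = k * k * k * (\<integral>\<^sup>+q0. \<integral>\<^sup>+q1. \<integral>\<^sup>+q2. ennreal \<bar>qdet q0 q1 q2\<bar> *
        (plane_weight \<kappa> 0 0 0 q0 * plane_weight \<kappa> 0 0 0 q1 * plane_weight \<kappa> 0 0 0 q2) \<partial>lborel \<partial>lborel \<partial>lborel) *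
       (\<integral>\<^sup>+a. \<integral>\<^sup>+b. ennreal (1 / (1 + a\<^sup>2 + b\<^sup>2)\<^sup>2) * ennreal (sqrt (1 + a\<^sup>2 + b\<^sup>2)) \<partial>lborel \<partial>lborel)"
  define r where "r = k * (\<integral>\<^sup>+q. plane_weight \<kappa> 0 0 0 q \<partial>lborel)"
  have one: "(\<integral>\<^sup>+p. 1 \<partial>\<nu>) = 1"
    using \<nu>.emeasure_space_1 by simp
  show thesis
  proof (rule that)
    have "(\<integral>\<^sup>+p0. \<integral>\<^sup>+p1. \<integral>\<^sup>+p2. 1 \<partial>\<nu> \<partial>\<nu> \<partial>\<nu>) = C * (\<integral>\<^sup>+t. 1 * pospow (3 * \<kappa> + 4) (1 - t\<^sup>2) \<partial>lborel)"
      unfolding C_def \<nu>_def by (rule nn_integral_ball_weight_plane) simp_all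
    then show "C * (\<integral>\<^sup>+t. pospow (3 * \<kappa> + 4) (1 - t\<^sup>2) \<partial>lborel) = 1"
      by (simp only: one mult_1_left)
    have "(\<integral>\<^sup>+p. 1 \<partial>\<nu>) = r * (\<integral>\<^sup>+t. 1 * pospow (\<kappa> + 1) (1 - t\<^sup>2) \<partial>lborel)"
      using nn_integral_ball_weight_halfspace[of "\<lambda>_. 1" k \<kappa> 0 0] unfolding \<nu>_def r_def by simp
    then show "r * (\<integral>\<^sup>+t. pospow (\<kappa> + 1) (1 - t\<^sup>2) \<partial>lborel) = 1"
      by (simp only: one mult_1_left)
    let ?I = "indicator {d. d < 0} :: real \<Rightarrow> ennreal"
    let ?F = "\<lambda>t::real. r * (\<integral>\<^sup>+s. indicator {..<t} s * pospow (\<kappa> + 1) (1 - s\<^sup>2) \<partial>lborel)"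
    let ?F' = "\<lambda>t::real. r * (\<integral>\<^sup>+s. indicator {t<..} s * pospow (\<kappa> + 1) (1 - s\<^sup>2) \<partial>lborel)"
    show "(\<integral>\<^sup>+p0. \<integral>\<^sup>+p1. \<integral>\<^sup>+p2. \<integral>\<^sup>+p3. \<integral>\<^sup>+p4.
        ?I (triple_det p0 p1 p2 p3 * triple_det p0 p1 p2 p4) \<partial>\<nu> \<partial>\<nu> \<partial>\<nu> \<partial>\<nu> \<partial>\<nu>)
      = C * (\<integral>\<^sup>+t. 2 * ?F t * ?F' t * pospow (3 * \<kappa> + 4) (1 - t\<^sup>2) \<partial>lborel)"
      unfolding C_def \<nu>_def
    proof (rule nn_integral_ball_weight_plane, goal_cases)
      case 1
      have [measurable_cong]: "sets (density lborel (\<lambda>p. k * ball_weight \<kappa> p)) = sets borel" by simp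
      interpret N: prob_space "density lborel (\<lambda>p. k * ball_weight \<kappa> p)"
        using \<open>prob_space \<nu>\<close> unfolding \<nu>_def .
      show ?case by measurable
    next
      case 2
      show ?case
        unfolding indicator_def of_bool_def lessThan_iff greaterThan_iff by measurable
    next
      case (3 a b c q0 q1 q2)
      define R where "R = sqrt (1 + a\<^sup>2 + b\<^sup>2)"
      have R: "R > 0" unfolding R_def by (simp add: add_pos_nonneg)
      define g where "g p = snd p - a * fst (fst p) - b * snd (fst p)" for p
      have [measurable]: "g \<in> borel_measurable borel" unfolding g_def by measurable
      have sgn: "?I (triple_det (q0, a * fst q0 + b * snd q0 + c) (q1, a * fst q1 + b * snd q1 + c) (q2, a * fst q2 + b * snd q2 + c) p3 *
          triple_det (q0, a * fst q0 + b * snd q0 + c) (q1, a * fst q1 + b * snd q1 + c) (q2, a * fst q2 + b * snd q2 + c) p4)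
        = indicator {..<c} (g p3) * indicator {c<..} (g p4) + indicator {c<..} (g p3) * indicator {..<c} (g p4)" for p3 p4
      proof -
        \<comment> \<open>\<open>qdet\<close> is a factor of both determinants and so enters
          squared; the orientation of the base triangle drops out.\<close>
        have "qdet q0 q1 q2 * (g p3 - c) * (qdet q0 q1 q2 * (g p4 - c)) < 0 \<longleftrightarrow> (g p3 - c) * (g p4 - c) < 0"
          using 3 by (auto simp: mult_less_0_iff zero_less_mult_iff)
        then show ?thesis
          unfolding triple_det_plane g_def[symmetric]
          by (auto simp: indicator_def mult_less_0_iff)
      qed
      have F: "(\<integral>\<^sup>+p. indicator {..<c} (g p) \<partial>\<nu>) = ?F (c / R)"
      proof -
        have "(\<integral>\<^sup>+p. indicator {..<c} (g p) \<partial>\<nu>) = r * (\<integral>\<^sup>+t. indicator {..<c} (R * t) * pospow (\<kappa> + 1) (1 - t\<^sup>2) \<partial>lborel)"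
          unfolding g_def \<nu>_def r_def R_def by (rule nn_integral_ball_weight_halfspace) simp
        moreover have "indicator {..<c} (R * t) = (indicator {..<c / R} t :: ennreal)" for t
          using R by (auto simp: indicator_def field_simps)
        ultimately show ?thesis by simp
      qed
      have F': "(\<integral>\<^sup>+p. indicator {c<..} (g p) \<partial>\<nu>) = ?F' (c / R)"
      proof -
        have "(\<integral>\<^sup>+p. indicator {c<..} (g p) \<partial>\<nu>) = r * (\<integral>\<^sup>+t. indicator {c<..} (R * t) * pospow (\<kappa> + 1) (1 - t\<^sup>2) \<partial>lborel)"
          unfolding g_def \<nu>_def r_def R_def by (rule nn_integral_ball_weight_halfspace) simp
        moreover have "indicator {c<..} (R * t) = (indicator {c / R<..} t :: ennreal)" for t
          using R by (auto simp: indicator_def field_simps)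
        ultimately show ?thesis by simp
      qed
      have "(\<integral>\<^sup>+p3. \<integral>\<^sup>+p4. indicator {..<c} (g p3) * indicator {c<..} (g p4) + indicator {c<..} (g p3) * indicator {..<c} (g p4) \<partial>\<nu> \<partial>\<nu>)
        = ?F (c / R) * ?F' (c / R) + ?F' (c / R) * ?F (c / R)"
        by (simp add: nn_integral_add nn_integral_cmult nn_integral_multc F F' mult.commute)
      also have "\<dots> = 2 * ?F (c / R) * ?F' (c / R)"
        by (subst mult.commute) (simp only: mult_2 distrib_right)
      finally show ?case
        unfolding sgn \<nu>_def[symmetric] R_def[symmetric] .
    qed
  qed
qed

section \<open>The one-dimensional integrals\<close>

text \<open>Under \<open>t = x^2\<close> the singular factor \<open>t powr (-1/2)\<close> of the
  Beta integral cancels against the derivative \<open>2 * x\<close>; the remaining factor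
  \<open>2\<close> is used up by reflecting \<open>[0, 1]\<close> onto
  \<open>[-1, 0]\<close>.\<close>

lemma nn_integral_pospow_Beta:
  assumes "\<gamma> > 0"
  shows "(\<integral>\<^sup>+t. pospow \<gamma> (1 - t\<^sup>2) \<partial>lborel) = ennreal (Beta (1 / 2) (\<gamma> + 1))"
proof -
  have pw: "ennreal ((1 - x\<^sup>2) powr \<gamma> * indicator {-1..1} x) = pospow \<gamma> (1 - x\<^sup>2)" for x :: real
    by (auto simp: pospow_def indicator_def abs_square_less_1 abs_square_le_1 abs_square_eq_1)
  have "((\<lambda>t. t powr (-1 / 2) * (1 - t) powr \<gamma>) has_integral Beta (1 / 2) (\<gamma> + 1)) {0..1}"
    using has_integral_Beta_real[of "1/2" "\<gamma> + 1"] assms by simp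
  from nn_integral_has_integral_lebesgue[OF _ this] have
     "ennreal (Beta (1 / 2) (\<gamma> + 1)) =
        nn_integral lborel (\<lambda>t. ennreal (t powr (-1 / 2) * (1 - t) powr \<gamma> * indicator {0^2..1^2} t))"
    by (simp add: mult_ac ennreal_mult' ennreal_indicator)
  also have "\<dots> = (\<integral>\<^sup>+ x. ennreal (x\<^sup>2 powr - (1 / 2) * (1 - x\<^sup>2) powr \<gamma> * (2 * x) * indicator {0..1} x) \<partial>lborel)"
    by (subst nn_integral_substitution[where g = "\<lambda>x. x ^ 2" and g' = "\<lambda>x. 2 * x"])
       (auto intro!: derivative_eq_intros continuous_intros simp: set_borel_measurable_def)
  also have "\<dots> = (\<integral>\<^sup>+ x. 2 * ennreal ((1 - x\<^sup>2) powr \<gamma> * indicator {0..1} x) \<partial>lborel)"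
    by (intro nn_integral_cong_AE AE_I[of _ _ "{0}"])
       (auto simp: indicator_def powr_minus powr_half_sqrt field_split_simps ennreal_mult')
  also have "\<dots> = (\<integral>\<^sup>+ x. ennreal ((1 - x\<^sup>2) powr \<gamma> * indicator {0..1} x) \<partial>lborel) +
                    (\<integral>\<^sup>+ x. ennreal ((1 - x\<^sup>2) powr \<gamma> * indicator {0..1} x) \<partial>lborel)"
    (is "_ = ?I + _") by (simp add: mult_2 nn_integral_add)
  also have "?I = (\<integral>\<^sup>+ x. ennreal ((1 - x\<^sup>2) powr \<gamma> * indicator {-1..0} x) \<partial>lborel)"
    by (subst nn_integral_real_affine[of _ "-1" 0])
       (auto simp: indicator_def intro!: nn_integral_cong)
  hence "?I + ?I = \<dots> + ?I" by simp
  also have "\<dots> = (\<integral>\<^sup>+ x. ennreal ((1 - x\<^sup>2) powr \<gamma> * (indicator {-1..0} x + indicator{0..1} x)) \<partial>lborel)"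
    by (subst nn_integral_add [symmetric]) (auto simp: algebra_simps)
  also have "\<dots> = (\<integral>\<^sup>+ x. ennreal ((1 - x\<^sup>2) powr \<gamma> * indicator {-1..1} x) \<partial>lborel)"
    by (intro nn_integral_cong_AE AE_I[of _ _ "{0}"]) (auto simp: indicator_def)
  finally show ?thesis unfolding pw ..
qed

lemma continuous_on_beta_weight [continuous_intros]:
  "\<gamma> > 0 \<Longrightarrow> continuous_on {-1..1} (\<lambda>t::real. (1 - t\<^sup>2) powr \<gamma>)"
  by (intro continuous_on_powr') (auto intro!: continuous_intros simp: abs_square_le_1)

text \<open>Here the unsigned integrals meet the real ones of the final formula; continuity on a
  compact interval makes the real integral exist.\<close>

lemma nn_integral_pospow_interval:
  assumes "\<gamma> > 0" "{a..b} \<subseteq> {-1..1}"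
  shows "(\<integral>\<^sup>+s. indicator {a..b} s * pospow \<gamma> (1 - s\<^sup>2) \<partial>lborel) = ennreal (integral {a..b} (\<lambda>s. (1 - s\<^sup>2) powr \<gamma>))"
proof -
  have "(\<lambda>s::real. (1 - s\<^sup>2) powr \<gamma>) integrable_on {a..b}"
    using assms by (intro integrable_continuous_real continuous_on_subset[OF continuous_on_beta_weight])
  then have "((\<lambda>s::real. (1 - s\<^sup>2) powr \<gamma>) has_integral integral {a..b} (\<lambda>s. (1 - s\<^sup>2) powr \<gamma>)) {a..b}"
    by (rule integrable_integral)
  from nn_integral_has_integral_lebesgue'[OF _ this]
  have "ennreal (integral {a..b} (\<lambda>s. (1 - s\<^sup>2) powr \<gamma>)) = (\<integral>\<^sup>+s. ennreal ((1 - s\<^sup>2) powr \<gamma>) * indicator {a..b} s \<partial>lborel)"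
    by simp
  also have "\<dots> = (\<integral>\<^sup>+s. indicator {a..b} s * pospow \<gamma> (1 - s\<^sup>2) \<partial>lborel)"
  proof (intro nn_integral_cong)
    fix s :: real
    have "1 - s\<^sup>2 \<ge> 0" if "s \<in> {a..b}"
      using that assms by (auto simp: abs_square_le_1)
    then show "ennreal ((1 - s\<^sup>2) powr \<gamma>) * indicator {a..b} s = indicator {a..b} s * pospow \<gamma> (1 - s\<^sup>2)"
      by (auto simp: indicator_def pospow_def)
  qed
  finally show ?thesis ..
qed

lemma pospow_outside: "\<bar>s\<bar> > 1 \<Longrightarrow> pospow \<gamma> (1 - s\<^sup>2) = 0"
  using abs_square_less_1[of s] abs_square_le_1[of s] by (auto simp: pospow_def not_less)

text \<open>How a normalisation turns an unknown and possibly infinite constant into a real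
  number.\<close>

lemma ennreal_eq_inverse:
  assumes "r * ennreal b = 1" "b > 0"
  shows "r = ennreal (1 / b)"
proof -
  have "r = r * (ennreal b * ennreal (1 / b))" using assms by (simp flip: ennreal_mult)
  also have "\<dots> = ennreal (1 / b)" using assms by (simp add: mult.assoc[symmetric])
  finally show ?thesis .
qed

text \<open>Let \<open>F = G / b1\<close> be the distribution function of the density
  \<open>w1 / b1\<close> and let \<open>t\<close> have the density \<open>w3 / b3\<close>. The left
  side is \<open>E (2 F (1 - F))\<close>; both densities are even, so \<open>E F = 1/2\<close> and
  \<open>1 - 2 E (F^2)\<close> remains. Sine substitutions in the inner and outer integral give the
  trigonometric form.\<close>

lemma nn_integral_beta_cdf_product:
  fixes \<beta> :: real
  assumes \<beta>: "\<beta> \<ge> -1"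
    and C: "C * (\<integral>\<^sup>+t. pospow (3 * \<beta> + 11 / 2) (1 - t\<^sup>2) \<partial>lborel) = 1"
    and r: "r * (\<integral>\<^sup>+t. pospow (\<beta> + 3 / 2) (1 - t\<^sup>2) \<partial>lborel) = 1"
  shows "C * (\<integral>\<^sup>+t. 2 * (r * (\<integral>\<^sup>+s. indicator {..<t} s * pospow (\<beta> + 3 / 2) (1 - s\<^sup>2) \<partial>lborel)) *
            (r * (\<integral>\<^sup>+s. indicator {t<..} s * pospow (\<beta> + 3 / 2) (1 - s\<^sup>2) \<partial>lborel)) *
            pospow (3 * \<beta> + 11 / 2) (1 - t\<^sup>2) \<partial>lborel)
    = ennreal (1 - 2 / (Beta (1 / 2) (3 * \<beta> + 13 / 2) * (Beta (1 / 2) (\<beta> + 5 / 2))\<^sup>2) *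
        integral {- pi / 2..pi / 2} (\<lambda>\<phi>. cos \<phi> powr (6 * \<beta> + 12) *
        (integral {- pi / 2..\<phi>} (\<lambda>\<theta>. cos \<theta> powr (2 * \<beta> + 4)))\<^sup>2))"
proof -
  define \<gamma>1 \<gamma>3 where "\<gamma>1 = \<beta> + 3 / 2" and "\<gamma>3 = 3 * \<beta> + 11 / 2"
  have \<gamma>: "\<gamma>1 > 0" "\<gamma>3 > 0" using \<beta> by (simp_all add: \<gamma>1_def \<gamma>3_def)
  define w1 w3 where "w1 t = (1 - t\<^sup>2) powr \<gamma>1" and "w3 t = (1 - t\<^sup>2) powr \<gamma>3" for t :: real
  have cont: "continuous_on {-1..1} w1" "continuous_on {-1..1} w3"
    unfolding w1_def [abs_def] w3_def [abs_def] using \<gamma> by (auto intro: continuous_on_beta_weight)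
  define b1 b3 where "b1 = Beta (1 / 2) (\<gamma>1 + 1)" and "b3 = Beta (1 / 2) (\<gamma>3 + 1)"
  have b: "b1 > 0" "b3 > 0" using \<gamma> by (simp_all add: b1_def b3_def Beta_def)
  have r: "r = ennreal (1 / b1)"
    by (rule ennreal_eq_inverse) (use r nn_integral_pospow_Beta[OF \<gamma>(1)] b in \<open>simp_all add: b1_def \<gamma>1_def\<close>)
  have C: "C = ennreal (1 / b3)"
    by (rule ennreal_eq_inverse) (use C nn_integral_pospow_Beta[OF \<gamma>(2)] b in \<open>simp_all add: b3_def \<gamma>3_def\<close>)
  have whole: "(\<integral>\<^sup>+t. pospow \<gamma> (1 - t\<^sup>2) \<partial>lborel) = (\<integral>\<^sup>+t. indicator {-1..1} t * pospow \<gamma> (1 - t\<^sup>2) \<partial>lborel)" for \<gamma>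
    by (intro nn_integral_cong) (use pospow_outside in \<open>auto simp: indicator_def\<close>)
  have int1: "integral {-1..1} w1 = b1"
  proof -
    have "ennreal (integral {-1..1} w1) = ennreal b1"
      using nn_integral_pospow_interval[OF \<gamma>(1), of "-1" 1] nn_integral_pospow_Beta[OF \<gamma>(1)] whole[of \<gamma>1]
      by (simp add: w1_def [abs_def] b1_def)
    moreover have "integral {-1..1} w1 \<ge> 0"
      by (rule integral_nonneg) (use cont in \<open>auto intro: integrable_continuous_real simp: w1_def\<close>)
    ultimately show ?thesis using b by simp
  qed
  have int3: "integral {-1..1} w3 = b3"
  proof -
    have "ennreal (integral {-1..1} w3) = ennreal b3"
      using nn_integral_pospow_interval[OF \<gamma>(2), of "-1" 1] nn_integral_pospow_Beta[OF \<gamma>(2)] whole[of \<gamma>3]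
      by (simp add: w3_def [abs_def] b3_def)
    moreover have "integral {-1..1} w3 \<ge> 0"
      by (rule integral_nonneg) (use cont in \<open>auto intro: integrable_continuous_real simp: w3_def\<close>)
    ultimately show ?thesis using b by simp
  qed
  define G where "G t = integral {-1..t} w1" for t
  have int1': "w1 integrable_on {-1..1}" using cont(1) by (rule integrable_continuous_real)
  have contG: "continuous_on {-1..1} G"
    unfolding G_def [abs_def] by (rule indefinite_integral_continuous_1[OF int1'])
  have Gc: "integral {t..1} w1 = b1 - G t" if "t \<in> {-1..1}" for t
    using Henstock_Kurzweil_Integration.integral_combine[where a = "-1" and c = t and b = 1 and f = w1] that int1' int1 by (simp add: G_def)
  have G0: "G t \<ge> 0" "G t \<le> b1" if "t \<in> {-1..1}" for t
  proof -
    show "G t \<ge> 0" unfolding G_def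
      by (rule integral_nonneg) (use that cont in \<open>auto intro!: integrable_continuous_real intro: continuous_on_subset simp: w1_def\<close>)
    have "integral {t..1} w1 \<ge> 0"
      by (rule integral_nonneg) (use that cont in \<open>auto intro!: integrable_continuous_real intro: continuous_on_subset simp: w1_def\<close>)
    then show "G t \<le> b1" using Gc[OF that] by simp
  qed
  have G_minus: "G (- t) = b1 - G t" if "t \<in> {-1..1}" for t
  proof -
    have "G (- t) = integral {- 1.. - t} (\<lambda>x. w1 (- x))"
      unfolding G_def by (intro integral_cong) (simp add: w1_def)
    also have "\<dots> = integral {t..1} w1" by (rule Henstock_Kurzweil_Integration.integral_reflect_real)
    finally show ?thesis using Gc[OF that] by simp
  qed
  have left: "(\<integral>\<^sup>+s. indicator {..<t} s * pospow \<gamma>1 (1 - s\<^sup>2) \<partial>lborel) = ennreal (G t)" if "t \<in> {-1..1}" for t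
  proof -
    \<comment> \<open>The ray and the interval differ in the null point \<open>t\<close> and where
      \<open>pospow\<close> is cut off.\<close>
    have "(\<integral>\<^sup>+s. indicator {..<t} s * pospow \<gamma>1 (1 - s\<^sup>2) \<partial>lborel) = (\<integral>\<^sup>+s. indicator {-1..t} s * pospow \<gamma>1 (1 - s\<^sup>2) \<partial>lborel)"
      by (intro nn_integral_cong_AE AE_I[of _ _ "{t}"])
        (use that pospow_outside in \<open>auto simp: indicator_def split: if_splits\<close>)
    then show ?thesis
      using that nn_integral_pospow_interval[OF \<gamma>(1), of "-1" t] by (simp add: G_def w1_def [abs_def])
  qed
  have right: "(\<integral>\<^sup>+s. indicator {t<..} s * pospow \<gamma>1 (1 - s\<^sup>2) \<partial>lborel) = ennreal (b1 - G t)" if "t \<in> {-1..1}" for t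
  proof -
    have "(\<integral>\<^sup>+s. indicator {t<..} s * pospow \<gamma>1 (1 - s\<^sup>2) \<partial>lborel) = (\<integral>\<^sup>+s. indicator {t..1} s * pospow \<gamma>1 (1 - s\<^sup>2) \<partial>lborel)"
      by (intro nn_integral_cong_AE AE_I[of _ _ "{t}"])
        (use that pospow_outside in \<open>auto simp: indicator_def split: if_splits\<close>)
    then show ?thesis
      using that nn_integral_pospow_interval[OF \<gamma>(1), of t 1] Gc[OF that] by (simp add: w1_def [abs_def])
  qed
  define F where "F t = G t / b1" for t
  have contF: "continuous_on {-1..1} F"
    unfolding F_def [abs_def] using contG b by (intro continuous_intros) auto
  have contp: "continuous_on {-1..1} (\<lambda>t. 2 * F t * (1 - F t) * w3 t)"
    using contF cont by (intro continuous_intros)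
  have "(\<integral>\<^sup>+t. 2 * (r * (\<integral>\<^sup>+s. indicator {..<t} s * pospow \<gamma>1 (1 - s\<^sup>2) \<partial>lborel)) *
            (r * (\<integral>\<^sup>+s. indicator {t<..} s * pospow \<gamma>1 (1 - s\<^sup>2) \<partial>lborel)) * pospow \<gamma>3 (1 - t\<^sup>2) \<partial>lborel)
    = (\<integral>\<^sup>+t. ennreal (2 * F t * (1 - F t) * w3 t) * indicator {-1..1} t \<partial>lborel)"
  proof (intro nn_integral_cong)
    fix t :: real
    show "2 * (r * (\<integral>\<^sup>+s. indicator {..<t} s * pospow \<gamma>1 (1 - s\<^sup>2) \<partial>lborel)) *
            (r * (\<integral>\<^sup>+s. indicator {t<..} s * pospow \<gamma>1 (1 - s\<^sup>2) \<partial>lborel)) * pospow \<gamma>3 (1 - t\<^sup>2)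
      = ennreal (2 * F t * (1 - F t) * w3 t) * indicator {-1..1} t"
    proof (cases "t \<in> {-1..1}")
      case True
      have eL: "r * ennreal (G t) = ennreal (F t)" "r * ennreal (b1 - G t) = ennreal (1 - F t)"
        using b G0[OF True] by (simp_all add: r F_def field_simps flip: ennreal_mult)
      have "1 - t\<^sup>2 \<ge> 0" using True by (auto simp: abs_square_le_1)
      then have "pospow \<gamma>3 (1 - t\<^sup>2) = ennreal (w3 t)"
        by (auto simp: pospow_def w3_def)
      moreover have "0 \<le> F t" "0 \<le> 1 - F t" "0 \<le> w3 t"
        using b G0[OF True] by (simp_all add: F_def w3_def)
      ultimately show ?thesis
        using True unfolding left[OF True] right[OF True] eL
        by (simp flip: ennreal_mult ennreal_numeral)
    next
      case False
      then show ?thesis using pospow_outside[of t \<gamma>3] by auto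
    qed
  qed
  also have "\<dots> = ennreal (integral {-1..1} (\<lambda>t. 2 * F t * (1 - F t) * w3 t))"
  proof (rule nn_integral_has_integral_lebesgue')
    show "((\<lambda>t. 2 * F t * (1 - F t) * w3 t) has_integral integral {-1..1} (\<lambda>t. 2 * F t * (1 - F t) * w3 t)) {-1..1}"
      using contp by (intro integrable_integral integrable_continuous_real)
  next
    fix t :: real assume "t \<in> {-1..1}"
    then show "0 \<le> 2 * F t * (1 - F t) * w3 t"
      using b G0[of t] by (simp add: F_def w3_def)
  qed
  also have "integral {-1..1} (\<lambda>t. 2 * F t * (1 - F t) * w3 t) = b3 - 2 * integral {-1..1} (\<lambda>t. (F t)\<^sup>2 * w3 t)"
  proof -
    have iF: "(\<lambda>t. F t * w3 t) integrable_on {-1..1}" "(\<lambda>t. (F t)\<^sup>2 * w3 t) integrable_on {-1..1}" "w3 integrable_on {-1..1}"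
      by (rule integrable_continuous_real, intro continuous_intros contF cont)+
    \<comment> \<open>Reflection exchanges \<open>F\<close> with \<open>1 - F\<close> under the even
      weight, so this integral equals \<open>b3\<close> minus itself.\<close>
    have "integral {-1..1} (\<lambda>t. F t * w3 t) = integral {-1..1} (\<lambda>t. F (- t) * w3 (- t))"
      using Henstock_Kurzweil_Integration.integral_reflect_real[where a = "-1" and b = 1 and f = "\<lambda>t. F t * w3 t"] by simp
    also have "\<dots> = integral {-1..1} (\<lambda>t. w3 t - F t * w3 t)"
    proof (intro integral_cong)
      fix t :: real assume "t \<in> {-1..1}"
      then have "F (- t) = 1 - F t" using G_minus[of t] b by (simp add: F_def field_simps)
      then show "F (- t) * w3 (- t) = w3 t - F t * w3 t" by (simp add: w3_def left_diff_distrib)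
    qed
    also have "\<dots> = b3 - integral {-1..1} (\<lambda>t. F t * w3 t)"
      using iF int3 by (simp add: integral_diff)
    finally have half: "2 * integral {-1..1} (\<lambda>t. F t * w3 t) = b3" by simp
    have "integral {-1..1} (\<lambda>t. 2 * F t * (1 - F t) * w3 t) = integral {-1..1} (\<lambda>t. 2 * (F t * w3 t) - 2 * ((F t)\<^sup>2 * w3 t))"
      by (intro integral_cong) (simp add: algebra_simps power2_eq_square)
    also have "\<dots> = 2 * integral {-1..1} (\<lambda>t. F t * w3 t) - 2 * integral {-1..1} (\<lambda>t. (F t)\<^sup>2 * w3 t)"
      using iF by (subst integral_diff) (auto intro: integrable_on_cmult_left)
    finally show ?thesis using half by simp
  qed
  also have "integral {-1..1} (\<lambda>t. (F t)\<^sup>2 * w3 t) = integral {-1..1} (\<lambda>t. (G t)\<^sup>2 * w3 t) / b1\<^sup>2"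
    by (simp add: F_def power_divide flip: integral_divide)
  also have "integral {-1..1} (\<lambda>t. (G t)\<^sup>2 * w3 t)
    = integral {- pi / 2..pi / 2} (\<lambda>\<phi>. cos \<phi> powr (6 * \<beta> + 12) *
        (integral {- pi / 2..\<phi>} (\<lambda>\<theta>. cos \<theta> powr (2 * \<beta> + 4)))\<^sup>2)"
  proof -
    \<comment> \<open>Origin of the cosine exponents: \<open>2 * \<gamma> + 1\<close> is
      \<open>2 * \<beta> + 4\<close> for \<open>\<gamma>1\<close> and
      \<open>6 * \<beta> + 12\<close> for \<open>\<gamma>3\<close>. Where the cosine vanishes both
      sides are \<open>0\<close>, as \<open>0 powr y = 0\<close>.\<close>
    have cos_powr: "cos x * (1 - (sin x)\<^sup>2) powr \<gamma> = cos x powr (2 * \<gamma> + 1)"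
      if "x \<in> {-pi/2..pi/2}" for x \<gamma>
    proof (cases "cos x = 0")
      case False
      moreover have "cos x \<ge> 0" using that by (intro cos_ge_zero) auto
      ultimately have "cos x > 0" by simp
      moreover have *: "1 - (sin x)\<^sup>2 = cos x powr 2"
        using \<open>cos x > 0\<close> by (simp add: cos_squared_eq)
      ultimately show ?thesis
        unfolding * powr_powr powr_add by simp
    qed simp
    have Gsin: "G (sin \<phi>) = integral {-pi/2..\<phi>} (\<lambda>\<theta>. cos \<theta> powr (2 * \<beta> + 4))" if "\<phi> \<in> {-pi/2..pi/2}" for \<phi>
    proof -
      have "((\<lambda>x. cos x *\<^sub>R w1 (sin x)) has_integral integral {sin (-pi/2)..sin \<phi>} w1) {-pi/2..\<phi>}"
        by (rule has_integral_substitution[where c = "-1" and d = 1])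
          (use that cont in \<open>auto intro!: derivative_eq_intros sin_monotone_2pi_le\<close>)
      then have "G (sin \<phi>) = integral {-pi/2..\<phi>} (\<lambda>x. cos x *\<^sub>R w1 (sin x))"
        by (simp add: G_def integral_unique)
      also have "\<dots> = integral {-pi/2..\<phi>} (\<lambda>\<theta>. cos \<theta> powr (2 * \<beta> + 4))"
        using that cos_powr[of _ \<gamma>1] by (intro integral_cong) (simp add: w1_def \<gamma>1_def algebra_simps)
      finally show ?thesis .
    qed
    have "((\<lambda>x. cos x *\<^sub>R ((G (sin x))\<^sup>2 * w3 (sin x))) has_integral integral {sin (-pi/2)..sin (pi/2)} (\<lambda>t. (G t)\<^sup>2 * w3 t)) {-pi/2..pi/2}"
      by (rule has_integral_substitution[where c = "-1" and d = 1])
        (use contG cont in \<open>auto intro!: derivative_eq_intros continuous_intros\<close>)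
    then have "integral {-1..1} (\<lambda>t. (G t)\<^sup>2 * w3 t) = integral {-pi/2..pi/2} (\<lambda>x. cos x *\<^sub>R ((G (sin x))\<^sup>2 * w3 (sin x)))"
      by (simp add: integral_unique)
    also have "\<dots> = integral {- pi / 2..pi / 2} (\<lambda>\<phi>. cos \<phi> powr (6 * \<beta> + 12) *
        (integral {- pi / 2..\<phi>} (\<lambda>\<theta>. cos \<theta> powr (2 * \<beta> + 4)))\<^sup>2)"
    proof (intro integral_cong)
      have comm: "c *\<^sub>R (A * w) = (c * w) * A" for c A w :: real by simp
      fix x :: real assume x: "x \<in> {-pi/2..pi/2}"
      have "cos x * w3 (sin x) = cos x powr (6 * \<beta> + 12)"
        using cos_powr[OF x, of \<gamma>3] by (simp add: w3_def \<gamma>3_def algebra_simps)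
      then show "cos x *\<^sub>R ((G (sin x))\<^sup>2 * w3 (sin x)) = cos x powr (6 * \<beta> + 12) *
        (integral {- pi / 2..x} (\<lambda>\<theta>. cos \<theta> powr (2 * \<beta> + 4)))\<^sup>2"
        unfolding comm Gsin[OF x] by (simp only:)
    qed
    finally show ?thesis .
  qed
  finally have *: "C * (\<integral>\<^sup>+t. 2 * (r * (\<integral>\<^sup>+s. indicator {..<t} s * pospow \<gamma>1 (1 - s\<^sup>2) \<partial>lborel)) *
            (r * (\<integral>\<^sup>+s. indicator {t<..} s * pospow \<gamma>1 (1 - s\<^sup>2) \<partial>lborel)) * pospow \<gamma>3 (1 - t\<^sup>2) \<partial>lborel)
    = ennreal (1 / b3) * ennreal (b3 - 2 * (integral {- pi / 2..pi / 2} (\<lambda>\<phi>. cos \<phi> powr (6 * \<beta> + 12) *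
        (integral {- pi / 2..\<phi>} (\<lambda>\<theta>. cos \<theta> powr (2 * \<beta> + 4)))\<^sup>2) / b1\<^sup>2))" (is "_ = _ * ennreal (b3 - 2 * (?J / _))")
    unfolding C by simp
  also have "\<dots> = ennreal (1 / b3 * (b3 - 2 * (?J / b1\<^sup>2)))"
    using b by (intro ennreal_mult'[symmetric]) simp
  also have "1 / b3 * (b3 - 2 * (?J / b1\<^sup>2)) = 1 - 2 / (b3 * b1\<^sup>2) * ?J"
    using b by (simp add: right_diff_distrib)
  finally show ?thesis
    by (simp add: b1_def b3_def \<gamma>1_def \<gamma>3_def add.commute)
qed

section \<open>Rotation invariance and projection of the beta distribution\<close>

lemma distr_lborel_orthogonal:
  fixes R :: "real ^ 'n::{finite,wellorder} \<Rightarrow> real ^ 'n::_"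
  assumes R: "orthogonal_transformation R"
  shows "distr lborel borel R = lborel"
proof (rule lborel_eqI[symmetric])
  have lin: "linear R" using R by (rule orthogonal_transformation_linear)
  have [measurable]: "R \<in> borel_measurable borel"
    using lin by (simp add: linear_conv_bounded_linear borel_measurable_continuous_onI linear_continuous_on)
  obtain S where S: "orthogonal_transformation S" "\<And>x. S (R x) = x" "\<And>x. R (S x) = x"
    using orthogonal_transformation_inv[OF R] orthogonal_transformation_bij[OF R]
    by (metis bij_inv_eq_iff)
  fix l u :: "real ^ 'n::{finite,wellorder}"
  assume le: "\<And>b. b \<in> Basis \<Longrightarrow> l \<bullet> b \<le> u \<bullet> b"
  \<comment> \<open>A preimage under \<open>R\<close> is an image under the inverse isometry, and
    isometries preserve the volume of a box.\<close>
  have vim: "R -` box l u = S ` box l u" using S by (auto simp: image_iff) (metis)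
  have B: "R -` box l u \<in> sets borel" using measurable_sets[of R borel borel "box l u"] by simp
  have "emeasure (distr lborel borel R) (box l u) = emeasure lborel (R -` box l u)"
    by (simp add: emeasure_distr)
  also have "\<dots> = emeasure lebesgue (S ` box l u)"
    using B by (simp add: vim)
  also have "\<dots> = ennreal (measure lebesgue (S ` box l u))"
    using measurable_orthogonal_image[OF S(1), of "box l u"] by (intro emeasure_eq_measure2) simp
  also have "\<dots> = ennreal (measure lebesgue (box l u))"
    by (subst measure_orthogonal_image[OF S(1)]) simp_all
  also have "\<dots> = (\<Prod>b\<in>Basis. (u - l) \<bullet> b)"
    using le by (simp add: measure_lborel_box_eq)
  finally show "emeasure (distr lborel borel R) (box l u) = (\<Prod>b\<in>Basis. (u - l) \<bullet> b)" .
qed simp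

lemma distr_density_invariant:
  assumes [measurable]: "R \<in> measurable M M" "f \<in> borel_measurable M"
    and "distr M M R = M" "\<And>x. x \<in> space M \<Longrightarrow> f (R x) = f x"
  shows "distr (density M f) M R = density M f"
proof (rule measure_eqI)
  fix A assume "A \<in> sets (distr (density M f) M R)"
  then have [measurable]: "A \<in> sets M" by simp
  have "emeasure (distr (density M f) M R) A = (\<integral>\<^sup>+x. f x * indicator (R -` A \<inter> space M) x \<partial>M)"
    by (subst emeasure_distr) (auto simp: emeasure_density)
  also have "\<dots> = (\<integral>\<^sup>+x. f (R x) * indicator A (R x) \<partial>M)"
    using assms(4) by (intro nn_integral_cong) (auto simp: indicator_def)
  also have "\<dots> = (\<integral>\<^sup>+x. f x * indicator A x \<partial>distr M M R)"
    by (subst nn_integral_distr) auto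
  also have "\<dots> = emeasure (density M f) A"
    using assms(3) by (simp add: emeasure_density)
  finally show "emeasure (distr (density M f) M R) A = emeasure (density M f) A" .
qed simp

text \<open>The density depends on the norm alone. For \<beta> = -1 the argument is applied one
  level down, to the uniform law on the ball, because \<open>sgn\<close> commutes with linear
  isometries.\<close>

lemma distr_beta_distribution_orthogonal:
  fixes R :: "real ^ 'n::{finite,wellorder} \<Rightarrow> real ^ 'n::_"
  assumes R: "orthogonal_transformation R"
  shows "distr (beta_distribution \<beta>) borel R = beta_distribution \<beta>"
proof -
  have lin: "linear R" using R by (rule orthogonal_transformation_linear)
  have [measurable]: "R \<in> borel_measurable borel"
    using lin by (simp add: linear_conv_bounded_linear borel_measurable_continuous_onI linear_continuous_on)
  have dd: "distr (density lborel f) borel R = density lborel f"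
    if [measurable]: "f \<in> borel_measurable borel" and inv: "\<And>x. f (R x) = f x" for f :: "real ^ 'n::_ \<Rightarrow> ennreal"
  proof -
    have "distr lborel lborel R = lborel"
      using distr_lborel_orthogonal[OF R] by (subst distr_cong[OF refl sets_lborel refl]) simp
    then have "distr (density lborel f) lborel R = density lborel f"
      by (intro distr_density_invariant) (simp_all add: inv)
    then show ?thesis
      by (subst distr_cong[OF refl sets_lborel[symmetric] refl])
  qed
  show ?thesis
  proof (cases "\<beta> = -1")
    case True
    have U: "distr (uniform_measure lborel (ball 0 1)) borel R = uniform_measure lborel (ball 0 1)"
      unfolding uniform_measure_def
      by (rule dd) (simp_all add: indicator_def orthogonal_transformation_norm[OF R])
    have sgn: "R (sgn x) = sgn (R x)" for x
      by (simp add: sgn_div_norm orthogonal_transformation_norm[OF R] linear_cmul[OF lin])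
    have "distr (sphere_uniform :: (real ^ 'n::_) measure) borel R = distr (uniform_measure lborel (ball 0 1)) borel (\<lambda>x. sgn (R x))"
      unfolding sphere_uniform_def by (subst distr_distr) (simp_all add: comp_def sgn)
    also have "\<dots> = distr (distr (uniform_measure lborel (ball 0 1)) borel R) borel sgn"
      by (subst distr_distr) (simp_all add: comp_def)
    also have "\<dots> = sphere_uniform"
      unfolding U sphere_uniform_def ..
    finally show ?thesis by (simp add: beta_distribution_def True)
  next
    case False
    have "distr (density lborel (\<lambda>x. ennreal (beta_density \<beta> x))) borel R = density lborel (\<lambda>x. ennreal (beta_density \<beta> x))"
      by (rule dd) (simp_all add: beta_density_def [abs_def] indicator_def orthogonal_transformation_norm[OF R])
    then show ?thesis by (simp add: beta_distribution_def False)
  qed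
qed

section \<open>Splitting off the fourth coordinate\<close>

definition vec4 :: "(real \<times> real) \<times> real \<Rightarrow> real \<Rightarrow> real ^ 4" where
  "vec4 p w = vector [fst (fst p), snd (fst p), snd p, w]"

definition proj3 :: "real ^ 4 \<Rightarrow> (real \<times> real) \<times> real" where
  "proj3 x = ((x $ 1, x $ 2), x $ 3)"

lemma vec4_nth [simp]:
  "vec4 p w $ 1 = fst (fst p)" "vec4 p w $ 2 = snd (fst p)" "vec4 p w $ 3 = snd p" "vec4 p w $ 4 = w"
  by (simp_all add: vec4_def vector_def)

lemma norm_vec4: "(norm (vec4 p w))\<^sup>2 = (norm p)\<^sup>2 + w\<^sup>2"
proof -
  obtain a b c where "p = ((a, b), c)" by (metis prod.exhaust)
  then show ?thesis by (simp add: norm_vec_def L2_set_def sum_4 norm_Pair add_nonneg_nonneg)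
qed

lemma measurable_nth [measurable (raw)]:
  assumes "f \<in> borel_measurable M"
  shows "(\<lambda>x. (f x :: real ^ 'n) $ i) \<in> borel_measurable M"
proof -
  have "(\<lambda>x::real ^ 'n. x $ i) \<in> borel_measurable borel"
    by (intro borel_measurable_continuous_onI continuous_intros)
  from measurable_compose[OF assms this] show ?thesis .
qed

lemma measurable_proj3 [measurable]: "proj3 \<in> borel_measurable borel"
  unfolding proj3_def [abs_def] by measurable

lemma measurable_vec4 [measurable (raw)]:
  assumes [measurable]: "f \<in> borel_measurable M" "g \<in> borel_measurable M"
  shows "(\<lambda>x. vec4 (f x) (g x)) \<in> borel_measurable M"
proof (rule borel_measurable_euclidean_space[THEN iffD2], rule ballI)
  fix i :: "real ^ 4" assume "i \<in> Basis"
  then obtain k where k: "i = axis k 1" by (auto simp: Basis_vec_def)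
  have "k \<in> {1, 2, 3, 4}" using UNIV_4 by auto
  then show "(\<lambda>x. vec4 (f x) (g x) \<bullet> i) \<in> borel_measurable M"
    by (auto simp: k inner_axis)
qed

lemma distr_lborel_vec4: "distr lborel borel (\<lambda>x. vec4 (fst x) (snd x)) = lborel"
proof (rule lborel_eqI[symmetric])
  fix l u :: "real ^ 4"
  assume le: "\<And>b. b \<in> Basis \<Longrightarrow> l \<bullet> b \<le> u \<bullet> b"
  have le': "l $ i \<le> u $ i" for i
    using le[of "axis i 1"] by (simp add: inner_axis)
  have vim: "(\<lambda>x. vec4 (fst x) (snd x)) -` box l u
      = (({l $ 1<..<u $ 1} \<times> {l $ 2<..<u $ 2}) \<times> {l $ 3<..<u $ 3}) \<times> {l $ 4<..<u $ 4}"
    by (auto simp: mem_box_cart forall_4)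
  have e: "emeasure lborel (A \<times> B) = emeasure lborel A * emeasure lborel B"
    if "A \<in> sets borel" "B \<in> sets borel" for A :: "'a::euclidean_space set" and B :: "'b::euclidean_space set"
    using lborel.emeasure_pair_measure_Times[of A lborel B] that by (simp add: lborel_prod)
  have "emeasure (distr lborel borel (\<lambda>x. vec4 (fst x) (snd x))) (box l u)
    = emeasure lborel ((({l $ 1<..<u $ 1} \<times> {l $ 2<..<u $ 2}) \<times> {l $ 3<..<u $ 3}) \<times> {l $ 4<..<u $ 4})"
    by (simp add: emeasure_distr vim)
  also have "\<dots> = ennreal (u $ 1 - l $ 1) * ennreal (u $ 2 - l $ 2) * ennreal (u $ 3 - l $ 3) * ennreal (u $ 4 - l $ 4)"
    using le' by (simp add: e borel_Times)
  also have "\<dots> = ennreal (\<Prod>i\<in>UNIV. (u - l) $ i)"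
  proof -
    have p4: "(\<Prod>i\<in>UNIV. (u - l) $ i) = (u $ 1 - l $ 1) * (u $ 2 - l $ 2) * (u $ 3 - l $ 3) * (u $ 4 - l $ 4)"
      unfolding UNIV_4 by simp
    show ?thesis
      unfolding p4 using le'[of 1] le'[of 2] le'[of 3] le'[of 4] by (simp add: ennreal_mult)
  qed
  also have "(\<Prod>i\<in>UNIV. (u - l) $ i) = (\<Prod>b\<in>Basis. (u - l) \<bullet> b)"
  proof -
    have B: "(Basis :: (real ^ 4) set) = range (\<lambda>i. axis i 1)"
      by (auto simp: Basis_vec_def)
    have "inj (\<lambda>i::4. axis i (1::real))"
      by (auto simp: inj_def axis_eq_axis)
    then show ?thesis
      unfolding B by (subst prod.reindex) (simp_all add: inner_axis)
  qed
  finally show "emeasure (distr lborel borel (\<lambda>x. vec4 (fst x) (snd x))) (box l u) = (\<Prod>b\<in>Basis. (u - l) \<bullet> b)" .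
qed simp

lemma nn_integral_vec4:
  assumes [measurable]: "f \<in> borel_measurable borel"
  shows "(\<integral>\<^sup>+x. f x \<partial>lborel) = (\<integral>\<^sup>+p. \<integral>\<^sup>+w. f (vec4 p w) \<partial>lborel \<partial>lborel)"
proof -
  have "(\<integral>\<^sup>+x. f x \<partial>lborel) = (\<integral>\<^sup>+x. f x \<partial>distr lborel borel (\<lambda>x. vec4 (fst x) (snd x)))"
    by (simp add: distr_lborel_vec4)
  also have "\<dots> = (\<integral>\<^sup>+x. f (vec4 (fst x) (snd x)) \<partial>lborel)"
    by (subst nn_integral_distr) simp_all
  also have "\<dots> = (\<integral>\<^sup>+p. \<integral>\<^sup>+w. f (vec4 p w) \<partial>lborel \<partial>lborel)"
    by (subst nn_integral_lborel_pair) simp_all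
  finally show ?thesis .
qed

lemma ball_weight_norm: "ball_weight \<kappa> p = pospow \<kappa> (1 - (norm p)\<^sup>2)"
proof -
  obtain a b c where "p = ((a, b), c)" by (metis prod.exhaust)
  then show ?thesis by (simp add: ball_weight_def norm_Pair add_nonneg_nonneg diff_diff_eq)
qed

lemma proj3_vec4 [simp]: "proj3 (vec4 p w) = p"
  by (simp add: proj3_def)

text \<open>The chord of the ball above a point \<open>p\<close> with \<open>1 - |p|^2 = m\<close>
  has half-length \<open>sqrt m\<close>; scaling it to \<open>[-1, 1]\<close> contributes the extra
  power \<open>1 / 2\<close> of \<open>m\<close>.\<close>

lemma nn_integral_pospow_chord:
  "(\<integral>\<^sup>+w. pospow \<kappa> (m - w\<^sup>2) \<partial>lborel) = pospow (\<kappa> + 1 / 2) m * (\<integral>\<^sup>+t. pospow \<kappa> (1 - t\<^sup>2) \<partial>lborel)"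
proof (cases "m > 0")
  case True
  have "(\<integral>\<^sup>+w. pospow \<kappa> (m - w\<^sup>2) \<partial>lborel) = ennreal \<bar>sqrt m\<bar> * (\<integral>\<^sup>+t. pospow \<kappa> (m - (0 + sqrt m * t)\<^sup>2) \<partial>lborel)"
    by (rule nn_integral_real_affine) (use True in simp_all)
  also have "pospow \<kappa> (m - (0 + sqrt m * t)\<^sup>2) = pospow \<kappa> m * pospow \<kappa> (1 - t\<^sup>2)" for t
    using True by (simp add: pospow_mult[symmetric] power_mult_distrib algebra_simps)
  then have "(\<lambda>t. pospow \<kappa> (m - (0 + sqrt m * t)\<^sup>2)) = (\<lambda>t. pospow \<kappa> m * pospow \<kappa> (1 - t\<^sup>2))"
    by blast
  also have "ennreal \<bar>sqrt m\<bar> = pospow (1 / 2) m"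
    using True by (simp add: pospow_def powr_half_sqrt)
  also have "pospow (1 / 2) m * (\<integral>\<^sup>+t. pospow \<kappa> m * pospow \<kappa> (1 - t\<^sup>2) \<partial>lborel)
    = (pospow \<kappa> m * pospow (1 / 2) m) * (\<integral>\<^sup>+t. pospow \<kappa> (1 - t\<^sup>2) \<partial>lborel)"
    by (simp add: nn_integral_cmult mult_ac)
  finally show ?thesis unfolding pospow_add .
next
  case False
  then have "pospow \<kappa> (m - w\<^sup>2) = 0" for w
    by (simp add: pospow_def) (smt (verit) zero_le_power2)
  with False show ?thesis by (simp add: pospow_def)
qed

text \<open>Integrating out the fourth coordinate over the chord above \<open>p\<close> raises the
  exponent by \<open>1 / 2\<close>. Only the existence of the constant is recorded, since total mass
  determines its effect later.\<close>

lemma distr_density_proj3: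
  assumes \<beta>: "\<beta> > -1"
  shows "\<exists>k. distr (density lborel (\<lambda>x :: real ^ 4. ennreal (beta_density \<beta> x))) borel proj3
    = density lborel (\<lambda>p. k * ball_weight (\<beta> + 1 / 2) p)"
proof (intro exI measure_eqI)
  define c where "c = Gamma (real DIM(real ^ 4) / 2 + \<beta> + 1) / (pi powr (real DIM(real ^ 4) / 2) * Gamma (\<beta> + 1))"
  have c: "c \<ge> 0" unfolding c_def using \<beta> by (auto intro!: divide_nonneg_nonneg mult_nonneg_nonneg Gamma_real_nonneg)
  have [measurable]: "(\<lambda>x :: real ^ 4. ennreal (beta_density \<beta> x)) \<in> borel_measurable borel"
    by (simp add: beta_density_def [abs_def])
  have d: "ennreal (beta_density \<beta> (vec4 p w)) = ennreal c * pospow \<beta> ((1 - (norm p)\<^sup>2) - w\<^sup>2)" for p w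
  proof -
    have "norm (vec4 p w) < 1 \<longleftrightarrow> 1 - (norm (vec4 p w))\<^sup>2 > 0"
      by (simp add: abs_square_less_1)
    then have "ennreal (beta_density \<beta> (vec4 p w)) = ennreal c * pospow \<beta> (1 - (norm (vec4 p w))\<^sup>2)"
      unfolding beta_density_def c_def[symmetric] pospow_def using c
      by (auto simp: ennreal_mult)
    then show ?thesis by (simp add: norm_vec4 algebra_simps)
  qed
  let ?k = "ennreal c * (\<integral>\<^sup>+t. pospow \<beta> (1 - t\<^sup>2) \<partial>lborel)"
  fix A assume "A \<in> sets (distr (density lborel (\<lambda>x :: real ^ 4. ennreal (beta_density \<beta> x))) borel proj3)"
  then have [measurable]: "A \<in> sets borel" by simp
  have P: "proj3 -` A \<in> sets borel"
    using measurable_sets[OF measurable_proj3, of A] by simp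
  have "emeasure (distr (density lborel (\<lambda>x :: real ^ 4. ennreal (beta_density \<beta> x))) borel proj3) A
     = (\<integral>\<^sup>+x. ennreal (beta_density \<beta> x) * indicator (proj3 -` A) x \<partial>lborel)"
    using P by (subst emeasure_distr) (simp_all add: emeasure_density)
  also have "\<dots> = (\<integral>\<^sup>+x. ennreal (beta_density \<beta> x) * indicator A (proj3 x) \<partial>lborel)"
    by (intro nn_integral_cong) (auto simp: indicator_def)
  also have "\<dots> = (\<integral>\<^sup>+p. \<integral>\<^sup>+w. ennreal c * indicator A p * pospow \<beta> ((1 - (norm p)\<^sup>2) - w\<^sup>2) \<partial>lborel \<partial>lborel)"
    by (subst nn_integral_vec4) (simp_all add: d mult_ac)
  also have "\<dots> = (\<integral>\<^sup>+p. ?k * ball_weight (\<beta> + 1 / 2) p * indicator A p \<partial>lborel)"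
  proof (rule nn_integral_cong)
    fix p :: "(real \<times> real) \<times> real"
    have "(\<integral>\<^sup>+w. ennreal c * indicator A p * pospow \<beta> ((1 - (norm p)\<^sup>2) - w\<^sup>2) \<partial>lborel)
      = ennreal c * indicator A p * (\<integral>\<^sup>+w. pospow \<beta> ((1 - (norm p)\<^sup>2) - w\<^sup>2) \<partial>lborel)"
      by (rule nn_integral_cmult) measurable
    then show "(\<integral>\<^sup>+w. ennreal c * indicator A p * pospow \<beta> ((1 - (norm p)\<^sup>2) - w\<^sup>2) \<partial>lborel)
      = ?k * ball_weight (\<beta> + 1 / 2) p * indicator A p"
      unfolding nn_integral_pospow_chord[of \<beta> "1 - (norm p)\<^sup>2"] ball_weight_norm by (simp only: mult_ac)
  qed
  also have "\<dots> = emeasure (density lborel (\<lambda>p. ?k * ball_weight (\<beta> + 1 / 2) p)) A"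
    by (simp add: emeasure_density)
  finally show "emeasure (distr (density lborel (\<lambda>x :: real ^ 4. ennreal (beta_density \<beta> x))) borel proj3) A
    = emeasure (density lborel (\<lambda>p. ?k * ball_weight (\<beta> + 1 / 2) p)) A" .
qed simp

section \<open>Projection of the uniform distribution on the sphere\<close>

text \<open>For fixed \<open>n\<close> the norm \<open>x = sqrt (n^2 + w^2)\<close> replaces the
  height \<open>w\<close>. On \<open>w > 0\<close> the relation
  \<open>dw = x / sqrt (x^2 - n^2) dx\<close> produces the weight, in which \<open>pospow\<close>
  encodes \<open>x > n\<close>; the two signs of \<open>w\<close> give the factor
  \<open>2\<close>.\<close>

lemma nn_integral_radius:
  fixes h :: "real \<Rightarrow> real"
  assumes [measurable]: "h \<in> borel_measurable borel" and h: "\<And>x. h x \<ge> 0" "\<And>x. x \<ge> 1 \<Longrightarrow> h x = 0" and n: "n > 0"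
  shows "(\<integral>\<^sup>+w. ennreal (h (sqrt (n\<^sup>2 + w\<^sup>2))) \<partial>lborel)
    = 2 * (\<integral>\<^sup>+x. indicator {0<..} x * ennreal (h x) * ennreal x * pospow (- 1 / 2) (x\<^sup>2 - n\<^sup>2) \<partial>lborel)"
proof -
  let ?g = "\<lambda>w. sqrt (n\<^sup>2 + w\<^sup>2)"
  define f where "f x = h x * (x * (x\<^sup>2 - n\<^sup>2) powr (- 1 / 2))" for x
  have pos: "n\<^sup>2 + w\<^sup>2 > 0" for w using n by (simp add: add_pos_nonneg)
  have half: "(\<integral>\<^sup>+w. indicator {0<..} w * ennreal (h (?g w)) \<partial>lborel)
    = (\<integral>\<^sup>+x. indicator {0<..} x * ennreal (h x) * ennreal x * pospow (- 1 / 2) (x\<^sup>2 - n\<^sup>2) \<partial>lborel)"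
  proof -
    \<comment> \<open>Confines \<open>w\<close> to \<open>[0, 1]\<close>, so that the substitution
      runs over a compact interval.\<close>
    have large: "h (?g w) = 0" if "\<bar>w\<bar> \<ge> 1" for w
    proof -
      have "1 \<le> w\<^sup>2" using that by (metis abs_le_square_iff abs_one one_power2)
      then have "sqrt 1 \<le> ?g w" by (intro real_sqrt_le_mono) (simp add: add_increasing)
      then show ?thesis using h(2)[of "?g w"] by simp
    qed
    have "(\<integral>\<^sup>+x. indicator {0<..} x * ennreal (h x) * ennreal x * pospow (- 1 / 2) (x\<^sup>2 - n\<^sup>2) \<partial>lborel)
      = (\<integral>\<^sup>+x. ennreal (f x * indicator {?g 0..?g 1} x) \<partial>lborel)"
    proof (intro nn_integral_cong)
      fix x :: real
      \<comment> \<open>Only \<open>n < x < 1\<close> contributes on either side. At the singular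
        point \<open>x = n\<close> both sides are \<open>0\<close>, again because
        \<open>0 powr y = 0\<close>.\<close>
      show "indicator {0<..} x * ennreal (h x) * ennreal x * pospow (- 1 / 2) (x\<^sup>2 - n\<^sup>2)
        = ennreal (f x * indicator {?g 0..?g 1} x)"
      proof (cases "x > n \<and> x < 1")
        case True
        then have "x\<^sup>2 > n\<^sup>2" using n by (intro power_strict_mono) auto
        moreover have "x \<le> ?g 1" using True n power_le_one[of x 2] by (intro real_le_rsqrt) (simp add: add_increasing)
        ultimately show ?thesis using True n h(1)[of x]
          by (simp add: f_def pospow_def indicator_def flip: ennreal_mult)
      next
        case False
        then show ?thesis
        proof (cases "x \<ge> 1")
          case True then show ?thesis by (simp add: f_def h)
        next
          case False
          with \<open>\<not> (x > n \<and> x < 1)\<close> have "x \<le> n" by simp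
          then have "pospow (- 1 / 2) (x\<^sup>2 - n\<^sup>2) = 0" if "x > 0"
          proof -
            have "x\<^sup>2 \<le> n\<^sup>2" using that \<open>x \<le> n\<close> by (intro power_mono) auto
            then show ?thesis by (simp only: pospow_def) auto
          qed
          moreover have R: "f x * indicator {?g 0..?g 1} x = 0"
            using n \<open>x \<le> n\<close> by (cases "x = n") (auto simp: f_def indicator_def)
          ultimately show ?thesis unfolding R by (cases "x > 0") auto
        qed
      qed
    qed
    also have "\<dots> = (\<integral>\<^sup>+x. ennreal (f (?g x) * (x / ?g x) * indicator {0..1} x) \<partial>lborel)"
    proof (rule nn_integral_substitution)
      show "set_borel_measurable borel {?g 0..?g 1} f"
        unfolding set_borel_measurable_def f_def [abs_def] by measurable
      show "(?g has_real_derivative x / ?g x) (at x)" if "x \<in> {0..1}" for x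
        using pos[of x] by (auto intro!: derivative_eq_intros simp: field_simps)
      show "continuous_on {0..1} (\<lambda>x. x / ?g x)"
        using pos by (intro continuous_intros) (auto simp: less_imp_neq[symmetric])
      show "x / ?g x \<ge> 0" if "x \<in> {0..1}" for x
        using that by simp
    qed simp
    also have "\<dots> = (\<integral>\<^sup>+w. indicator {0<..} w * ennreal (h (?g w)) \<partial>lborel)"
    proof (intro nn_integral_cong)
      fix w :: real
      show "ennreal (f (?g w) * (w / ?g w) * indicator {0..1} w) = indicator {0<..} w * ennreal (h (?g w))"
      proof (cases "w > 0")
        case True
        have g: "?g w > 0" using pos[of w] by simp
        have "(?g w)\<^sup>2 - n\<^sup>2 = w\<^sup>2" using pos[of w] by simp
        then have "f (?g w) * (w / ?g w) = h (?g w) * (w * (w\<^sup>2) powr (- 1 / 2))"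
          using g by (simp add: f_def)
        also have "w * (w\<^sup>2) powr (- 1 / 2) = 1"
          using True by (simp add: powr_minus powr_half_sqrt)
        finally show ?thesis using True large[of w] by (auto simp: indicator_def)
      qed (auto simp: indicator_def)
    qed
    finally show ?thesis ..
  qed
  have "(\<integral>\<^sup>+w. ennreal (h (?g w)) \<partial>lborel)
    = (\<integral>\<^sup>+w. indicator {0<..} w * ennreal (h (?g w)) + indicator {..<0} w * ennreal (h (?g w)) \<partial>lborel)"
    by (intro nn_integral_cong_AE AE_I[of _ _ "{0}"]) (auto simp: indicator_def split: if_splits)
  also have "\<dots> = (\<integral>\<^sup>+w. indicator {0<..} w * ennreal (h (?g w)) \<partial>lborel) + (\<integral>\<^sup>+w. indicator {..<0} w * ennreal (h (?g w)) \<partial>lborel)"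
    by (rule nn_integral_add) measurable
  also have "(\<integral>\<^sup>+w. indicator {..<0} w * ennreal (h (?g w)) \<partial>lborel) = (\<integral>\<^sup>+w. indicator {0<..} w * ennreal (h (?g w)) \<partial>lborel)"
    by (subst nn_integral_real_affine[where c = "-1" and t = 0]) (auto simp: indicator_def intro!: nn_integral_cong)
  finally show ?thesis unfolding half by (simp add: mult_2)
qed

lemma measurable_sgn [measurable (raw)]:
  fixes f :: "'x \<Rightarrow> 'a::euclidean_space"
  assumes [measurable]: "f \<in> borel_measurable M"
  shows "(\<lambda>x. sgn (f x)) \<in> borel_measurable M"
  unfolding sgn_div_norm by measurable

lemma nn_integral_scale:
  fixes f :: "'a::euclidean_space \<Rightarrow> ennreal"
  assumes [measurable]: "f \<in> borel_measurable borel" and "c > 0"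
  shows "(\<integral>\<^sup>+x. f x \<partial>lborel) = ennreal (c ^ DIM('a)) * (\<integral>\<^sup>+x. f (c *\<^sub>R x) \<partial>lborel)"
  using assms
  by (subst lborel_affine[of c 0])
    (simp_all add: nn_integral_density nn_integral_distr nn_integral_cmult)

text \<open>Archimedes' hat-box theorem: the cone measure in \<open>\<real>\<^sup>4\<close> is computed in the coordinates
  \<open>(v / x, x)\<close>, where \<open>v\<close> is the projection of the point and \<open>x\<close> its norm.\<close>

lemma distr_sphere_uniform_proj3:
  "\<exists>k. distr (sphere_uniform :: (real ^ 4) measure) borel proj3 = density lborel (\<lambda>p. k * ball_weight (- 1 / 2) p)"
proof -
  let ?vol = "emeasure lborel (ball (0 :: real ^ 4) 1)"
  \<comment> \<open>The radial integral that is left once the norm has been separated from the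
    direction.\<close>
  define c where "c = (\<integral>\<^sup>+x. indicator {0<..<1} x * ennreal x * (ennreal (x ^ 3) * pospow (- 1 / 2) (x\<^sup>2)) \<partial>lborel)"
  define k where "k = 1 / ?vol * 2 * c"
  have "distr (sphere_uniform :: (real ^ 4) measure) borel proj3 = density lborel (\<lambda>p. k * ball_weight (- 1 / 2) p)"
  proof (rule measure_eqI)
    fix A assume "A \<in> sets (distr (sphere_uniform :: (real ^ 4) measure) borel proj3)"
    then have [measurable]: "A \<in> sets borel" by simp
    have [measurable]: "ball (0 :: real ^ 4) 1 \<in> sets borel" by simp
    have n_pos: "AE v in lborel. norm (v :: (real \<times> real) \<times> real) > 0"
      using AE_lborel_singleton[of "0 :: (real \<times> real) \<times> real"] by eventually_elim simp
    have *: "(\<lambda>y. ps y) -` A \<in> sets borel" if "ps \<in> borel_measurable borel" for ps :: "real ^ 4 \<Rightarrow> (real \<times> real) \<times> real"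
      using measurable_sets_borel[OF that] by simp
    have "emeasure (distr (sphere_uniform :: (real ^ 4) measure) borel proj3) A
      = emeasure (uniform_measure lborel (ball 0 1)) ((\<lambda>y. proj3 (sgn y)) -` A)"
      unfolding sphere_uniform_def by (subst distr_distr) (simp_all add: emeasure_distr comp_def)
    also have "\<dots> = (\<integral>\<^sup>+y. indicator (ball 0 1) y / ?vol * indicator A (proj3 (sgn y)) \<partial>lborel)"
      unfolding uniform_measure_def
      by (subst emeasure_density) (auto simp: indicator_def intro!: nn_integral_cong *)
    also have "\<dots> = (\<integral>\<^sup>+v. \<integral>\<^sup>+w. indicator (ball 0 1) (vec4 v w) / ?vol * indicator A (proj3 (sgn (vec4 v w))) \<partial>lborel \<partial>lborel)"
      by (rule nn_integral_vec4) measurable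
    also have "\<dots> = (\<integral>\<^sup>+v. 1 / ?vol * (\<integral>\<^sup>+w. ennreal (indicator {..<1} (sqrt ((norm v)\<^sup>2 + w\<^sup>2)) * indicator A (v /\<^sub>R sqrt ((norm v)\<^sup>2 + w\<^sup>2))) \<partial>lborel) \<partial>lborel)"
    proof (rule nn_integral_cong)
      fix v :: "(real \<times> real) \<times> real"
      have "indicator (ball 0 1) (vec4 v w) / ?vol * indicator A (proj3 (sgn (vec4 v w)))
        = 1 / ?vol * ennreal (indicator {..<1} (sqrt ((norm v)\<^sup>2 + w\<^sup>2)) * indicator A (v /\<^sub>R sqrt ((norm v)\<^sup>2 + w\<^sup>2)))" for w
      proof -
        have n: "sqrt ((norm v)\<^sup>2 + w\<^sup>2) = norm (vec4 v w)" by (simp flip: norm_vec4)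
        have "proj3 (sgn (vec4 v w)) = v /\<^sub>R norm (vec4 v w)"
          by (simp add: proj3_def sgn_div_norm scaleR_prod_def)
        then show ?thesis unfolding n by (auto simp: indicator_def divide_ennreal_def)
      qed
      then show "(\<integral>\<^sup>+w. indicator (ball 0 1) (vec4 v w) / ?vol * indicator A (proj3 (sgn (vec4 v w))) \<partial>lborel)
        = 1 / ?vol * (\<integral>\<^sup>+w. ennreal (indicator {..<1} (sqrt ((norm v)\<^sup>2 + w\<^sup>2)) * indicator A (v /\<^sub>R sqrt ((norm v)\<^sup>2 + w\<^sup>2))) \<partial>lborel)"
        by (simp add: nn_integral_cmult)
    qed
    also have "\<dots> = 1 / ?vol * (\<integral>\<^sup>+v. \<integral>\<^sup>+w. ennreal (indicator {..<1} (sqrt ((norm v)\<^sup>2 + w\<^sup>2)) * indicator A (v /\<^sub>R sqrt ((norm v)\<^sup>2 + w\<^sup>2))) \<partial>lborel \<partial>lborel)"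
      by (rule nn_integral_cmult) measurable
    \<comment> \<open>The height is traded for the norm \<open>x\<close>, which needs
      \<open>v\<close> nonzero and hence excludes one point.\<close>
    also have "(\<integral>\<^sup>+v. \<integral>\<^sup>+w. ennreal (indicator {..<1} (sqrt ((norm v)\<^sup>2 + w\<^sup>2)) * indicator A (v /\<^sub>R sqrt ((norm v)\<^sup>2 + w\<^sup>2))) \<partial>lborel \<partial>lborel)
      = (\<integral>\<^sup>+v. 2 * (\<integral>\<^sup>+x. indicator {0<..} x * ennreal (indicator {..<1} x * indicator A (v /\<^sub>R x)) * ennreal x * pospow (- 1 / 2) (x\<^sup>2 - (norm v)\<^sup>2) \<partial>lborel) \<partial>lborel)"
    proof (rule nn_integral_cong_AE, use n_pos in eventually_elim)
      case (elim v)
      then show ?case by (intro nn_integral_radius) (auto simp: indicator_def)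
    qed
    also have "\<dots> = 2 * (\<integral>\<^sup>+v. \<integral>\<^sup>+x. indicator {0<..} x * ennreal (indicator {..<1} x * indicator A (v /\<^sub>R x)) * ennreal x * pospow (- 1 / 2) (x\<^sup>2 - (norm v)\<^sup>2) \<partial>lborel \<partial>lborel)"
      by (rule nn_integral_cmult) measurable
    also have "(\<integral>\<^sup>+v. \<integral>\<^sup>+x. indicator {0<..} x * ennreal (indicator {..<1} x * indicator A (v /\<^sub>R x)) * ennreal x * pospow (- 1 / 2) (x\<^sup>2 - (norm v)\<^sup>2) \<partial>lborel \<partial>lborel)
      = (\<integral>\<^sup>+x. \<integral>\<^sup>+v. indicator {0<..} x * ennreal (indicator {..<1} x * indicator A (v /\<^sub>R x)) * ennreal x * pospow (- 1 / 2) (x\<^sup>2 - (norm v)\<^sup>2) \<partial>lborel \<partial>lborel)"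
      by (rule lborel_pair.Fubini') measurable
    \<comment> \<open>Scaling \<open>v = x p\<close> frees \<open>A\<close> from \<open>x\<close>:
      it contributes \<open>x ^ 3\<close> in three dimensions, and
      \<open>x^2 - |v|^2 = x^2 (1 - |p|^2)\<close> splits off the ball weight with exponent
      \<open>-1/2\<close>.\<close>
    also have "\<dots> = (\<integral>\<^sup>+x. indicator {0<..<1} x * ennreal x * (ennreal (x ^ 3) * pospow (- 1 / 2) (x\<^sup>2)) * (\<integral>\<^sup>+p. ball_weight (- 1 / 2) p * indicator A p \<partial>lborel) \<partial>lborel)"
    proof (rule nn_integral_cong)
      fix x :: real
      show "(\<integral>\<^sup>+v. indicator {0<..} x * ennreal (indicator {..<1} x * indicator A (v /\<^sub>R x)) * ennreal x * pospow (- 1 / 2) (x\<^sup>2 - (norm v)\<^sup>2) \<partial>lborel)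
        = indicator {0<..<1} x * ennreal x * (ennreal (x ^ 3) * pospow (- 1 / 2) (x\<^sup>2)) * (\<integral>\<^sup>+p. ball_weight (- 1 / 2) p * indicator A p \<partial>lborel)"
      proof (cases "0 < x \<and> x < 1")
        case True
        have "(\<integral>\<^sup>+v. indicator {0<..} x * ennreal (indicator {..<1} x * indicator A (v /\<^sub>R x)) * ennreal x * pospow (- 1 / 2) (x\<^sup>2 - (norm v)\<^sup>2) \<partial>lborel)
          = (\<integral>\<^sup>+v. ennreal x * (indicator A (v /\<^sub>R x) * pospow (- 1 / 2) (x\<^sup>2 - (norm v)\<^sup>2)) \<partial>lborel)"
          using True by (simp add: mult_ac ennreal_indicator)
        also have "\<dots> = ennreal x * (\<integral>\<^sup>+v. indicator A (v /\<^sub>R x) * pospow (- 1 / 2) (x\<^sup>2 - (norm v)\<^sup>2) \<partial>lborel)"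
          by (rule nn_integral_cmult) measurable
        also have "(\<integral>\<^sup>+v. indicator A (v /\<^sub>R x) * pospow (- 1 / 2) (x\<^sup>2 - (norm v)\<^sup>2) \<partial>lborel)
          = ennreal (x ^ 3) * (\<integral>\<^sup>+v. indicator A ((x *\<^sub>R v) /\<^sub>R x) * pospow (- 1 / 2) (x\<^sup>2 - (norm (x *\<^sub>R v))\<^sup>2) \<partial>lborel)"
          using True by (subst nn_integral_scale[where c = x]) (simp_all add: power3_eq_cube mult.assoc)
        also have "(\<integral>\<^sup>+v. indicator A ((x *\<^sub>R v) /\<^sub>R x) * pospow (- 1 / 2) (x\<^sup>2 - (norm (x *\<^sub>R v))\<^sup>2) \<partial>lborel)
          = (\<integral>\<^sup>+v. pospow (- 1 / 2) (x\<^sup>2) * (ball_weight (- 1 / 2) v * indicator A v) \<partial>lborel)"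
        proof (rule nn_integral_cong)
          fix v :: "(real \<times> real) \<times> real"
          have "x\<^sup>2 - (norm (x *\<^sub>R v))\<^sup>2 = x\<^sup>2 * (1 - (norm v)\<^sup>2)"
            by (simp add: power_mult_distrib algebra_simps)
          then show "indicator A ((x *\<^sub>R v) /\<^sub>R x) * pospow (- 1 / 2) (x\<^sup>2 - (norm (x *\<^sub>R v))\<^sup>2) = pospow (- 1 / 2) (x\<^sup>2) * (ball_weight (- 1 / 2) v * indicator A v)"
            using True by (simp add: pospow_mult ball_weight_norm mult_ac)
        qed
        also have "\<dots> = pospow (- 1 / 2) (x\<^sup>2) * (\<integral>\<^sup>+v. ball_weight (- 1 / 2) v * indicator A v \<partial>lborel)"
          by (rule nn_integral_cmult) measurable
        finally show ?thesis using True by (simp add: mult_ac)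
      qed (auto simp: indicator_def)
    qed
    also have "\<dots> = c * (\<integral>\<^sup>+p. ball_weight (- 1 / 2) p * indicator A p \<partial>lborel)"
      unfolding c_def by (rule nn_integral_multc) measurable
    also have "1 / ?vol * (2 * (c * (\<integral>\<^sup>+p. ball_weight (- 1 / 2) p * indicator A p \<partial>lborel)))
      = k * (\<integral>\<^sup>+p. ball_weight (- 1 / 2) p * indicator A p \<partial>lborel)"
      unfolding k_def by (simp only: mult.assoc)
    also have "\<dots> = (\<integral>\<^sup>+p. k * (ball_weight (- 1 / 2) p * indicator A p) \<partial>lborel)"
      by (rule nn_integral_cmult[symmetric]) measurable
    also have "\<dots> = emeasure (density lborel (\<lambda>p. k * ball_weight (- 1 / 2) p)) A"
      by (simp add: emeasure_density mult.assoc)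
    finally show "emeasure (distr (sphere_uniform :: (real ^ 4) measure) borel proj3) A
      = emeasure (density lborel (\<lambda>p. k * ball_weight (- 1 / 2) p)) A" .
  qed simp
  then show ?thesis by blast
qed

lemma distr_beta_distribution_proj3:
  assumes "\<beta> \<ge> -1"
  shows "\<exists>k. distr (beta_distribution \<beta> :: (real ^ 4) measure) borel proj3 = density lborel (\<lambda>p. k * ball_weight (\<beta> + 1 / 2) p)"
proof (cases "\<beta> = -1")
  case True
  then show ?thesis using distr_sphere_uniform_proj3 by (simp add: beta_distribution_def)
next
  case False
  then show ?thesis using distr_density_proj3[of \<beta>] assms by (simp add: beta_distribution_def)
qed

section \<open>Solid angles of a simplex in four dimensions\<close>

definition in_cone :: "'a::real_vector \<Rightarrow> 'a \<Rightarrow> 'a \<Rightarrow> 'a \<Rightarrow> 'a \<Rightarrow> 'a \<Rightarrow> bool" where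
  "in_cone a b c d e u \<longleftrightarrow> (\<exists>r\<ge>0. \<exists>s\<ge>0. \<exists>t\<ge>0. \<exists>q\<ge>0.
     u = r *\<^sub>R (b - a) + s *\<^sub>R (c - a) + t *\<^sub>R (d - a) + q *\<^sub>R (e - a))"

text \<open>A conic combination of edge vectors becomes a convex one after scaling down, the slack
  going to \<open>a\<close>; conversely the cone translated to \<open>a\<close> is convex and
  contains the five points. They may be in any position, which covers degenerate samples.\<close>

lemma in_cone_convex_hull:
  "(\<exists>\<epsilon>>0. a + \<epsilon> *\<^sub>R u \<in> convex hull {a, b, c, d, e}) \<longleftrightarrow> in_cone a b c d e u"
proof
  assume "\<exists>\<epsilon>>0. a + \<epsilon> *\<^sub>R u \<in> convex hull {a, b, c, d, e}"
  then obtain \<epsilon> where \<epsilon>: "\<epsilon> > 0" "a + \<epsilon> *\<^sub>R u \<in> convex hull {a, b, c, d, e}" by blast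
  have "convex hull {a, b, c, d, e} \<subseteq> {x. in_cone a b c d e (x - a)}"
  proof (rule hull_minimal)
    have "in_cone a b c d e (a - a)"
      unfolding in_cone_def by (rule exI[of _ 0], simp)+
    moreover have "in_cone a b c d e (b - a)"
      unfolding in_cone_def by (rule exI[of _ 1], simp, (rule exI[of _ 0], simp)+)
    moreover have "in_cone a b c d e (c - a)"
      unfolding in_cone_def by (rule exI[of _ 0], simp, rule exI[of _ 1], simp, (rule exI[of _ 0], simp)+)
    moreover have "in_cone a b c d e (d - a)"
      unfolding in_cone_def by (rule exI[of _ 0], simp, rule exI[of _ 0], simp, rule exI[of _ 1], simp, rule exI[of _ 0], simp)
    moreover have "in_cone a b c d e (e - a)"
      unfolding in_cone_def by (rule exI[of _ 0], simp, rule exI[of _ 0], simp, rule exI[of _ 0], simp, rule exI[of _ 1], simp)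
    ultimately show "{a, b, c, d, e} \<subseteq> {x. in_cone a b c d e (x - a)}" by blast
    show "convex {x. in_cone a b c d e (x - a)}"
    proof (rule convexI)
      fix x y :: 'a and l \<mu> :: real
      assume "x \<in> {x. in_cone a b c d e (x - a)}" "y \<in> {x. in_cone a b c d e (x - a)}"
        and lm: "0 \<le> l" "0 \<le> \<mu>" "l + \<mu> = 1"
      then obtain r s t q r' s' t' q' where
        x: "r \<ge> 0" "s \<ge> 0" "t \<ge> 0" "q \<ge> 0" "x - a = r *\<^sub>R (b - a) + s *\<^sub>R (c - a) + t *\<^sub>R (d - a) + q *\<^sub>R (e - a)"
        and y: "r' \<ge> 0" "s' \<ge> 0" "t' \<ge> 0" "q' \<ge> 0" "y - a = r' *\<^sub>R (b - a) + s' *\<^sub>R (c - a) + t' *\<^sub>R (d - a) + q' *\<^sub>R (e - a)"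
        unfolding in_cone_def by blast
      have "l *\<^sub>R x + \<mu> *\<^sub>R y - a = l *\<^sub>R (x - a) + \<mu> *\<^sub>R (y - a) + (l + \<mu> - 1) *\<^sub>R a"
        by (simp add: algebra_simps)
      also have "\<dots> = (l * r + \<mu> * r') *\<^sub>R (b - a) + (l * s + \<mu> * s') *\<^sub>R (c - a)
          + (l * t + \<mu> * t') *\<^sub>R (d - a) + (l * q + \<mu> * q') *\<^sub>R (e - a)"
        unfolding x(5) y(5) lm(3) by (simp add: algebra_simps)
      finally have "in_cone a b c d e (l *\<^sub>R x + \<mu> *\<^sub>R y - a)"
        unfolding in_cone_def using lm x y
        by (intro exI[of _ "l * r + \<mu> * r'"] exI[of _ "l * s + \<mu> * s'"] exI[of _ "l * t + \<mu> * t'"] exI[of _ "l * q + \<mu> * q'"]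
          conjI add_nonneg_nonneg mult_nonneg_nonneg)
      then show "l *\<^sub>R x + \<mu> *\<^sub>R y \<in> {x. in_cone a b c d e (x - a)}" by simp
    qed
  qed
  with \<epsilon>(2) have "in_cone a b c d e (\<epsilon> *\<^sub>R u)" by auto
  then obtain r s t q where x: "r \<ge> 0" "s \<ge> 0" "t \<ge> 0" "q \<ge> 0"
    "\<epsilon> *\<^sub>R u = r *\<^sub>R (b - a) + s *\<^sub>R (c - a) + t *\<^sub>R (d - a) + q *\<^sub>R (e - a)"
    unfolding in_cone_def by blast
  have "u = (1 / \<epsilon>) *\<^sub>R (\<epsilon> *\<^sub>R u)" using \<epsilon> by simp
  also have "\<dots> = (r / \<epsilon>) *\<^sub>R (b - a) + (s / \<epsilon>) *\<^sub>R (c - a) + (t / \<epsilon>) *\<^sub>R (d - a) + (q / \<epsilon>) *\<^sub>R (e - a)"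
    unfolding x(5) by (simp only: scaleR_add_right scaleR_scaleR) simp
  finally show "in_cone a b c d e u"
    unfolding in_cone_def using x \<epsilon>
    by (intro exI[of _ "r / \<epsilon>"] exI[of _ "s / \<epsilon>"] exI[of _ "t / \<epsilon>"] exI[of _ "q / \<epsilon>"] conjI) simp_all
next
  assume "in_cone a b c d e u"
  then obtain r s t q where x: "r \<ge> 0" "s \<ge> 0" "t \<ge> 0" "q \<ge> 0"
    "u = r *\<^sub>R (b - a) + s *\<^sub>R (c - a) + t *\<^sub>R (d - a) + q *\<^sub>R (e - a)"
    unfolding in_cone_def by blast
  \<comment> \<open>Chosen so that the convex weights, \<open>\<epsilon>\<close> for
    \<open>a\<close> and \<open>\<epsilon>\<close> times the coefficients for the others, sum to
    one.\<close>
  define \<epsilon> where "\<epsilon> = 1 / (1 + r + s + t + q)"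
  have \<epsilon>: "\<epsilon> > 0" using x by (simp add: \<epsilon>_def add_pos_nonneg)
  have le: "\<epsilon> * r + \<epsilon> * s + \<epsilon> * t + \<epsilon> * q = 1 - \<epsilon>"
  proof -
    have "1 + r + s + t + q > 0" using x by linarith
    then have "\<epsilon> * (1 + r + s + t + q) = 1" by (simp add: \<epsilon>_def)
    then show ?thesis by (simp add: distrib_left)
  qed
  define w where "w = [\<epsilon>, \<epsilon> * r, \<epsilon> * s, \<epsilon> * t, \<epsilon> * q]"
  define p where "p = [a, b, c, d, e]"
  have "(\<Sum>i<5. w ! i *\<^sub>R p ! i) \<in> convex hull {a, b, c, d, e}"
  proof (rule convex_sum)
    show "sum ((!) w) {..<5} = 1"
      using le by (simp add: w_def eval_nat_numeral)
    show "0 \<le> w ! i" if "i \<in> {..<5}" for i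
      using that x \<epsilon> by (auto simp: w_def eval_nat_numeral less_Suc_eq)
    show "p ! i \<in> convex hull {a, b, c, d, e}" if "i \<in> {..<5}" for i
      using that by (intro hull_inc) (auto simp: p_def eval_nat_numeral less_Suc_eq)
  qed simp_all
  also have "(\<Sum>i<5. w ! i *\<^sub>R p ! i) = \<epsilon> *\<^sub>R a + (\<epsilon> * r) *\<^sub>R b + (\<epsilon> * s) *\<^sub>R c + (\<epsilon> * t) *\<^sub>R d + (\<epsilon> * q) *\<^sub>R e"
    by (simp add: w_def p_def eval_nat_numeral)
  also have "\<dots> = a + \<epsilon> *\<^sub>R u"
  proof -
    have "a + \<epsilon> *\<^sub>R u = (1 - (\<epsilon> * r + \<epsilon> * s + \<epsilon> * t + \<epsilon> * q)) *\<^sub>R a + (\<epsilon> * r) *\<^sub>R b + (\<epsilon> * s) *\<^sub>R c + (\<epsilon> * t) *\<^sub>R d + (\<epsilon> * q) *\<^sub>R e"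
      unfolding x(5) by (simp add: algebra_simps)
    then show ?thesis unfolding le by simp
  qed
  finally show "\<exists>\<epsilon>>0. a + \<epsilon> *\<^sub>R u \<in> convex hull {a, b, c, d, e}"
    using \<epsilon> by blast
qed

text \<open>The existential over coefficients is a projection, which need not preserve Borel sets.
  With coefficients in \<open>[0, n]\<close> it projects a closed set along a compact factor, so the
  result is closed; the full set is the countable union over \<open>n\<close>.\<close>

lemma borel_in_cone:
  "{(a, b, c, d, e, u). in_cone a b c d e (u :: 'a::euclidean_space)} \<in> sets borel"
proof -
  define T :: "((real \<times> real \<times> real \<times> real) \<times> ('a \<times> 'a \<times> 'a \<times> 'a \<times> 'a \<times> 'a)) set" where
    "T = {z. snd (snd (snd (snd (snd (snd z))))) =
       fst (fst z) *\<^sub>R (fst (snd (snd z)) - fst (snd z)) + fst (snd (fst z)) *\<^sub>R (fst (snd (snd (snd z))) - fst (snd z))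
      + fst (snd (snd (fst z))) *\<^sub>R (fst (snd (snd (snd (snd z)))) - fst (snd z))
      + snd (snd (snd (fst z))) *\<^sub>R (fst (snd (snd (snd (snd (snd z))))) - fst (snd z))}"
  define K :: "nat \<Rightarrow> (real \<times> real \<times> real \<times> real) set" where
    "K n = {0..real n} \<times> {0..real n} \<times> {0..real n} \<times> {0..real n}" for n
  have "closed T" unfolding T_def by (intro closed_Collect_eq continuous_intros)
  moreover have "compact (K n)" for n unfolding K_def by (intro compact_Times compact_Icc)
  ultimately have "{z. \<exists>x. x \<in> K n \<and> (x, z) \<in> T} \<in> sets borel" for n
    by (intro borel_closed closed_compact_projection)
  then have "(\<Union>n. {z. \<exists>x. x \<in> K n \<and> (x, z) \<in> T}) \<in> sets borel" by blast
  also have "(\<Union>n. {z. \<exists>x. x \<in> K n \<and> (x, z) \<in> T}) = {(a, b, c, d, e, u). in_cone a b c d e u}"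
  proof (intro set_eqI iffI)
    fix z :: "'a \<times> 'a \<times> 'a \<times> 'a \<times> 'a \<times> 'a"
    assume "z \<in> {(a, b, c, d, e, u). in_cone a b c d e u}"
    then obtain a b c d e u r s t q where z: "z = (a, b, c, d, e, u)" "r \<ge> 0" "s \<ge> 0" "t \<ge> 0" "q \<ge> 0"
      "u = r *\<^sub>R (b - a) + s *\<^sub>R (c - a) + t *\<^sub>R (d - a) + q *\<^sub>R (e - a)"
      unfolding in_cone_def by blast
    obtain n where "real n \<ge> r + s + t + q" using real_arch_simple by blast
    then have "(r, s, t, q) \<in> K n" using z by (auto simp: K_def)
    moreover have "((r, s, t, q), z) \<in> T" using z by (simp add: T_def)
    ultimately show "z \<in> (\<Union>n. {z. \<exists>x. x \<in> K n \<and> (x, z) \<in> T})" by blast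
  next
    fix z :: "'a \<times> 'a \<times> 'a \<times> 'a \<times> 'a \<times> 'a"
    assume "z \<in> (\<Union>n. {z. \<exists>x. x \<in> K n \<and> (x, z) \<in> T})"
    then obtain n r s t q where rst: "(r, s, t, q) \<in> K n" "((r, s, t, q), z) \<in> T" by auto
    obtain a b c d e u where z: "z = (a, b, c, d, e, u)" by (metis prod.exhaust)
    have "r \<ge> 0" "s \<ge> 0" "t \<ge> 0" "q \<ge> 0" using rst(1) by (auto simp: K_def)
    moreover have "u = r *\<^sub>R (b - a) + s *\<^sub>R (c - a) + t *\<^sub>R (d - a) + q *\<^sub>R (e - a)"
      using rst(2) by (simp add: T_def z)
    ultimately show "z \<in> {(a, b, c, d, e, u). in_cone a b c d e u}"
      unfolding z in_cone_def by blast
  qed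
  finally show ?thesis .
qed

lemma measurable_in_cone [measurable (raw)]:
  fixes a b c d e u :: "'x \<Rightarrow> 'a::euclidean_space"
  assumes [measurable]: "a \<in> borel_measurable M" "b \<in> borel_measurable M" "c \<in> borel_measurable M"
    "d \<in> borel_measurable M" "e \<in> borel_measurable M" "u \<in> borel_measurable M"
  shows "Measurable.pred M (\<lambda>x. in_cone (a x) (b x) (c x) (d x) (e x) (u x))"
proof -
  have "(\<lambda>x. (a x, b x, c x, d x, e x, u x)) \<in> borel_measurable M" by measurable
  from measurable_sets[OF this borel_in_cone] show ?thesis
    by (simp add: pred_def vimage_def Int_def conj_commute)
qed

section \<open>Null hyperplanes and degenerate simplices\<close>

lemma beta_distribution_minus_1: "beta_distribution (-1) = sphere_uniform"
  by (simp add: beta_distribution_def)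

text \<open>The law is singular for \<beta> = -1, so Lebesgue null sets of R^4 do not suffice.
  Rotating the normal to the first axis makes the hyperplane the preimage of a plane under
  \<open>proj3\<close>, and the projected law has a density in all cases.\<close>

lemma AE_beta_distribution_hyperplane:
  fixes n :: "real ^ 4"
  assumes "\<beta> \<ge> -1" "n \<noteq> 0"
  shows "AE x in beta_distribution \<beta>. n \<bullet> x \<noteq> b"
proof -
  let ?\<mu> = "beta_distribution \<beta> :: (real ^ 4) measure"
  have sets_\<mu>: "sets ?\<mu> = sets borel"
    by (simp add: beta_distribution_def sphere_uniform_def)
  obtain k where k: "distr ?\<mu> borel proj3 = density lborel (\<lambda>p. k * ball_weight (\<beta> + 1 / 2) p)"
    using distr_beta_distribution_proj3[OF assms(1)] by blast
  have "\<exists>R :: real ^ 4 \<Rightarrow> real ^ 4. orthogonal_transformation R \<and> R (norm n *\<^sub>R axis 1 1) = n"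
  proof (rule rotation_rightward_line[of n 1])
    fix f :: "real ^ 4 \<Rightarrow> real ^ 4" assume "orthogonal_transformation f" "f (norm n *\<^sub>R axis 1 1) = n"
    then show ?thesis by blast
  qed
  then obtain R :: "real ^ 4 \<Rightarrow> real ^ 4" where R: "orthogonal_transformation R" "R (norm n *\<^sub>R axis 1 1) = n" by blast
  have [measurable]: "R \<in> borel_measurable borel"
    using orthogonal_transformation_linear[OF R(1)]
    by (simp add: linear_conv_bounded_linear borel_measurable_continuous_onI linear_continuous_on)
  have [measurable]: "R \<in> measurable ?\<mu> borel" "proj3 \<in> measurable ?\<mu> borel"
    using sets_\<mu> by (simp_all cong: measurable_cong_sets)
  have "AE p in lborel. (((1, 0), 0) :: (real \<times> real) \<times> real) \<bullet> p \<noteq> b / norm n"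
    by (rule AE_lborel_hyperplane) (simp add: zero_prod_def)
  then have "AE p in distr ?\<mu> borel proj3. fst (fst p) \<noteq> b / norm n"
    unfolding k by (subst AE_density) (auto simp: inner_prod_def elim: eventually_mono)
  then have "AE x in ?\<mu>. x $ 1 \<noteq> b / norm n"
    by (subst (asm) AE_distr_iff) (simp_all add: proj3_def)
  then have "AE x in ?\<mu>. n \<bullet> R x \<noteq> b"
  proof eventually_elim
    case (elim x)
    have "n \<bullet> R x = R (norm n *\<^sub>R axis 1 1) \<bullet> R x" using R(2) by simp
    also have "\<dots> = (norm n *\<^sub>R axis 1 1) \<bullet> x"
      using R(1) by (simp add: orthogonal_transformation_def)
    also have "\<dots> = norm n * x $ 1" by (simp add: inner_axis')
    finally show ?case using elim assms(2) by (auto simp: field_simps)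
  qed
  then have "AE x in distr ?\<mu> borel R. n \<bullet> x \<noteq> b"
    by (subst AE_distr_iff) simp_all
  then show ?thesis
    unfolding distr_beta_distribution_orthogonal[OF R(1)] .
qed

lemma prob_space_sphere_uniform: "prob_space (sphere_uniform :: 'a::euclidean_space measure)"
proof -
  have "prob_space (uniform_measure lborel (ball (0 :: 'a) 1))"
  proof (rule prob_space_uniform_measure)
    have "unit_ball_vol (real DIM('a)) > 0" by simp
    then have "unit_ball_vol (real DIM('a)) \<noteq> 0" by linarith
    then show "emeasure lborel (ball (0 :: 'a) 1) \<noteq> 0"
      using emeasure_ball[of 1 "0 :: 'a"] by simp
    show "emeasure lborel (ball (0 :: 'a) 1) \<noteq> \<infinity>"
      using emeasure_ball[of 1 "0 :: 'a"] by simp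
  qed
  then show ?thesis unfolding sphere_uniform_def by (rule prob_space.prob_space_distr) simp
qed

lemma measure_sphere_uniform_hyperplane:
  fixes n :: "real ^ 4"
  assumes "n \<noteq> 0" "A \<subseteq> {u. n \<bullet> u = 0}"
  shows "measure sphere_uniform A = 0"
proof (cases "A \<in> sets sphere_uniform")
  case True
  have "AE u in sphere_uniform. n \<bullet> u \<noteq> 0"
    using AE_beta_distribution_hyperplane[of "-1" n 0] assms(1) unfolding beta_distribution_minus_1 by simp
  then have "AE u in sphere_uniform. u \<notin> A"
    using assms(2) by (auto elim: eventually_mono)
  then have "emeasure sphere_uniform A = 0"
    using emeasure_eq_0_AE[of "\<lambda>u. u \<in> A" sphere_uniform] sets.sets_into_space[OF True]
    by (simp add: Int_absorb1 Collect_conj_eq[symmetric] Int_def[symmetric])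
  then show ?thesis by (simp add: measure_def)
\<comment> \<open>For a non-measurable \<open>A\<close> the default value of \<open>measure\<close>
  is \<open>0\<close>.\<close>
qed (simp add: measure_notin_sets)

lemma AE_norm_sphere_uniform: "AE u in sphere_uniform. norm (u :: real ^ 4) = 1"
proof -
  have [measurable]: "ball (0 :: real ^ 4) 1 \<in> sets borel" by simp
  have "AE y in uniform_measure lborel (ball (0 :: real ^ 4) 1). y \<noteq> 0"
    unfolding uniform_measure_def using AE_lborel_singleton[of "0 :: real ^ 4"]
    by (subst AE_density) (auto elim: eventually_mono)
  then show ?thesis
    unfolding sphere_uniform_def by (subst AE_distr_iff) (auto simp: norm_sgn elim: eventually_mono)
qed

text \<open>If the points are affinely independent they are the vertices and the cones are the
  angles. Otherwise the hull lies in a hyperplane, all directions into it are orthogonal to one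
  normal, and both sides vanish.\<close>

lemma vertex_angle_sum_convex_hull:
  fixes a b c d e :: "real ^ 4"
  shows "vertex_angle_sum (convex hull {a, b, c, d, e}) =
    measure sphere_uniform {u. in_cone a b c d e u} + measure sphere_uniform {u. in_cone b a c d e u} +
    measure sphere_uniform {u. in_cone c a b d e u} + measure sphere_uniform {u. in_cone d a b c e u} +
    measure sphere_uniform {u. in_cone e a b c d u}"
proof -
  let ?S = "{a, b, c, d, e}"
  let ?P = "convex hull ?S"
  have perm: "{b, a, c, d, e} = ?S" "{c, a, b, d, e} = ?S" "{d, a, b, c, e} = ?S" "{e, a, b, c, d} = ?S" by blast+
  have angles: "solid_angle a ?P = measure sphere_uniform {u. in_cone a b c d e u}"
    "solid_angle b ?P = measure sphere_uniform {u. in_cone b a c d e u}"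
    "solid_angle c ?P = measure sphere_uniform {u. in_cone c a b d e u}"
    "solid_angle d ?P = measure sphere_uniform {u. in_cone d a b c e u}"
    "solid_angle e ?P = measure sphere_uniform {u. in_cone e a b c d u}"
    using in_cone_convex_hull[of a _ b c d e] in_cone_convex_hull[of b _ a c d e]
      in_cone_convex_hull[of c _ a b d e] in_cone_convex_hull[of d _ a b c e] in_cone_convex_hull[of e _ a b c d]
    unfolding solid_angle_def perm by simp_all
  show ?thesis
  proof (cases "card ?S = 5 \<and> \<not> affine_dependent ?S")
    case True
    then have dist: "distinct [a, b, c, d, e]"
      using card_distinct[of "[a, b, c, d, e]"] by simp
    have "{x. x extreme_point_of ?P} = ?S"
      using True extreme_point_of_convex_hull_affine_independent[of ?S] by blast
    then show ?thesis
      unfolding vertex_angle_sum_def using dist by (simp add: angles)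
  next
    case False
    \<comment> \<open>Affine dimension four would force five distinct independent points, so any
      other sample, coincidences included, lies in a hyperplane.\<close>
    have "aff_dim ?S \<noteq> 4"
    proof
      assume d4: "aff_dim ?S = 4"
      have "aff_dim ?S \<le> int (card ?S) - 1" by (rule aff_dim_le_card) simp
      moreover have "card ?S \<le> 5" by (simp add: card_insert_if)
      ultimately have "card ?S = 5" using d4 by linarith
      with d4 have "\<not> affine_dependent ?S"
        by (simp add: affine_independent_iff_card)
      with \<open>card ?S = 5\<close> False show False by simp
    qed
    moreover have "aff_dim ?S \<le> 4" using aff_dim_le_DIM[of ?S] by simp
    ultimately have "aff_dim ?S < DIM(real ^ 4)" by simp
    then obtain n k where n: "n \<noteq> 0" "?S \<subseteq> {x. n \<bullet> x = k}"
      using aff_lowdim_subset_hyperplane by blast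
    then have P: "?P \<subseteq> {x. n \<bullet> x = k}"
      by (intro hull_minimal convex_hyperplane)
    have 0: "solid_angle x ?P = 0" if "x \<in> ?P" for x
      unfolding solid_angle_def
    proof (rule measure_sphere_uniform_hyperplane[OF n(1)], safe)
      fix u \<epsilon> :: "_" assume "(\<epsilon>::real) > 0" "x + \<epsilon> *\<^sub>R u \<in> ?P"
      then have "n \<bullet> (x + \<epsilon> *\<^sub>R u) = n \<bullet> x" using P that by blast
      then show "n \<bullet> u = 0" using \<open>\<epsilon> > 0\<close> by (simp add: inner_add_right)
    qed
    have "vertex_angle_sum ?P = 0"
      unfolding vertex_angle_sum_def by (intro sum.neutral) (auto simp: extreme_point_of_def 0)
    moreover have "solid_angle x ?P = 0" if "x \<in> ?S" for x
      using that hull_inc[of x ?S] by (intro 0)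
    ultimately show ?thesis
      unfolding angles[symmetric] by simp
  qed
qed

section \<open>Affine dependences of five points\<close>

definition cdet :: "real ^ 4 \<Rightarrow> real ^ 4 \<Rightarrow> real ^ 4 \<Rightarrow> real ^ 4 \<Rightarrow> real" where
  "cdet a b c d = triple_det (proj3 a) (proj3 b) (proj3 c) (proj3 d)"

lemma cdet_measurable [measurable (raw)]:
  assumes [measurable]: "f \<in> borel_measurable M" "g \<in> borel_measurable M" "h \<in> borel_measurable M" "k \<in> borel_measurable M"
  shows "(\<lambda>x. cdet (f x) (g x) (h x) (k x)) \<in> borel_measurable M"
  unfolding cdet_def by measurable

lemma cdet_coords: "cdet a b c d =
    (b $ 1 - a $ 1) * ((c $ 2 - a $ 2) * (d $ 3 - a $ 3) - (d $ 2 - a $ 2) * (c $ 3 - a $ 3))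
  - (c $ 1 - a $ 1) * ((b $ 2 - a $ 2) * (d $ 3 - a $ 3) - (d $ 2 - a $ 2) * (b $ 3 - a $ 3))
  + (d $ 1 - a $ 1) * ((b $ 2 - a $ 2) * (c $ 3 - a $ 3) - (c $ 2 - a $ 2) * (b $ 3 - a $ 3))"
  by (simp add: cdet_def triple_det_def proj3_def)

lemma cdet_swap34: "cdet a b d c = - cdet a b c d"
  unfolding cdet_coords by algebra

text \<open>Up to sign the determinant of the five points bordered by ones, expanded along the
  fourth coordinate: it is what the affine dependence of the projections leaves over in that
  coordinate.\<close>

definition vertical_gap :: "real ^ 4 \<Rightarrow> real ^ 4 \<Rightarrow> real ^ 4 \<Rightarrow> real ^ 4 \<Rightarrow> real ^ 4 \<Rightarrow> real" where
  "vertical_gap a b c d e = cdet b c d e * a $ 4 - cdet a c d e * b $ 4 + cdet a b d e * c $ 4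
     - cdet a b c e * d $ 4 + cdet a b c d * e $ 4"

lemma vertical_gap_measurable [measurable (raw)]:
  assumes [measurable]: "f \<in> borel_measurable M" "g \<in> borel_measurable M" "h \<in> borel_measurable M" "k \<in> borel_measurable M"
    "l \<in> borel_measurable M"
  shows "(\<lambda>x. vertical_gap (f x) (g x) (h x) (k x) (l x)) \<in> borel_measurable M"
  unfolding vertical_gap_def by measurable

text \<open>The signed \<open>cdet\<close>s of the four-point subsets are the coefficients of the affine dependence
  between the projections of the five points to \<open>\<real>\<^sup>3\<close>.\<close>

lemma cdet_sum: "cdet b c d e - cdet a c d e + cdet a b d e - cdet a b c e + cdet a b c d = 0"
  unfolding cdet_coords by algebra

text \<open>With a nonzero gap this writes the vertical direction in terms of the five
  points.\<close>

lemma cdet_dependence: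
  "cdet b c d e *\<^sub>R a - cdet a c d e *\<^sub>R b + cdet a b d e *\<^sub>R c - cdet a b c e *\<^sub>R d + cdet a b c d *\<^sub>R e
    = vertical_gap a b c d e *\<^sub>R axis 4 1"
proof -
  have "cdet b c d e * a $ 1 - cdet a c d e * b $ 1 + cdet a b d e * c $ 1 - cdet a b c e * d $ 1 + cdet a b c d * e $ 1 = 0"
    unfolding cdet_coords by algebra
  moreover have "cdet b c d e * a $ 2 - cdet a c d e * b $ 2 + cdet a b d e * c $ 2 - cdet a b c e * d $ 2 + cdet a b c d * e $ 2 = 0"
    unfolding cdet_coords by algebra
  moreover have "cdet b c d e * a $ 3 - cdet a c d e * b $ 3 + cdet a b d e * c $ 3 - cdet a b c e * d $ 3 + cdet a b c d * e $ 3 = 0"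
    unfolding cdet_coords by algebra
  ultimately show ?thesis
    by (simp add: vec_eq_iff forall_4 axis_def vertical_gap_def)
qed

text \<open>Cramer's rule: the determinant of the projected \<open>b - a\<close>,
  \<open>c - a\<close> and the vanishing combination loses the terms with \<open>ra\<close> and
  \<open>rb\<close>.\<close>

lemma cdet_relation:
  assumes "ra * (b $ 1 - a $ 1) + rb * (c $ 1 - a $ 1) + rc * (d $ 1 - a $ 1) + rd * (e $ 1 - a $ 1) = 0"
    and "ra * (b $ 2 - a $ 2) + rb * (c $ 2 - a $ 2) + rc * (d $ 2 - a $ 2) + rd * (e $ 2 - a $ 2) = 0"
    and "ra * (b $ 3 - a $ 3) + rb * (c $ 3 - a $ 3) + rc * (d $ 3 - a $ 3) + rd * (e $ 3 - a $ 3) = 0"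
  shows "rc * cdet a b c d + rd * cdet a b c e = 0"
  using assms unfolding cdet_coords by algebra

text \<open>The \<open>cdet\<close>s make the affine dependence of the projections unique up to
  scale, with all coefficients nonzero; the gap makes the simplex nondegenerate.\<close>

definition generic :: "real ^ 4 \<Rightarrow> real ^ 4 \<Rightarrow> real ^ 4 \<Rightarrow> real ^ 4 \<Rightarrow> real ^ 4 \<Rightarrow> bool" where
  "generic a b c d e \<longleftrightarrow> cdet b c d e \<noteq> 0 \<and> cdet a c d e \<noteq> 0 \<and> cdet a b d e \<noteq> 0 \<and> cdet a b c e \<noteq> 0
     \<and> cdet a b c d \<noteq> 0 \<and> vertical_gap a b c d e \<noteq> 0"

text \<open>The dependence expresses the gap \<open>s\<close> times the axis vector through the edge
  vectors at \<open>a\<close>, and such coefficients are unique. Membership is thus a matter of the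
  signs of the coefficients after scaling by \<open>h / s\<close>, and genericity makes the
  inequalities strict.\<close>

lemma in_cone_axis_iff:
  assumes "generic a b c d e" "h \<noteq> 0"
  shows "in_cone a b c d e (h *\<^sub>R axis 4 1) \<longleftrightarrow>
    h * vertical_gap a b c d e * - cdet a c d e > 0 \<and> h * vertical_gap a b c d e * cdet a b d e > 0 \<and>
    h * vertical_gap a b c d e * - cdet a b c e > 0 \<and> h * vertical_gap a b c d e * cdet a b c d > 0"
proof -
  define lb lc ld le s where "lb = - cdet a c d e" and "lc = cdet a b d e" and "ld = - cdet a b c e"
    and "le = cdet a b c d" and "s = vertical_gap a b c d e"
  have nz: "lb \<noteq> 0" "lc \<noteq> 0" "ld \<noteq> 0" "le \<noteq> 0" "s \<noteq> 0"
    using assms by (simp_all add: generic_def lb_def lc_def ld_def le_def s_def)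
  have dep: "s *\<^sub>R axis 4 1 = lb *\<^sub>R (b - a) + lc *\<^sub>R (c - a) + ld *\<^sub>R (d - a) + le *\<^sub>R (e - a)"
  proof -
    have la: "cdet b c d e = - (lb + lc + ld + le)"
      using cdet_sum[of b c d e a] by (simp add: lb_def lc_def ld_def le_def)
    have "s *\<^sub>R axis 4 1 = cdet b c d e *\<^sub>R a + lb *\<^sub>R b + lc *\<^sub>R c + ld *\<^sub>R d + le *\<^sub>R e"
      unfolding s_def cdet_dependence[symmetric] by (simp add: lb_def lc_def ld_def le_def)
    then show ?thesis
      unfolding la by (simp add: algebra_simps)
  qed
  have sgn: "h / s * l \<ge> 0 \<longleftrightarrow> h * s * l > 0" if "l \<noteq> 0" for l
  proof -
    have "h * s * l = s\<^sup>2 * (h / s * l)" using nz(5) by (simp add: power2_eq_square)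
    moreover have "s\<^sup>2 > 0" using nz(5) by simp
    moreover have "h / s * l \<noteq> 0" using that nz(5) assms(2) by simp
    ultimately show ?thesis by (metis order_less_le zero_less_mult_pos mult_pos_pos)
  qed
  have "in_cone a b c d e (h *\<^sub>R axis 4 1) \<longleftrightarrow> h / s * lb \<ge> 0 \<and> h / s * lc \<ge> 0 \<and> h / s * ld \<ge> 0 \<and> h / s * le \<ge> 0"
  proof
    assume "in_cone a b c d e (h *\<^sub>R axis 4 1)"
    then obtain rb rc rd re where r: "rb \<ge> 0" "rc \<ge> 0" "rd \<ge> 0" "re \<ge> 0"
      "h *\<^sub>R axis 4 1 = rb *\<^sub>R (b - a) + rc *\<^sub>R (c - a) + rd *\<^sub>R (d - a) + re *\<^sub>R (e - a)"
      unfolding in_cone_def by blast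
    have v: "(h *\<^sub>R axis 4 1 :: real ^ 4) $ i = rb * (b $ i - a $ i) + rc * (c $ i - a $ i) + rd * (d $ i - a $ i) + re * (e $ i - a $ i)" for i
      unfolding r(5) by simp
    have z: "rb * (b $ 1 - a $ 1) + rc * (c $ 1 - a $ 1) + rd * (d $ 1 - a $ 1) + re * (e $ 1 - a $ 1) = 0"
      "rb * (b $ 2 - a $ 2) + rc * (c $ 2 - a $ 2) + rd * (d $ 2 - a $ 2) + re * (e $ 2 - a $ 2) = 0"
      "rb * (b $ 3 - a $ 3) + rc * (c $ 3 - a $ 3) + rd * (d $ 3 - a $ 3) + re * (e $ 3 - a $ 3) = 0"
      unfolding v[symmetric] by (simp_all add: axis_def)
    \<comment> \<open>The ratios of the coefficients are forced to be those of the dependence; the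
      fourth coordinate then fixes the common factor \<open>t\<close> as
      \<open>h / s\<close>.\<close>
    have 1: "rd * le = re * ld"
      using cdet_relation[OF z] by (simp add: le_def ld_def)
    have 2: "rc * le = re * lc"
      using cdet_relation[of rb b a rd d rc c re e] z
      by (simp add: le_def lc_def algebra_simps cdet_swap34[of a b c d])
    have 3: "rb * le = re * lb"
    proof -
      have "rb * cdet a c d b + re * cdet a c d e = 0"
        using z by (intro cdet_relation[of rc c a rd d rb b re e]) (simp_all add: algebra_simps)
      moreover have "cdet a c d b = cdet a b c d"
        unfolding cdet_coords by algebra
      ultimately show ?thesis by (simp add: le_def lb_def)
    qed
    define t where "t = re / le"
    have c: "rb = t * lb" "rc = t * lc" "rd = t * ld" "re = t * le"
      using 1 2 3 nz by (simp_all add: t_def field_simps)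
    have "h *\<^sub>R axis 4 1 = t *\<^sub>R (s *\<^sub>R axis 4 1 :: real ^ 4)"
      unfolding r(5) dep c by (simp add: algebra_simps)
    then have "(h *\<^sub>R axis 4 1 :: real ^ 4) $ 4 = (t *\<^sub>R (s *\<^sub>R axis 4 1 :: real ^ 4)) $ 4" by simp
    then have "t = h / s" using nz by (simp add: axis_def)
    then show "h / s * lb \<ge> 0 \<and> h / s * lc \<ge> 0 \<and> h / s * ld \<ge> 0 \<and> h / s * le \<ge> 0"
      using r c by simp
  next
    assume nn: "h / s * lb \<ge> 0 \<and> h / s * lc \<ge> 0 \<and> h / s * ld \<ge> 0 \<and> h / s * le \<ge> 0"
    have "h *\<^sub>R axis 4 1 = (h / s) *\<^sub>R (s *\<^sub>R axis 4 1 :: real ^ 4)" using nz by simp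
    also have "\<dots> = (h / s * lb) *\<^sub>R (b - a) + (h / s * lc) *\<^sub>R (c - a) + (h / s * ld) *\<^sub>R (d - a) + (h / s * le) *\<^sub>R (e - a)"
      unfolding dep by (simp only: scaleR_add_right scaleR_scaleR)
    finally show "in_cone a b c d e (h *\<^sub>R axis 4 1)"
      unfolding in_cone_def using nn by blast
  qed
  then show ?thesis
    unfolding sgn[OF nz(1)] sgn[OF nz(2)] sgn[OF nz(3)] sgn[OF nz(4)]
    unfolding lb_def lc_def ld_def le_def s_def .
qed

section \<open>Counting separations\<close>

text \<open>The zero sum excludes five equal signs. Four equal signs make
  \<open>4 choose 2 = 6\<close> agreeing pairs, and exactly one summand on the right is one; a split
  into three and two makes \<open>3 + 1 = 4\<close> such pairs, and all summands vanish.\<close>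

lemma count_sign_pairs:
  fixes a b c d e :: real
  assumes "a \<noteq> 0" "b \<noteq> 0" "c \<noteq> 0" "d \<noteq> 0" "e \<noteq> 0" "a + b + c + d + e = 0"
  shows "(of_bool (d * e > 0) + of_bool (c * e > 0) + of_bool (c * d > 0) + of_bool (b * e > 0) + of_bool (b * d > 0)
    + of_bool (b * c > 0) + of_bool (a * e > 0) + of_bool (a * d > 0) + of_bool (a * c > 0) + of_bool (a * b > 0) :: nat)
    = 4 + 2 * (of_bool (b > 0 \<and> c > 0 \<and> d > 0 \<and> e > 0) + of_bool (a > 0 \<and> c > 0 \<and> d > 0 \<and> e > 0)
      + of_bool (a > 0 \<and> b > 0 \<and> d > 0 \<and> e > 0) + of_bool (a > 0 \<and> b > 0 \<and> c > 0 \<and> e > 0)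
      + of_bool (a > 0 \<and> b > 0 \<and> c > 0 \<and> d > 0)
      + of_bool (b < 0 \<and> c < 0 \<and> d < 0 \<and> e < 0) + of_bool (a < 0 \<and> c < 0 \<and> d < 0 \<and> e < 0)
      + of_bool (a < 0 \<and> b < 0 \<and> d < 0 \<and> e < 0) + of_bool (a < 0 \<and> b < 0 \<and> c < 0 \<and> e < 0)
      + of_bool (a < 0 \<and> b < 0 \<and> c < 0 \<and> d < 0))"
proof -
  have prod: "x * y > 0 \<longleftrightarrow> (x > 0 \<longleftrightarrow> y > 0)" if "x \<noteq> 0" "y \<noteq> 0" for x y :: real
    using that by (auto simp: zero_less_mult_iff)
  have neg: "x < 0 \<longleftrightarrow> \<not> x > 0" if "x \<noteq> 0" for x :: real
    using that by auto
  have "\<not> (a > 0 \<and> b > 0 \<and> c > 0 \<and> d > 0 \<and> e > 0)" "\<not> (\<not> a > 0 \<and> \<not> b > 0 \<and> \<not> c > 0 \<and> \<not> d > 0 \<and> \<not> e > 0)"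
    using assms by linarith+
  then show ?thesis
    unfolding neg[OF assms(1)] neg[OF assms(2)] neg[OF assms(3)] neg[OF assms(4)] neg[OF assms(5)]
    using assms(1-5)
    by (cases "a > 0"; cases "b > 0"; cases "c > 0"; cases "d > 0"; cases "e > 0") (simp_all add: prod)
qed

definition sep :: "real ^ 4 \<Rightarrow> real ^ 4 \<Rightarrow> real ^ 4 \<Rightarrow> real ^ 4 \<Rightarrow> real ^ 4 \<Rightarrow> ennreal" where
  "sep a b c d e = indicator {x. x < 0} (cdet a b c d * cdet a b c e)"

definition cone_axis :: "real \<Rightarrow> real ^ 4 \<Rightarrow> real ^ 4 \<Rightarrow> real ^ 4 \<Rightarrow> real ^ 4 \<Rightarrow> real ^ 4 \<Rightarrow> ennreal" where
  "cone_axis h a b c d e = of_bool (in_cone a b c d e (h *\<^sub>R axis 4 1))"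

text \<open>In the dependence the coefficients are the \<open>cdet\<close>s with alternating signs,
  and the alternation turns opposite sides of a plane into equal signs of two coefficients. A common
  factor \<open>s\<close> does not affect agreement of signs and is the one that the cone criterion
  asks for, so the count is applied to \<open>s * la\<close>, ..., \<open>s * le\<close>.\<close>

lemma count_separations:
  assumes g: "generic a b c d e"
  shows "sep a b c d e + sep a b d c e + sep a b e c d + sep a c d b e + sep a c e b d + sep a d e b c
    + sep b c d a e + sep b c e a d + sep b d e a c + sep c d e a b
    = 4 + 2 * (cone_axis 1 a b c d e + cone_axis 1 b a c d e + cone_axis 1 c a b d e + cone_axis 1 d a b c e + cone_axis 1 e a b c d
      + cone_axis (-1) a b c d e + cone_axis (-1) b a c d e + cone_axis (-1) c a b d e + cone_axis (-1) d a b c e + cone_axis (-1) e a b c d)"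
proof -
  define la lb lc ld le s where "la = cdet b c d e" and "lb = - cdet a c d e" and "lc = cdet a b d e" and "ld = - cdet a b c e"
    and "le = cdet a b c d" and "s = vertical_gap a b c d e"
  have nz: "la \<noteq> 0" "lb \<noteq> 0" "lc \<noteq> 0" "ld \<noteq> 0" "le \<noteq> 0" "s \<noteq> 0"
    using g by (simp_all add: generic_def la_def lb_def lc_def ld_def le_def s_def)
  have cd: "cdet a b c d = le" "cdet a b c e = - ld" "cdet a b d e = lc" "cdet a c d e = - lb" "cdet b c d e = la"
    by (simp_all add: la_def lb_def lc_def ld_def le_def)
  \<comment> \<open>\<open>cdet\<close> is alternating in its four points, so all orderings reduce
    to the five coefficients.\<close>
  have perm: "cdet a b d c = - le" "cdet a b e c = ld" "cdet a b e d = - lc" "cdet a c d b = le" "cdet a c e b = - ld"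
    "cdet a c e d = lb" "cdet a d e b = lc" "cdet a d e c = - lb" "cdet b c d a = - le" "cdet b c e a = ld"
    "cdet b c e d = - la" "cdet b d e a = - lc" "cdet b d e c = la" "cdet c d e a = lb" "cdet c d e b = - la"
    unfolding la_def lb_def lc_def ld_def le_def cdet_coords by algebra+
  have perm': "cdet b a c d = - le" "cdet b a c e = ld" "cdet b a d e = - lc"
    "cdet c a b d = le" "cdet c a b e = - ld" "cdet c a d e = lb" "cdet c b d e = - la"
    "cdet d a b c = - le" "cdet d a b e = lc" "cdet d a c e = - lb" "cdet d b c e = la"
    "cdet e a b c = ld" "cdet e a b d = - lc" "cdet e a c d = lb" "cdet e b c d = - la"
    unfolding la_def lb_def lc_def ld_def le_def cdet_coords by algebra+
  have h0: "vertical_gap a b c d e = s" by (simp add: s_def)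
  have hs: "vertical_gap b a c d e = - s" "vertical_gap c a b d e = s" "vertical_gap d a b c e = - s" "vertical_gap e a b c d = s"
    unfolding s_def vertical_gap_def perm' cd by simp_all
  have gen: "generic b a c d e" "generic c a b d e" "generic d a b c e" "generic e a b c d"
    using nz unfolding generic_def hs perm' cd by simp_all
  have sep: "sep a b c d e = of_bool ((s * ld) * (s * le) > 0)" "sep a b d c e = of_bool ((s * lc) * (s * le) > 0)"
    "sep a b e c d = of_bool ((s * lc) * (s * ld) > 0)" "sep a c d b e = of_bool ((s * lb) * (s * le) > 0)"
    "sep a c e b d = of_bool ((s * lb) * (s * ld) > 0)" "sep a d e b c = of_bool ((s * lb) * (s * lc) > 0)"
    "sep b c d a e = of_bool ((s * la) * (s * le) > 0)" "sep b c e a d = of_bool ((s * la) * (s * ld) > 0)"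
    "sep b d e a c = of_bool ((s * la) * (s * lc) > 0)" "sep c d e a b = of_bool ((s * la) * (s * lb) > 0)"
  proof -
    have sq: "(s * x) * (s * y) > 0 \<longleftrightarrow> x * y > 0" for x y
    proof -
      have "(s * x) * (s * y) = s\<^sup>2 * (x * y)" by (simp add: power2_eq_square)
      moreover have "s\<^sup>2 > 0" using nz(6) by simp
      ultimately show ?thesis by (metis zero_less_mult_pos mult_pos_pos)
    qed
    show "sep a b c d e = of_bool ((s * ld) * (s * le) > 0)" "sep a b d c e = of_bool ((s * lc) * (s * le) > 0)"
      "sep a b e c d = of_bool ((s * lc) * (s * ld) > 0)" "sep a c d b e = of_bool ((s * lb) * (s * le) > 0)"
      "sep a c e b d = of_bool ((s * lb) * (s * ld) > 0)" "sep a d e b c = of_bool ((s * lb) * (s * lc) > 0)"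
      "sep b c d a e = of_bool ((s * la) * (s * le) > 0)" "sep b c e a d = of_bool ((s * la) * (s * ld) > 0)"
      "sep b d e a c = of_bool ((s * la) * (s * lc) > 0)" "sep c d e a b = of_bool ((s * la) * (s * lb) > 0)"
      unfolding sep_def sq cd perm indicator_def by (simp_all add: mult.commute)
  qed
  have cone: "cone_axis h a b c d e = of_bool (h * (s * lb) > 0 \<and> h * (s * lc) > 0 \<and> h * (s * ld) > 0 \<and> h * (s * le) > 0)"
    "cone_axis h b a c d e = of_bool (h * (s * la) > 0 \<and> h * (s * lc) > 0 \<and> h * (s * ld) > 0 \<and> h * (s * le) > 0)"
    "cone_axis h c a b d e = of_bool (h * (s * la) > 0 \<and> h * (s * lb) > 0 \<and> h * (s * ld) > 0 \<and> h * (s * le) > 0)"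
    "cone_axis h d a b c e = of_bool (h * (s * la) > 0 \<and> h * (s * lb) > 0 \<and> h * (s * lc) > 0 \<and> h * (s * le) > 0)"
    "cone_axis h e a b c d = of_bool (h * (s * la) > 0 \<and> h * (s * lb) > 0 \<and> h * (s * lc) > 0 \<and> h * (s * ld) > 0)"
    if "h \<noteq> 0" for h
    unfolding cone_axis_def in_cone_axis_iff[OF g that] in_cone_axis_iff[OF gen(1) that] in_cone_axis_iff[OF gen(2) that]
      in_cone_axis_iff[OF gen(3) that] in_cone_axis_iff[OF gen(4) that] hs h0 perm' cd
    by (simp_all only: mult.assoc mult_minus_left mult_minus_right minus_minus)
  have sum0: "s * la + s * lb + s * lc + s * ld + s * le = 0"
    using cdet_sum[of b c d e a] unfolding cd by (simp flip: distrib_left)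
  \<comment> \<open>\<open>h = 1\<close> selects four positive coefficients and
    \<open>h = -1\<close> four negative ones, the two halves of the count.\<close>
  have neg: "- 1 * x > 0 \<longleftrightarrow> x < 0" "1 * x = x" for x :: real by auto
  from count_sign_pairs[OF _ _ _ _ _ sum0] nz
  have "(of_nat (of_bool ((s * ld) * (s * le) > 0) + of_bool ((s * lc) * (s * le) > 0) + of_bool ((s * lc) * (s * ld) > 0)
      + of_bool ((s * lb) * (s * le) > 0) + of_bool ((s * lb) * (s * ld) > 0) + of_bool ((s * lb) * (s * lc) > 0)
      + of_bool ((s * la) * (s * le) > 0) + of_bool ((s * la) * (s * ld) > 0) + of_bool ((s * la) * (s * lc) > 0) + of_bool ((s * la) * (s * lb) > 0)) :: ennreal)
    = of_nat (4 + 2 * (of_bool (s * lb > 0 \<and> s * lc > 0 \<and> s * ld > 0 \<and> s * le > 0) + of_bool (s * la > 0 \<and> s * lc > 0 \<and> s * ld > 0 \<and> s * le > 0)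
      + of_bool (s * la > 0 \<and> s * lb > 0 \<and> s * ld > 0 \<and> s * le > 0) + of_bool (s * la > 0 \<and> s * lb > 0 \<and> s * lc > 0 \<and> s * le > 0)
      + of_bool (s * la > 0 \<and> s * lb > 0 \<and> s * lc > 0 \<and> s * ld > 0)
      + of_bool (s * lb < 0 \<and> s * lc < 0 \<and> s * ld < 0 \<and> s * le < 0) + of_bool (s * la < 0 \<and> s * lc < 0 \<and> s * ld < 0 \<and> s * le < 0)
      + of_bool (s * la < 0 \<and> s * lb < 0 \<and> s * ld < 0 \<and> s * le < 0) + of_bool (s * la < 0 \<and> s * lb < 0 \<and> s * lc < 0 \<and> s * le < 0)
      + of_bool (s * la < 0 \<and> s * lb < 0 \<and> s * lc < 0 \<and> s * ld < 0)))"
    by (intro arg_cong[where f = of_nat]) simp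
  then show ?thesis
    unfolding sep cone[OF one_neq_zero] cone[OF neg_one_neq_zero] neg of_nat_add of_nat_mult of_nat_of_bool of_nat_numeral .
qed

section \<open>Genericity, independence and expectation\<close>

lemma AE_beta_distribution_affine:
  assumes "\<beta> \<ge> -1" "v1 \<noteq> 0 \<or> v2 \<noteq> 0 \<or> v3 \<noteq> 0 \<or> v4 \<noteq> 0"
  shows "AE x :: real ^ 4 in beta_distribution \<beta>. v1 * x $ 1 + v2 * x $ 2 + v3 * x $ 3 + v4 * x $ 4 + k \<noteq> 0"
proof -
  define n where "n = vec4 ((v1, v2), v3) v4"
  have n0: "n \<noteq> 0" using assms(2) by (auto simp: n_def vec_eq_iff forall_4)
  have n: "n \<bullet> x = v1 * x $ 1 + v2 * x $ 2 + v3 * x $ 3 + v4 * x $ 4" for x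
    by (simp add: inner_vec_def sum_4 n_def)
  show ?thesis
    using AE_beta_distribution_hyperplane[OF assms(1) n0, of "- k"]
    by eventually_elim (simp add: n)
qed

definition minor :: "real ^ 4 \<Rightarrow> real ^ 4 \<Rightarrow> real ^ 4 \<Rightarrow> 4 \<Rightarrow> 4 \<Rightarrow> real" where
  "minor a b c i j = (b $ i - a $ i) * (c $ j - a $ j) - (c $ i - a $ i) * (b $ j - a $ j)"

text \<open>The last point enters affinely, with the value at the origin as constant term, so one
  nonzero minor makes the zero set a hyperplane.\<close>

lemma cdet_affine:
  "cdet a b c d = minor a b c 2 3 * d $ 1 - minor a b c 1 3 * d $ 2 + minor a b c 1 2 * d $ 3 + cdet a b c 0"
  unfolding cdet_coords minor_def zero_index by algebra

lemma AE_minor: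
  assumes "\<beta> \<ge> -1" "b $ 1 \<noteq> a $ 1"
  shows "AE c in beta_distribution \<beta>. minor a b c 1 2 \<noteq> 0"
proof -
  have "AE c :: real ^ 4 in beta_distribution \<beta>. - (b $ 2 - a $ 2) * c $ 1 + (b $ 1 - a $ 1) * c $ 2 + 0 * c $ 3 + 0 * c $ 4
      + (a $ 1 * (b $ 2 - a $ 2) - (b $ 1 - a $ 1) * a $ 2) \<noteq> 0"
    using assms by (intro AE_beta_distribution_affine) auto
  then show ?thesis by eventually_elim (simp add: minor_def algebra_simps)
qed

lemma AE_cdet:
  assumes "\<beta> \<ge> -1" "minor a b c 1 2 \<noteq> 0"
  shows "AE d in beta_distribution \<beta>. cdet a b c d \<noteq> 0"
proof -
  have "AE d :: real ^ 4 in beta_distribution \<beta>. minor a b c 2 3 * d $ 1 + (- minor a b c 1 3) * d $ 2 + minor a b c 1 2 * d $ 3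
     + 0 * d $ 4 + cdet a b c 0 \<noteq> 0"
    using assms by (intro AE_beta_distribution_affine) auto
  then show ?thesis
  proof eventually_elim
    case (elim d)
    then show ?case by (subst cdet_affine) simp
  qed
qed

text \<open>The gap is affine in the last point, and the coefficient of \<open>e $ 4\<close> is
  \<open>cdet a b c d\<close>.\<close>

lemma AE_vertical_gap:
  assumes "\<beta> \<ge> -1" "cdet a b c d \<noteq> 0"
  shows "AE e in beta_distribution \<beta>. vertical_gap a b c d e \<noteq> 0"
proof -
  let ?v = "\<lambda>i j. minor b c d i j * a $ 4 - minor a c d i j * b $ 4 + minor a b d i j * c $ 4 - minor a b c i j * d $ 4"
  have gap: "vertical_gap a b c d e = ?v 2 3 * e $ 1 + (- ?v 1 3) * e $ 2 + ?v 1 2 * e $ 3 + cdet a b c d * e $ 4 + vertical_gap a b c d 0" for e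
    unfolding vertical_gap_def zero_index
    unfolding cdet_affine[of b c d e] cdet_affine[of a c d e] cdet_affine[of a b d e] cdet_affine[of a b c e]
    by (simp add: algebra_simps)
  have "AE e :: real ^ 4 in beta_distribution \<beta>. ?v 2 3 * e $ 1 + (- ?v 1 3) * e $ 2 + ?v 1 2 * e $ 3 + cdet a b c d * e $ 4 + vertical_gap a b c d 0 \<noteq> 0"
    using assms by (intro AE_beta_distribution_affine) auto
  then show ?thesis
  proof eventually_elim
    case (elim e)
    then show ?case by (subst gap)
  qed
qed

text \<open>Points are added one at a time. Each condition is affine in the newest point with a
  coefficient that is nonzero by a condition on earlier points: first coordinates serve the minors,
  minors the \<open>cdet\<close>s, a \<open>cdet\<close> the gap. So each step excludes finitely
  many null hyperplanes.\<close>

lemma AE_generic: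
  assumes \<beta>: "\<beta> \<ge> -1"
  shows "AE a in beta_distribution \<beta>. AE b in beta_distribution \<beta>. AE c in beta_distribution \<beta>.
    AE d in beta_distribution \<beta>. AE e in beta_distribution \<beta>. generic a b c d e"
proof -
  have nth: "AE b :: real ^ 4 in beta_distribution \<beta>. b $ 1 \<noteq> a $ 1" for a :: "real ^ 4"
  proof -
    have "AE b :: real ^ 4 in beta_distribution \<beta>. 1 * b $ 1 + 0 * b $ 2 + 0 * b $ 3 + 0 * b $ 4 + - a $ 1 \<noteq> 0"
      using \<beta> by (intro AE_beta_distribution_affine) auto
    then show ?thesis by eventually_elim simp
  qed
  have "AE b in beta_distribution \<beta>. AE c in beta_distribution \<beta>.
    AE d in beta_distribution \<beta>. AE e in beta_distribution \<beta>. generic a b c d e" for a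
    using nth[of a]
  proof eventually_elim
    case (elim b)
    show ?case
      using nth[of a] nth[of b] AE_minor[OF \<beta> elim]
    proof eventually_elim
      case (elim c)
      note ac = elim(1) and bc = elim(2) and abc = elim(3)
      show ?case
        using AE_minor[OF \<beta> \<open>b $ 1 \<noteq> a $ 1\<close>] AE_minor[OF \<beta> ac] AE_minor[OF \<beta> bc] AE_cdet[OF \<beta> abc]
      proof eventually_elim
        case (elim d)
        show ?case
          using AE_cdet[OF \<beta> abc] AE_cdet[OF \<beta> elim(1)] AE_cdet[OF \<beta> elim(2)] AE_cdet[OF \<beta> elim(3)]
            AE_vertical_gap[OF \<beta> elim(4)]
          by eventually_elim (use elim(4) in \<open>simp add: generic_def\<close>)
      qed
    qed
  qed
  then show ?thesis by (rule AE_I2)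
qed

lemma generic_measurable [measurable (raw)]:
  assumes [measurable]: "f \<in> borel_measurable M" "g \<in> borel_measurable M" "h \<in> borel_measurable M" "k \<in> borel_measurable M"
    "l \<in> borel_measurable M"
  shows "Measurable.pred M (\<lambda>x. generic (f x) (g x) (h x) (k x) (l x))"
  unfolding generic_def by measurable

section \<open>Iterated integrals of five independent points\<close>

definition iter5 :: "'a measure \<Rightarrow> ('a \<Rightarrow> 'a \<Rightarrow> 'a \<Rightarrow> 'a \<Rightarrow> 'a \<Rightarrow> ennreal) \<Rightarrow> ennreal" where
  "iter5 \<mu> f = (\<integral>\<^sup>+a. \<integral>\<^sup>+b. \<integral>\<^sup>+c. \<integral>\<^sup>+d. \<integral>\<^sup>+e. f a b c d e \<partial>\<mu> \<partial>\<mu> \<partial>\<mu> \<partial>\<mu> \<partial>\<mu>)"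

lemma measurable_curry5:
  assumes "(\<lambda>(x, y, z, w, v). f x y z w v) \<in> measurable (A \<Otimes>\<^sub>M B \<Otimes>\<^sub>M C \<Otimes>\<^sub>M D \<Otimes>\<^sub>M E) F"
    and "g \<in> measurable N A" "h \<in> measurable N B" "k \<in> measurable N C" "l \<in> measurable N D" "m \<in> measurable N E"
  shows "(\<lambda>x. f (g x) (h x) (k x) (l x) (m x)) \<in> measurable N F"
proof -
  have "(\<lambda>x. (g x, h x, k x, l x, m x)) \<in> measurable N (A \<Otimes>\<^sub>M B \<Otimes>\<^sub>M C \<Otimes>\<^sub>M D \<Otimes>\<^sub>M E)"
    using assms(2-) by simp
  from measurable_compose[OF this assms(1)] show ?thesis by simp
qed

lemma iter5_distr:
  assumes "prob_space \<mu>" and T [measurable]: "T \<in> measurable \<mu> N"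
    and f: "(\<lambda>(a, b, c, d, e). f a b c d e) \<in> borel_measurable (N \<Otimes>\<^sub>M N \<Otimes>\<^sub>M N \<Otimes>\<^sub>M N \<Otimes>\<^sub>M N)"
  shows "iter5 (distr \<mu> N T) f = iter5 \<mu> (\<lambda>a b c d e. f (T a) (T b) (T c) (T d) (T e))"
proof -
  note [measurable (raw)] = measurable_curry5[OF f]
  interpret prob_space \<mu> by fact
  interpret N: prob_space "distr \<mu> N T" by (rule prob_space_distr) fact
  let ?N = "distr \<mu> N T"
  have d: "(\<integral>\<^sup>+x. g x \<partial>?N) = (\<integral>\<^sup>+x. g (T x) \<partial>\<mu>)" if "g \<in> borel_measurable N" for g
    using that by (intro nn_integral_distr T) simp
  have "iter5 ?N f = (\<integral>\<^sup>+a. \<integral>\<^sup>+b. \<integral>\<^sup>+c. \<integral>\<^sup>+d. \<integral>\<^sup>+e. f (T a) b c d e \<partial>?N \<partial>?N \<partial>?N \<partial>?N \<partial>\<mu>)"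
    unfolding iter5_def by (rule d) measurable
  also have "\<dots> = (\<integral>\<^sup>+a. \<integral>\<^sup>+b. \<integral>\<^sup>+c. \<integral>\<^sup>+d. \<integral>\<^sup>+e. f (T a) (T b) c d e \<partial>?N \<partial>?N \<partial>?N \<partial>\<mu> \<partial>\<mu>)"
    by (rule nn_integral_cong, rule d) measurable
  also have "\<dots> = (\<integral>\<^sup>+a. \<integral>\<^sup>+b. \<integral>\<^sup>+c. \<integral>\<^sup>+d. \<integral>\<^sup>+e. f (T a) (T b) (T c) d e \<partial>?N \<partial>?N \<partial>\<mu> \<partial>\<mu> \<partial>\<mu>)"
    by (rule nn_integral_cong, rule nn_integral_cong, rule d) measurable
  also have "\<dots> = (\<integral>\<^sup>+a. \<integral>\<^sup>+b. \<integral>\<^sup>+c. \<integral>\<^sup>+d. \<integral>\<^sup>+e. f (T a) (T b) (T c) (T d) e \<partial>?N \<partial>\<mu> \<partial>\<mu> \<partial>\<mu> \<partial>\<mu>)"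
    by (rule nn_integral_cong, rule nn_integral_cong, rule nn_integral_cong, rule d) measurable
  also have "\<dots> = iter5 \<mu> (\<lambda>a b c d e. f (T a) (T b) (T c) (T d) (T e))"
    unfolding iter5_def
    by (rule nn_integral_cong, rule nn_integral_cong, rule nn_integral_cong, rule nn_integral_cong, rule d) measurable
  finally show ?thesis .
qed

lemma iter5_eq_0:
  assumes "AE a in \<mu>. AE b in \<mu>. AE c in \<mu>. AE d in \<mu>. AE e in \<mu>. f a b c d e = 0"
  shows "iter5 \<mu> f = 0"
proof -
  have z: "(\<integral>\<^sup>+x. g x \<partial>\<mu>) = 0" if "AE x in \<mu>. g x = 0" for g
    using nn_integral_cong_AE[OF that] by simp
  show ?thesis
    unfolding iter5_def
    by (rule z, rule eventually_mono[OF assms], rule z, erule eventually_mono, rule z, erule eventually_mono,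
      rule z, erule eventually_mono, rule z)
qed

text \<open>Independence makes the joint law a product measure, from which one coordinate is peeled
  off at a time. As the right side does not see the order in which the indices are listed, this also
  contains exchangeability.\<close>

lemma (in prob_space) nn_integral_indep_vars5:
  fixes X :: "'i \<Rightarrow> 'a \<Rightarrow> 'b::topological_space"
  assumes X: "indep_vars (\<lambda>_. borel) X J" and J: "J = {i, j, k, l, m}" "distinct [i, j, k, l, m]"
    and \<mu>: "\<And>i. i \<in> J \<Longrightarrow> distr M borel (X i) = \<mu>"
    and f: "(\<lambda>(a, b, c, d, e). f a b c d e) \<in> borel_measurable (borel \<Otimes>\<^sub>M borel \<Otimes>\<^sub>M borel \<Otimes>\<^sub>M borel \<Otimes>\<^sub>M borel)"
  shows "(\<integral>\<^sup>+\<omega>. f (X i \<omega>) (X j \<omega>) (X k \<omega>) (X l \<omega>) (X m \<omega>) \<partial>M) = iter5 \<mu> f"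
proof -
  note fm [measurable (raw)] = measurable_curry5[OF f]
  have Xm: "random_variable borel (X i)" if "i \<in> J" for i
    using X that unfolding indep_vars_def2 by blast
  have "prob_space \<mu>" using \<mu>[of i] J Xm[of i] prob_space_distr by auto
  have sets_\<mu> [measurable_cong]: "sets \<mu> = sets borel" using \<mu>[of i] J by auto
  interpret \<mu>: prob_space \<mu> by fact
  interpret P: product_sigma_finite "\<lambda>_ :: 'i. \<mu>" by standard
  have "distr M (PiM J (\<lambda>_. borel)) (\<lambda>\<omega>. \<lambda>i\<in>J. X i \<omega>) = PiM J (\<lambda>i. distr M borel (X i))"
    using indep_vars_iff_distr_eq_PiM'[of J X "\<lambda>_. borel"] X Xm J(1) by blast
  also have "\<dots> = PiM J (\<lambda>_. \<mu>)" using \<mu> by (intro PiM_cong) auto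
  finally have D: "distr M (PiM J (\<lambda>_. borel)) (\<lambda>\<omega>. \<lambda>i\<in>J. X i \<omega>) = PiM J (\<lambda>_. \<mu>)" .
  have in_J: "i \<in> J" "j \<in> J" "k \<in> J" "l \<in> J" "m \<in> J" using J by auto
  have "(\<integral>\<^sup>+\<omega>. f (X i \<omega>) (X j \<omega>) (X k \<omega>) (X l \<omega>) (X m \<omega>) \<partial>M)
    = (\<integral>\<^sup>+\<omega>. f ((\<lambda>i\<in>J. X i \<omega>) i) ((\<lambda>i\<in>J. X i \<omega>) j) ((\<lambda>i\<in>J. X i \<omega>) k) ((\<lambda>i\<in>J. X i \<omega>) l) ((\<lambda>i\<in>J. X i \<omega>) m) \<partial>M)"
    using in_J by simp
  also have "\<dots> = (\<integral>\<^sup>+x. f (x i) (x j) (x k) (x l) (x m) \<partial>PiM J (\<lambda>_. \<mu>))"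
  proof -
    have "(\<lambda>\<omega>. \<lambda>i\<in>J. X i \<omega>) \<in> measurable M (PiM J (\<lambda>_. borel))"
      using Xm by (intro measurable_restrict) auto
    moreover have "(\<lambda>x. f (x i) (x j) (x k) (x l) (x m)) \<in> borel_measurable (PiM J (\<lambda>_. borel))"
      using in_J by (intro fm measurable_component_singleton)
    ultimately show ?thesis
      unfolding D[symmetric] by (simp add: nn_integral_distr)
  qed
  also have "\<dots> = iter5 \<mu> f"
  proof -
    have step: "(\<integral>\<^sup>+x. g x \<partial>PiM (insert i I) (\<lambda>_. \<mu>)) = (\<integral>\<^sup>+y. \<integral>\<^sup>+x. g (x(i := y)) \<partial>PiM I (\<lambda>_. \<mu>) \<partial>\<mu>)"
      if "finite I" "i \<notin> I" "g \<in> borel_measurable (PiM (insert i I) (\<lambda>_. \<mu>))" for i I and g :: "('i \<Rightarrow> 'b) \<Rightarrow> ennreal"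
      using P.product_nn_integral_insert_rev[OF that] .
    have comp: "(\<lambda>x. x i) \<in> borel_measurable (PiM I (\<lambda>_. \<mu>))" if "i \<in> I" for i I
      using measurable_component_singleton[OF that, of "\<lambda>_. \<mu>"] sets_\<mu> by (simp cong: measurable_cong_sets)
    have d: "i \<noteq> j" "i \<noteq> k" "i \<noteq> l" "i \<noteq> m" "j \<noteq> k" "j \<noteq> l" "j \<noteq> m" "k \<noteq> l" "k \<noteq> m" "l \<noteq> m"
      using J(2) by auto
    have "(\<integral>\<^sup>+x. f (x i) (x j) (x k) (x l) (x m) \<partial>PiM J (\<lambda>_. \<mu>))
      = (\<integral>\<^sup>+a. \<integral>\<^sup>+x. f a (x j) (x k) (x l) (x m) \<partial>PiM {j, k, l, m} (\<lambda>_. \<mu>) \<partial>\<mu>)"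
      unfolding J(1) using d by (subst step) (auto intro!: fm comp)
    also have "\<dots> = (\<integral>\<^sup>+a. \<integral>\<^sup>+b. \<integral>\<^sup>+x. f a b (x k) (x l) (x m) \<partial>PiM {k, l, m} (\<lambda>_. \<mu>) \<partial>\<mu> \<partial>\<mu>)"
      using d by (subst step) (auto intro!: fm comp)
    also have "\<dots> = (\<integral>\<^sup>+a. \<integral>\<^sup>+b. \<integral>\<^sup>+c. \<integral>\<^sup>+x. f a b c (x l) (x m) \<partial>PiM {l, m} (\<lambda>_. \<mu>) \<partial>\<mu> \<partial>\<mu> \<partial>\<mu>)"
      using d by (subst step) (auto intro!: fm comp)
    also have "\<dots> = (\<integral>\<^sup>+a. \<integral>\<^sup>+b. \<integral>\<^sup>+c. \<integral>\<^sup>+d. \<integral>\<^sup>+x. f a b c d (x m) \<partial>PiM {m} (\<lambda>_. \<mu>) \<partial>\<mu> \<partial>\<mu> \<partial>\<mu> \<partial>\<mu>)"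
      using d by (subst step) (auto intro!: fm comp)
    also have "\<dots> = iter5 \<mu> f"
      unfolding iter5_def by (subst P.product_nn_integral_singleton) simp_all
    finally show ?thesis .
  qed
  finally show ?thesis .
qed

lemma in_cone_linear_image:
  assumes "linear R" "inj R"
  shows "in_cone (R a) (R b) (R c) (R d) (R e) (R u) \<longleftrightarrow> in_cone a b c d e u"
proof -
  have "r *\<^sub>R (R b - R a) + s *\<^sub>R (R c - R a) + t *\<^sub>R (R d - R a) + q *\<^sub>R (R e - R a)
    = R (r *\<^sub>R (b - a) + s *\<^sub>R (c - a) + t *\<^sub>R (d - a) + q *\<^sub>R (e - a))" for r s t q
    using assms(1) by (simp add: linear_add linear_cmul linear_diff)
  then show ?thesis
    unfolding in_cone_def using assms(2) by (simp add: inj_eq)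
qed

lemma sets_beta_distribution [simp, measurable_cong]: "sets (beta_distribution \<beta>) = sets borel"
  by (simp add: beta_distribution_def sphere_uniform_def)

lemma sets_sphere_uniform [simp, measurable_cong]: "sets sphere_uniform = sets borel"
  by (simp add: sphere_uniform_def)

text \<open>Move all points by a rotation that takes \<open>e4\<close> to \<open>u\<close>: their
  law is unchanged, and cones move along with their points.\<close>

lemma iter5_in_cone:
  fixes u :: "real ^ 4"
  assumes "prob_space (beta_distribution \<beta> :: (real ^ 4) measure)" "norm u = 1"
  shows "iter5 (beta_distribution \<beta>) (\<lambda>a b c d e. of_bool (in_cone a b c d e u))
    = iter5 (beta_distribution \<beta>) (\<lambda>a b c d e. of_bool (in_cone a b c d e (axis 4 1 :: real ^ 4)))"
proof -
  have "\<exists>R :: real ^ 4 \<Rightarrow> real ^ 4. orthogonal_transformation R \<and> R (norm u *\<^sub>R axis 4 1) = u"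
  proof (rule rotation_rightward_line[of u 4])
    fix f :: "real ^ 4 \<Rightarrow> real ^ 4" assume "orthogonal_transformation f" "f (norm u *\<^sub>R axis 4 1) = u"
    then show ?thesis by blast
  qed
  then obtain R :: "real ^ 4 \<Rightarrow> real ^ 4" where R: "orthogonal_transformation R" "R (axis 4 1) = u"
    using assms(2) by auto
  have lin: "linear R" and inj: "inj R"
    using R(1) orthogonal_transformation_linear orthogonal_transformation_inj by blast+
  have "R \<in> borel_measurable borel"
    using lin by (simp add: linear_conv_bounded_linear borel_measurable_continuous_onI linear_continuous_on)
  then have [measurable]: "R \<in> measurable (beta_distribution \<beta>) borel"
    by (simp cong: measurable_cong_sets)
  have "iter5 (beta_distribution \<beta>) (\<lambda>a b c d e. of_bool (in_cone a b c d e u))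
    = iter5 (distr (beta_distribution \<beta>) borel R) (\<lambda>a b c d e. of_bool (in_cone a b c d e u))"
    by (simp only: distr_beta_distribution_orthogonal[OF R(1)])
  also have "\<dots> = iter5 (beta_distribution \<beta>) (\<lambda>a b c d e. of_bool (in_cone (R a) (R b) (R c) (R d) (R e) u))"
    by (rule iter5_distr[OF assms(1)]) (unfold of_bool_def case_prod_beta, measurable)
  also have "\<dots> = iter5 (beta_distribution \<beta>) (\<lambda>a b c d e. of_bool (in_cone a b c d e (axis 4 1 :: real ^ 4)))"
    unfolding R(2)[symmetric] in_cone_linear_image[OF lin inj] ..
  finally show ?thesis .
qed

lemma sep_measurable [measurable (raw)]:
  assumes [measurable]: "f \<in> borel_measurable M" "g \<in> borel_measurable M" "h \<in> borel_measurable M" "k \<in> borel_measurable M"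
    "l \<in> borel_measurable M"
  shows "(\<lambda>x. sep (f x) (g x) (h x) (k x) (l x)) \<in> borel_measurable M"
  unfolding sep_def by measurable

lemma cone_axis_measurable [measurable (raw)]:
  assumes [measurable]: "f \<in> borel_measurable M" "g \<in> borel_measurable M" "h \<in> borel_measurable M" "k \<in> borel_measurable M"
    "l \<in> borel_measurable M"
  shows "(\<lambda>x. cone_axis s (f x) (g x) (h x) (k x) (l x)) \<in> borel_measurable M"
  unfolding cone_axis_def of_bool_def by measurable

text \<open>Separation sees the projections only, so the integral is transported to R^3. There
  \<kappa> = \<beta> + 1/2, whence the exponents \<open>\<kappa> + 1 = \<beta> + 3 / 2\<close> and
  \<open>3 * \<kappa> + 4 = 3 * \<beta> + 11 / 2\<close>.\<close>

lemma iter5_sep: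
  assumes \<beta>: "\<beta> \<ge> -1" and prob: "prob_space (beta_distribution \<beta> :: (real ^ 4) measure)"
  shows "iter5 (beta_distribution \<beta>) sep
    = ennreal (1 - 2 / (Beta (1 / 2) (3 * \<beta> + 13 / 2) * (Beta (1 / 2) (\<beta> + 5 / 2))\<^sup>2) *
        integral {- pi / 2..pi / 2} (\<lambda>\<phi>. cos \<phi> powr (6 * \<beta> + 12) *
        (integral {- pi / 2..\<phi>} (\<lambda>\<theta>. cos \<theta> powr (2 * \<beta> + 4)))\<^sup>2))"
proof -
  obtain k where k: "distr (beta_distribution \<beta> :: (real ^ 4) measure) borel proj3 = density lborel (\<lambda>p. k * ball_weight (\<beta> + 1 / 2) p)"
    using distr_beta_distribution_proj3[OF \<beta>] by blast
  have pm: "proj3 \<in> measurable (beta_distribution \<beta>) borel"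
    using measurable_proj3 by (simp cong: measurable_cong_sets)
  have "prob_space (density lborel (\<lambda>p. k * ball_weight (\<beta> + 1 / 2) p))"
    unfolding k[symmetric] by (rule prob_space.prob_space_distr[OF prob pm])
  from prob_plane_separates[OF this] obtain C r where
    C: "C * (\<integral>\<^sup>+t. pospow (3 * (\<beta> + 1 / 2) + 4) (1 - t\<^sup>2) \<partial>lborel) = 1"
    and r: "r * (\<integral>\<^sup>+t. pospow (\<beta> + 1 / 2 + 1) (1 - t\<^sup>2) \<partial>lborel) = 1"
    and S: "iter5 (density lborel (\<lambda>p. k * ball_weight (\<beta> + 1 / 2) p))
        (\<lambda>p0 p1 p2 p3 p4. indicator {d. d < 0} (triple_det p0 p1 p2 p3 * triple_det p0 p1 p2 p4))
      = C * (\<integral>\<^sup>+t. 2 * (r * (\<integral>\<^sup>+s. indicator {..<t} s * pospow (\<beta> + 1 / 2 + 1) (1 - s\<^sup>2) \<partial>lborel)) *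
            (r * (\<integral>\<^sup>+s. indicator {t<..} s * pospow (\<beta> + 1 / 2 + 1) (1 - s\<^sup>2) \<partial>lborel)) *
            pospow (3 * (\<beta> + 1 / 2) + 4) (1 - t\<^sup>2) \<partial>lborel)"
    unfolding iter5_def by blast
  have e: "3 * (\<beta> + 1 / 2) + 4 = 3 * \<beta> + 11 / 2" "\<beta> + 1 / 2 + 1 = \<beta> + 3 / 2" by simp_all
  have "iter5 (beta_distribution \<beta>) sep
    = iter5 (distr (beta_distribution \<beta>) borel proj3)
        (\<lambda>p0 p1 p2 p3 p4. indicator {d. d < 0} (triple_det p0 p1 p2 p3 * triple_det p0 p1 p2 p4))"
    unfolding sep_def [abs_def] cdet_def
    by (rule iter5_distr[OF prob pm, symmetric]) (unfold case_prod_beta, measurable)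
  also note k
  also note S
  also note nn_integral_beta_cdf_product[OF \<beta> C[unfolded e] r[unfolded e], folded e]
  finally show ?thesis .
qed

section \<open>The expected angle sum\<close>

theorem theorem1p4:
  fixes \<beta> :: real
    and M :: "'w measure"
    and X :: "nat \<Rightarrow> 'w \<Rightarrow> real ^ 4"
  assumes "\<beta> \<ge> -1"
    and "prob_space M"
    and "prob_space.indep_vars M (\<lambda>_. borel) X {0..4}"
    and "\<And>i. i \<in> {0..4} \<Longrightarrow> distr M borel (X i) = beta_distribution \<beta>"
  shows "integrable M (\<lambda>\<omega>. vertex_angle_sum (convex hull ((\<lambda>i. X i \<omega>) ` {0..4}))) \<and>
    prob_space.expectation M (\<lambda>\<omega>. vertex_angle_sum (convex hull ((\<lambda>i. X i \<omega>) ` {0..4}))) =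
      3 / 2 -
      5 * (Gamma (\<beta> + 3))\<^sup>2 * Gamma (3 * \<beta> + 7) /
        (pi powr (3 / 2) * (Gamma (\<beta> + 5 / 2))\<^sup>2 * Gamma (3 * \<beta> + 13 / 2)) *
      integral {- pi / 2..pi / 2} (\<lambda>\<phi>. cos \<phi> powr (6 * \<beta> + 12) *
        (integral {- pi / 2..\<phi>} (\<lambda>\<theta>. cos \<theta> powr (2 * \<beta> + 4)))\<^sup>2)"
proof -
  interpret prob_space M by fact
  let ?\<mu> = "beta_distribution \<beta> :: (real ^ 4) measure"
  let ?\<sigma> = "sphere_uniform :: (real ^ 4) measure"
  interpret \<sigma>: prob_space ?\<sigma> by (rule prob_space_sphere_uniform)
  interpret M\<sigma>: pair_sigma_finite M ?\<sigma> ..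
  have X [measurable]: "X 0 \<in> borel_measurable M" "X 1 \<in> borel_measurable M" "X 2 \<in> borel_measurable M"
    "X 3 \<in> borel_measurable M" "X 4 \<in> borel_measurable M"
    using assms(3) unfolding indep_vars_def2 by auto
  have prob_\<mu>: "prob_space ?\<mu>"
    using prob_space_distr[OF X(1)] assms(4)[of 0] by simp
  interpret \<mu>: prob_space ?\<mu> by (rule prob_\<mu>)
  have J: "{0..4} = {0, 1, 2, 3, 4::nat}" by auto
  have X_J: "X i \<in> borel_measurable M" if "i \<in> {0, 1, 2, 3, 4}" for i
    using that X by auto
  \<comment> \<open>Every ordering of the indices yields the same iterated integral, so that the
    separations share one mean and the cones another.\<close>
  have E: "(\<integral>\<^sup>+\<omega>. f (X i \<omega>) (X j \<omega>) (X k \<omega>) (X l \<omega>) (X m \<omega>) \<partial>M) = iter5 ?\<mu> f"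
    if "{0, 1, 2, 3, 4} = {i, j, k, l, m}" "distinct [i, j, k, l, m]"
      "(\<lambda>(a, b, c, d, e). f a b c d e) \<in> borel_measurable (borel \<Otimes>\<^sub>M borel \<Otimes>\<^sub>M borel \<Otimes>\<^sub>M borel \<Otimes>\<^sub>M borel)" for i j k l m f
    by (rule nn_integral_indep_vars5[OF assms(3) _ that(2) assms(4) that(3)]) (simp_all only: J that(1))
  define \<kappa> where "\<kappa> = iter5 ?\<mu> (\<lambda>a b c d e. of_bool (in_cone a b c d e (axis 4 1 :: real ^ 4)))"
  have cone_m: "(\<lambda>(a, b, c, d, e). of_bool (in_cone a b c d e u) :: ennreal) \<in> borel_measurable (borel \<Otimes>\<^sub>M borel \<Otimes>\<^sub>M borel \<Otimes>\<^sub>M borel \<Otimes>\<^sub>M borel)"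
    for u :: "real ^ 4"
    unfolding of_bool_def case_prod_beta by measurable
  have E_axis: "(\<integral>\<^sup>+\<omega>. cone_axis h (X i \<omega>) (X j \<omega>) (X k \<omega>) (X l \<omega>) (X m \<omega>) \<partial>M) = \<kappa>"
    if "{0, 1, 2, 3, 4} = {i, j, k, l, m}" "distinct [i, j, k, l, m]" "\<bar>h\<bar> = 1" for i j k l m h
    unfolding cone_axis_def \<kappa>_def using that(3)
    by (subst E[OF that(1,2) cone_m]) (rule iter5_in_cone[OF prob_\<mu>], simp)
  have E_sep: "(\<integral>\<^sup>+\<omega>. sep (X i \<omega>) (X j \<omega>) (X k \<omega>) (X l \<omega>) (X m \<omega>) \<partial>M) = iter5 ?\<mu> sep"
    if "{0, 1, 2, 3, 4} = {i, j, k, l, m}" "distinct [i, j, k, l, m]" for i j k l m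
    by (rule E[OF that]) (unfold case_prod_beta, measurable)
  \<comment> \<open>The indicator carries the nested almost sure statement over to a single one on
    \<open>M\<close>.\<close>
  have "(\<integral>\<^sup>+\<omega>. of_bool (\<not> generic (X 0 \<omega>) (X 1 \<omega>) (X 2 \<omega>) (X 3 \<omega>) (X 4 \<omega>)) \<partial>M)
    = iter5 ?\<mu> (\<lambda>a b c d e. of_bool (\<not> generic a b c d e))"
    by (rule E) (simp, simp, unfold of_bool_def case_prod_beta, measurable)
  also have "\<dots> = 0"
    by (rule iter5_eq_0) (use AE_generic[OF assms(1)] in simp)
  finally have "AE \<omega> in M. of_bool (\<not> generic (X 0 \<omega>) (X 1 \<omega>) (X 2 \<omega>) (X 3 \<omega>) (X 4 \<omega>)) = (0 :: ennreal)"
    by (subst (asm) nn_integral_0_iff_AE) (unfold of_bool_def, measurable)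
  then have gen: "AE \<omega> in M. generic (X 0 \<omega>) (X 1 \<omega>) (X 2 \<omega>) (X 3 \<omega>) (X 4 \<omega>)"
    by eventually_elim simp
  define p where "p = iter5 ?\<mu> sep"
  \<comment> \<open>The mean of the pointwise count; the directions \<open>e4\<close> and
    \<open>-e4\<close> contribute alike, as both are unit vectors.\<close>
  have count: "10 * p = 4 + 2 * (10 * \<kappa>)"
  proof -
    let ?s = "\<lambda>i j k l m \<omega>. sep (X i \<omega>) (X j \<omega>) (X k \<omega>) (X l \<omega>) (X m \<omega>)"
    let ?c = "\<lambda>h i j k l m \<omega>. cone_axis h (X i \<omega>) (X j \<omega>) (X k \<omega>) (X l \<omega>) (X m \<omega>)"
    have eq: "(\<integral>\<^sup>+\<omega>. ?s 0 1 2 3 4 \<omega> + ?s 0 1 3 2 4 \<omega> + ?s 0 1 4 2 3 \<omega> + ?s 0 2 3 1 4 \<omega> + ?s 0 2 4 1 3 \<omega> + ?s 0 3 4 1 2 \<omega>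
        + ?s 1 2 3 0 4 \<omega> + ?s 1 2 4 0 3 \<omega> + ?s 1 3 4 0 2 \<omega> + ?s 2 3 4 0 1 \<omega> \<partial>M)
      = (\<integral>\<^sup>+\<omega>. 4 + 2 * (?c 1 0 1 2 3 4 \<omega> + ?c 1 1 0 2 3 4 \<omega> + ?c 1 2 0 1 3 4 \<omega> + ?c 1 3 0 1 2 4 \<omega> + ?c 1 4 0 1 2 3 \<omega>
        + ?c (-1) 0 1 2 3 4 \<omega> + ?c (-1) 1 0 2 3 4 \<omega> + ?c (-1) 2 0 1 3 4 \<omega> + ?c (-1) 3 0 1 2 4 \<omega> + ?c (-1) 4 0 1 2 3 \<omega>) \<partial>M)"
      by (rule nn_integral_cong_AE, use gen in eventually_elim) (rule count_separations)
    have lhs: "(\<integral>\<^sup>+\<omega>. ?s 0 1 2 3 4 \<omega> + ?s 0 1 3 2 4 \<omega> + ?s 0 1 4 2 3 \<omega> + ?s 0 2 3 1 4 \<omega> + ?s 0 2 4 1 3 \<omega> + ?s 0 3 4 1 2 \<omega>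
        + ?s 1 2 3 0 4 \<omega> + ?s 1 2 4 0 3 \<omega> + ?s 1 3 4 0 2 \<omega> + ?s 2 3 4 0 1 \<omega> \<partial>M) = p + p + p + p + p + p + p + p + p + p"
    proof -
      have "integral\<^sup>N M (?s 0 1 2 3 4) = p" "integral\<^sup>N M (?s 0 1 3 2 4) = p" "integral\<^sup>N M (?s 0 1 4 2 3) = p"
        "integral\<^sup>N M (?s 0 2 3 1 4) = p" "integral\<^sup>N M (?s 0 2 4 1 3) = p" "integral\<^sup>N M (?s 0 3 4 1 2) = p"
        "integral\<^sup>N M (?s 1 2 3 0 4) = p" "integral\<^sup>N M (?s 1 2 4 0 3) = p" "integral\<^sup>N M (?s 1 3 4 0 2) = p"
        "integral\<^sup>N M (?s 2 3 4 0 1) = p"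
        unfolding p_def by (rule E_sep; auto)+
      then show ?thesis by (simp add: nn_integral_add del: One_nat_def)
    qed
    have rhs: "(\<integral>\<^sup>+\<omega>. 4 + 2 * (?c 1 0 1 2 3 4 \<omega> + ?c 1 1 0 2 3 4 \<omega> + ?c 1 2 0 1 3 4 \<omega> + ?c 1 3 0 1 2 4 \<omega> + ?c 1 4 0 1 2 3 \<omega>
        + ?c (-1) 0 1 2 3 4 \<omega> + ?c (-1) 1 0 2 3 4 \<omega> + ?c (-1) 2 0 1 3 4 \<omega> + ?c (-1) 3 0 1 2 4 \<omega> + ?c (-1) 4 0 1 2 3 \<omega>) \<partial>M)
      = 4 + 2 * (\<kappa> + \<kappa> + \<kappa> + \<kappa> + \<kappa> + \<kappa> + \<kappa> + \<kappa> + \<kappa> + \<kappa>)"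
    proof -
      have c: "integral\<^sup>N M (?c h 0 1 2 3 4) = \<kappa>" "integral\<^sup>N M (?c h 1 0 2 3 4) = \<kappa>" "integral\<^sup>N M (?c h 2 0 1 3 4) = \<kappa>"
        "integral\<^sup>N M (?c h 3 0 1 2 4) = \<kappa>" "integral\<^sup>N M (?c h 4 0 1 2 3) = \<kappa>" if "\<bar>h\<bar> = 1" for h
        by (rule E_axis; use that in auto)+
      show ?thesis
        using c[of 1] c[of "-1"] by (simp add: nn_integral_add nn_integral_cmult emeasure_space_1 del: One_nat_def)
    qed
    have ten: "x + x + x + x + x + x + x + x + x + x = 10 * x" for x :: ennreal
    proof -
      have "x + x + x + x + x + x + x + x + x + x = (1 + 1 + 1 + 1 + 1 + 1 + 1 + 1 + 1 + 1) * x"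
        by (simp only: distrib_right mult_1_left)
      then show ?thesis by simp
    qed
    show ?thesis using eq unfolding lhs rhs ten .
  qed
  \<comment> \<open>A solid angle is an average over directions, and after Fubini almost every
    direction contributes the same \<open>\<kappa>\<close>.\<close>
  have angle: "(\<integral>\<^sup>+\<omega>. \<integral>\<^sup>+u. of_bool (in_cone (X i \<omega>) (X j \<omega>) (X k \<omega>) (X l \<omega>) (X m \<omega>) u) \<partial>?\<sigma> \<partial>M) = \<kappa>"
    if J': "{0, 1, 2, 3, 4} = {i, j, k, l, m}" "distinct [i, j, k, l, m]" for i j k l m
  proof -
    have [measurable]: "X i \<in> borel_measurable M" "X j \<in> borel_measurable M" "X k \<in> borel_measurable M"
      "X l \<in> borel_measurable M" "X m \<in> borel_measurable M"
      by (rule X_J, simp only: J'(1) insert_iff simp_thms)+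
    have "(\<integral>\<^sup>+\<omega>. \<integral>\<^sup>+u. of_bool (in_cone (X i \<omega>) (X j \<omega>) (X k \<omega>) (X l \<omega>) (X m \<omega>) u) \<partial>?\<sigma> \<partial>M)
      = (\<integral>\<^sup>+u. \<integral>\<^sup>+\<omega>. of_bool (in_cone (X i \<omega>) (X j \<omega>) (X k \<omega>) (X l \<omega>) (X m \<omega>) u) \<partial>M \<partial>?\<sigma>)"
      by (rule M\<sigma>.Fubini'[symmetric]) (unfold of_bool_def case_prod_beta, measurable)
    also have "\<dots> = (\<integral>\<^sup>+u. \<kappa> \<partial>?\<sigma>)"
    proof (rule nn_integral_cong_AE, use AE_norm_sphere_uniform in eventually_elim)
      case (elim u)
      then show ?case
        unfolding \<kappa>_def by (subst E[OF J' cone_m]) (rule iter5_in_cone[OF prob_\<mu>])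
    qed
    also have "\<dots> = \<kappa>" by (simp add: \<sigma>.emeasure_space_1)
    finally show ?thesis .
  qed
  define A where "A i j k l m \<omega> = (\<integral>\<^sup>+u. of_bool (in_cone (X i \<omega>) (X j \<omega>) (X k \<omega>) (X l \<omega>) (X m \<omega>) u) \<partial>?\<sigma>)" for i j k l m \<omega>
  have A_measure: "ennreal (measure ?\<sigma> {u. in_cone (X i \<omega>) (X j \<omega>) (X k \<omega>) (X l \<omega>) (X m \<omega>) u}) = A i j k l m \<omega>" for i j k l m \<omega>
  proof -
    have "{u. in_cone (X i \<omega>) (X j \<omega>) (X k \<omega>) (X l \<omega>) (X m \<omega>) u} \<in> sets borel"
      by measurable
    then have "emeasure ?\<sigma> {u. in_cone (X i \<omega>) (X j \<omega>) (X k \<omega>) (X l \<omega>) (X m \<omega>) u}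
      = (\<integral>\<^sup>+u. indicator {u. in_cone (X i \<omega>) (X j \<omega>) (X k \<omega>) (X l \<omega>) (X m \<omega>) u} u \<partial>?\<sigma>)"
      by (intro nn_integral_indicator[symmetric]) simp
    also have "\<dots> = A i j k l m \<omega>"
      by (simp add: A_def indicator_def)
    finally have "A i j k l m \<omega> = emeasure ?\<sigma> {u. in_cone (X i \<omega>) (X j \<omega>) (X k \<omega>) (X l \<omega>) (X m \<omega>) u}" ..
    then show ?thesis by (simp add: \<sigma>.emeasure_eq_measure)
  qed
  have A_m [measurable]: "A 0 1 2 3 4 \<in> borel_measurable M" "A 1 0 2 3 4 \<in> borel_measurable M" "A 2 0 1 3 4 \<in> borel_measurable M"
    "A 3 0 1 2 4 \<in> borel_measurable M" "A 4 0 1 2 3 \<in> borel_measurable M"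
    unfolding A_def [abs_def] of_bool_def by measurable
  define D where "D \<omega> = vertex_angle_sum (convex hull ((\<lambda>i. X i \<omega>) ` {0..4}))" for \<omega>
  have D: "D \<omega> = measure ?\<sigma> {u. in_cone (X 0 \<omega>) (X 1 \<omega>) (X 2 \<omega>) (X 3 \<omega>) (X 4 \<omega>) u}
     + measure ?\<sigma> {u. in_cone (X 1 \<omega>) (X 0 \<omega>) (X 2 \<omega>) (X 3 \<omega>) (X 4 \<omega>) u}
     + measure ?\<sigma> {u. in_cone (X 2 \<omega>) (X 0 \<omega>) (X 1 \<omega>) (X 3 \<omega>) (X 4 \<omega>) u}
     + measure ?\<sigma> {u. in_cone (X 3 \<omega>) (X 0 \<omega>) (X 1 \<omega>) (X 2 \<omega>) (X 4 \<omega>) u}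
     + measure ?\<sigma> {u. in_cone (X 4 \<omega>) (X 0 \<omega>) (X 1 \<omega>) (X 2 \<omega>) (X 3 \<omega>) u}" for \<omega>
    unfolding D_def J by (simp add: vertex_angle_sum_convex_hull)
  have D_nonneg: "D \<omega> \<ge> 0" for \<omega> unfolding D by simp
  have D_A: "ennreal (D \<omega>) = A 0 1 2 3 4 \<omega> + A 1 0 2 3 4 \<omega> + A 2 0 1 3 4 \<omega> + A 3 0 1 2 4 \<omega> + A 4 0 1 2 3 \<omega>" for \<omega>
    unfolding D A_measure[symmetric] by simp
  have D_m: "D \<in> borel_measurable M"
  proof -
    have "D = (\<lambda>\<omega>. enn2real (A 0 1 2 3 4 \<omega> + A 1 0 2 3 4 \<omega> + A 2 0 1 3 4 \<omega> + A 3 0 1 2 4 \<omega> + A 4 0 1 2 3 \<omega>))"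
      unfolding D_A[symmetric] using D_nonneg by simp
    also have "\<dots> \<in> borel_measurable M" by measurable
    finally show ?thesis .
  qed
  have D_int: "(\<integral>\<^sup>+\<omega>. ennreal (D \<omega>) \<partial>M) = 5 * \<kappa>"
  proof -
    have "integral\<^sup>N M (A 0 1 2 3 4) = \<kappa>" "integral\<^sup>N M (A 1 0 2 3 4) = \<kappa>" "integral\<^sup>N M (A 2 0 1 3 4) = \<kappa>"
      "integral\<^sup>N M (A 3 0 1 2 4) = \<kappa>" "integral\<^sup>N M (A 4 0 1 2 3) = \<kappa>"
      unfolding A_def [abs_def] by (rule angle; auto)+
    then have "(\<integral>\<^sup>+\<omega>. ennreal (D \<omega>) \<partial>M) = \<kappa> + \<kappa> + \<kappa> + \<kappa> + \<kappa>"
      unfolding D_A by (simp add: nn_integral_add del: One_nat_def)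
    also have "\<dots> = (1 + 1 + 1 + 1 + 1) * \<kappa>"
      by (simp only: distrib_right mult_1_left)
    finally show ?thesis by simp
  qed
  define I where "I = integral {- pi / 2..pi / 2} (\<lambda>\<phi>. cos \<phi> powr (6 * \<beta> + 12) *
        (integral {- pi / 2..\<phi>} (\<lambda>\<theta>. cos \<theta> powr (2 * \<beta> + 4)))\<^sup>2)"
  define q where "q = 1 - 2 / (Beta (1 / 2) (3 * \<beta> + 13 / 2) * (Beta (1 / 2) (\<beta> + 5 / 2))\<^sup>2) * I"
  have p: "p = ennreal q"
    unfolding p_def q_def I_def by (rule iter5_sep[OF assms(1) prob_\<mu>])
  \<comment> \<open>Finiteness allows the count to be solved for \<open>\<kappa>\<close> in the
    reals, where subtraction is available.\<close>
  have "\<kappa> < \<infinity>"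
  proof (rule ccontr)
    assume "\<not> \<kappa> < \<infinity>"
    then have "\<kappa> = \<infinity>" by (simp add: less_top[symmetric])
    then have "10 * ennreal q = \<infinity>" using count p by (simp add: ennreal_mult_top)
    then show False by (simp add: ennreal_mult_eq_top_iff)
  qed
  then obtain x where x: "\<kappa> = ennreal x" "x \<ge> 0" by (cases \<kappa>) auto
  have x5: "5 * x = 5 / 2 * q - 1"
  proof -
    have "ennreal (4 + 20 * x) = ennreal 4 + ennreal (2 * (10 * x))"
      using x(2) by (subst ennreal_plus[symmetric]) simp_all
    also have "ennreal (2 * (10 * x)) = 2 * (10 * ennreal x)"
      using x(2) by (simp only: ennreal_mult ennreal_numeral mult_nonneg_nonneg zero_le_numeral)
    finally have eq: "10 * ennreal q = ennreal (4 + 20 * x)"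
      using count x(1) unfolding p by simp
    \<comment> \<open>For negative \<open>q\<close> the left side would be truncated to
      \<open>0\<close>, while the right side is at least \<open>4\<close>.\<close>
    then have "q \<ge> 0" using x(2) by (cases "q \<ge> 0") (auto simp: ennreal_neg)
    then have "ennreal (10 * q) = ennreal (4 + 20 * x)" using eq by (simp add: ennreal_mult'')
    then have "10 * q = 4 + 20 * x"
      using \<open>q \<ge> 0\<close> x(2) by (subst (asm) ennreal_inj) simp_all
    then show ?thesis by simp
  qed
  have nn: "(\<integral>\<^sup>+\<omega>. ennreal (D \<omega>) \<partial>M) = ennreal (5 / 2 * q - 1)"
  proof -
    have "ennreal (5 / 2 * q - 1) = 5 * ennreal x"
      unfolding x5[symmetric] using x(2) by (simp only: ennreal_mult ennreal_numeral zero_le_numeral)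
    then show ?thesis using D_int x(1) by simp
  qed
  have D_integrable: "integrable M D"
    by (rule integrableI_nonneg) (use D_m D_nonneg nn in \<open>auto simp: less_top[symmetric]\<close>)
  have "5 / 2 * q - 1 \<ge> 0" using x5 x(2) by simp
  then have "expectation D = 5 / 2 * q - 1"
    using D_m D_nonneg nn by (subst integral_eq_nn_integral) auto
  also have "\<dots> = 3 / 2 - 5 * (Gamma (\<beta> + 3))\<^sup>2 * Gamma (3 * \<beta> + 7) /
        (pi powr (3 / 2) * (Gamma (\<beta> + 5 / 2))\<^sup>2 * Gamma (3 * \<beta> + 13 / 2)) * I"
  proof -
    have pos: "Gamma (\<beta> + 3) > 0" "Gamma (\<beta> + 5 / 2) > 0" "Gamma (3 * \<beta> + 7) > 0" "Gamma (3 * \<beta> + 13 / 2) > 0"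
      using assms(1) by (auto intro!: Gamma_real_pos)
    \<comment> \<open>\<open>Gamma (1 / 2) = sqrt pi\<close> occurs once in the first Beta value and
      squared through the second, which yields \<open>pi powr (3 / 2)\<close>.\<close>
    have B: "Beta (1 / 2) (3 * \<beta> + 13 / 2) = sqrt pi * Gamma (3 * \<beta> + 13 / 2) / Gamma (3 * \<beta> + 7)"
      "Beta (1 / 2) (\<beta> + 5 / 2) = sqrt pi * Gamma (\<beta> + 5 / 2) / Gamma (\<beta> + 3)"
      by (simp_all add: Beta_def Gamma_one_half_real add.commute)
    have "pi powr (3 / 2) = pi powr (1 + 1 / 2)" by simp
    also have "\<dots> = sqrt pi * (sqrt pi)\<^sup>2" unfolding powr_add powr_half_sqrt[OF pi_ge_zero] by simp
    finally have pi: "pi powr (3 / 2) = sqrt pi * (sqrt pi)\<^sup>2" .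
    have "1 / (Beta (1 / 2) (3 * \<beta> + 13 / 2) * (Beta (1 / 2) (\<beta> + 5 / 2))\<^sup>2)
      = (Gamma (\<beta> + 3))\<^sup>2 * Gamma (3 * \<beta> + 7) / (pi powr (3 / 2) * (Gamma (\<beta> + 5 / 2))\<^sup>2 * Gamma (3 * \<beta> + 13 / 2))" (is "?l = ?r")
      unfolding B pi using pos by (simp add: power_divide power_mult_distrib mult_ac)
    moreover have "5 / 2 * q - 1 = 3 / 2 - 5 * ?l * I"
      unfolding q_def by (simp add: algebra_simps)
    ultimately have "5 / 2 * q - 1 = 3 / 2 - 5 * ?r * I" by simp
    then show ?thesis by (simp add: mult.assoc)
  qed
  finally show ?thesis
    using D_integrable unfolding D_def I_def by blast
qed

end
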